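(* Let $\mathbb{F}$ be a field and $n$ a non-negative integer with $|\mathbb{F}|>2n-2$. Let $\mathcal{S}$ be an optimal symplectic affine subspace of $\mathrm{A}_{2n}(\mathbb{F})$. Then there exist an integer $r\in\{0,1,\dots,n\}$, an optimal affine subspace $\mathcal{W}$ of invertible elements of $\mathrm{M}_r(\mathbb{F})$, and an irreducible optimal symplectic affine subspace $\mathcal{C}$ of $\mathrm{A}_{2n-2r}(\mathbb{F})$ such that $$\mathcal{S}\cong \mathcal{W}\bullet\mathcal{C}.$$ Moreover, the integer $r$ is uniquely determined by $\mathcal{S}$, as well as the equivalence class of $\mathcal{W}$ and the congruence class of $\mathcal{C}$.
   Context: $\mathrm{M}_{k}(\mathbb{F})$ (resp. $\mathrm{M}_{k,l}(\mathbb{F})$) is the space of $k\times k$ (resp. $k\times l$) matrices over $\mathbb{F}$ and $\mathrm{A}_k(\mathbb{F})$ is the space of $k\times k$ alternating matrices (skew-symmetric with zero diagonal). The characteristic of $\mathbb{F}$ is arbitrary. An affine subspace of $\mathrm{A}_{2k}(\mathbb{F})$ is symplectic if all its elements are invertible; it is optimal if it has the greatest possible dimension among the symplectic affine subspaces of $\mathrm{A}_{2k}(\mathbb{F})$. An affine subspace of $\mathrm{M}_r(\mathbb{F})$ consisting of invertible matrices is optimal if it has the greatest possible dimension among affine subspaces of $\mathrm{M}_r(\mathbb{F})$ consisting of invertible matrices. The $0\times 0$ matrix is regarded as invertible. A nonempty set $\mathcal{X}$ of symplectic (i.e. non-degenerate alternating bilinear) forms on a vector space $V$ is irreducible when there is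 no nonzero linear subspace $W$ of $V$ such that the orthogonal $W^{\bot_s}=\{y\in V: s(x,y)=0\ \forall x\in W\}$ includes $W$ for every $s\in\mathcal{X}$ and does not depend on the choice of $s\in\mathcal{X}$. A set of invertible matrices of $\mathrm{A}_{2k}(\mathbb{F})$ is irreducible when the corresponding set of symplectic forms on $\mathbb{F}^{2k}$ (Gram matrices in the standard basis) is irreducible. (For $k=0$ the set consisting of the void matrix is irreducible.) Two subsets $\mathcal{X},\mathcal{Y}$ of $\mathrm{M}_r(\mathbb{F})$ are equivalent when $\mathcal{Y}=P\mathcal{X}Q$ for some $P,Q\in \mathrm{GL}_r(\mathbb{F})$; they are congruent, written $\mathcal{X}\cong\mathcal{Y}$, when $\mathcal{Y}=P\mathcal{X}P^T$ for some $P\in\mathrm{GL}_r(\mathbb{F})$. For subsets $\mathcal{W}\subseteq \mathrm{M}_r(\mathbb{F})$ and $\mathcal{C}\subseteq\mathrm{A}_{2t}(\mathbb{F})$, $$\mathcal{W}\bullet\mathcal{C}:=\left\{\begin{bmatrix}0_{r\times r}&0_{r\times 2t}&M\\ 0_{2t\times r}&C&B\\ -M^T&-B^T&D\end{bmatrix}\;\middle|\;(M,C,B,D)\in\mathcal{W}\times\mathcal{C}\times\mathrm{M}_{2t,r}(\mathbb{F})\times\mathrm{A}_r(\mathbb{F})\right\}\subseteq\mathrm{A}_{2(r+t)}(\mathbb{F}).$$ *)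

theory Defs
  imports "Jordan_Normal_Form.VS_Connect"
begin

definition GL :: "nat \<Rightarrow> 'a::field mat set" where
  "GL r = {P \<in> carrier_mat r r. invertible_mat P}"

definition alternating_mats :: "nat \<Rightarrow> 'a::field mat set" where
  "alternating_mats k =
     {A \<in> carrier_mat k k. transpose_mat A = - A \<and> (\<forall>i<k. A $$ (i, i) = 0)}"

text \<open>Affine subspaces are nonempty: translates of linear subspaces of the square matrices.\<close>

definition affine_subspace_mat :: "nat \<Rightarrow> 'a::field mat set \<Rightarrow> bool" where
  "affine_subspace_mat k S \<longleftrightarrow>
     (\<exists>A \<in> carrier_mat k k. \<exists>W. VectorSpace.subspace class_ring W (module_mat TYPE('a) k k)
        \<and> S = {A + X |X. X \<in> W})"

text \<open>The dimension of an affine subspace is the linear dimension of its direction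
  \<open>{X - Y | X, Y \<in> S}\<close>.\<close>

definition affine_dim_mat :: "nat \<Rightarrow> 'a::field mat set \<Rightarrow> nat" where
  "affine_dim_mat k S =
     vectorspace.dim class_ring
       ((module_mat TYPE('a) k k)\<lparr>carrier := {X - Y |X Y. X \<in> S \<and> Y \<in> S}\<rparr>)"

definition invertible_affine :: "nat \<Rightarrow> 'a::field mat set \<Rightarrow> bool" where
  "invertible_affine r W \<longleftrightarrow> affine_subspace_mat r W \<and> (\<forall>A \<in> W. invertible_mat A)"

definition optimal_invertible_affine :: "nat \<Rightarrow> 'a::field mat set \<Rightarrow> bool" where
  "optimal_invertible_affine r W \<longleftrightarrow> invertible_affine r W
     \<and> (\<forall>W' :: 'a mat set. invertible_affine r W' \<longrightarrow> affine_dim_mat r W' \<le> affine_dim_mat r W)"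

text \<open>Below, \<open>k\<close> is the full size of the matrices.\<close>

definition symplectic_affine :: "nat \<Rightarrow> 'a::field mat set \<Rightarrow> bool" where
  "symplectic_affine k S \<longleftrightarrow> S \<subseteq> alternating_mats k \<and> affine_subspace_mat k S
     \<and> (\<forall>A \<in> S. invertible_mat A)"

definition optimal_symplectic_affine :: "nat \<Rightarrow> 'a::field mat set \<Rightarrow> bool" where
  "optimal_symplectic_affine k S \<longleftrightarrow> symplectic_affine k S
     \<and> (\<forall>S' :: 'a mat set. symplectic_affine k S' \<longrightarrow> affine_dim_mat k S' \<le> affine_dim_mat k S)"

definition bilinear_form ::
  "('a, 'm) ring_scheme \<Rightarrow> ('a, 'v, 'n) module_scheme \<Rightarrow> ('v \<Rightarrow> 'v \<Rightarrow> 'a) \<Rightarrow> bool" where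
  "bilinear_form K V s \<longleftrightarrow>
     (\<forall>x \<in> carrier V. \<forall>y \<in> carrier V. s x y \<in> carrier K)
   \<and> (\<forall>x \<in> carrier V. \<forall>x' \<in> carrier V. \<forall>y \<in> carrier V.
        s (x \<oplus>\<^bsub>V\<^esub> x') y = s x y \<oplus>\<^bsub>K\<^esub> s x' y \<and> s y (x \<oplus>\<^bsub>V\<^esub> x') = s y x \<oplus>\<^bsub>K\<^esub> s y x')
   \<and> (\<forall>c \<in> carrier K. \<forall>x \<in> carrier V. \<forall>y \<in> carrier V.
        s (c \<odot>\<^bsub>V\<^esub> x) y = c \<otimes>\<^bsub>K\<^esub> s x y \<and> s x (c \<odot>\<^bsub>V\<^esub> y) = c \<otimes>\<^bsub>K\<^esub> s x y)"

definition symplectic_form ::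
  "('a, 'm) ring_scheme \<Rightarrow> ('a, 'v, 'n) module_scheme \<Rightarrow> ('v \<Rightarrow> 'v \<Rightarrow> 'a) \<Rightarrow> bool" where
  "symplectic_form K V s \<longleftrightarrow> bilinear_form K V s
     \<and> (\<forall>x \<in> carrier V. s x x = \<zero>\<^bsub>K\<^esub>)
     \<and> (\<forall>x \<in> carrier V. (\<forall>y \<in> carrier V. s x y = \<zero>\<^bsub>K\<^esub>) \<longrightarrow> x = \<zero>\<^bsub>V\<^esub>)"

definition form_orthogonal ::
  "('a, 'm) ring_scheme \<Rightarrow> ('a, 'v, 'n) module_scheme \<Rightarrow> ('v \<Rightarrow> 'v \<Rightarrow> 'a) \<Rightarrow> 'v set \<Rightarrow> 'v set" where
  "form_orthogonal K V s W = {y \<in> carrier V. \<forall>x \<in> W. s x y = \<zero>\<^bsub>K\<^esub>}"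

definition irreducible_forms ::
  "('a, 'm) ring_scheme \<Rightarrow> ('a, 'v, 'n) module_scheme \<Rightarrow> ('v \<Rightarrow> 'v \<Rightarrow> 'a) set \<Rightarrow> bool" where
  "irreducible_forms K V \<X> \<longleftrightarrow> \<X> \<noteq> {} \<and> (\<forall>s \<in> \<X>. symplectic_form K V s)
     \<and> \<not> (\<exists>W. VectorSpace.subspace K W V \<and> W \<noteq> {\<zero>\<^bsub>V\<^esub>}
            \<and> (\<forall>s \<in> \<X>. W \<subseteq> form_orthogonal K V s W)
            \<and> (\<forall>s \<in> \<X>. \<forall>s' \<in> \<X>. form_orthogonal K V s W = form_orthogonal K V s' W))"

text \<open>The bilinear form whose Gram matrix in the standard basis is \<open>A\<close>.\<close>

definition gram_form :: "'a::field mat \<Rightarrow> 'a vec \<Rightarrow> 'a vec \<Rightarrow> 'a" where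
  "gram_form A x y = x \<bullet> (A *\<^sub>v y)"

definition irreducible_mats :: "nat \<Rightarrow> 'a::field mat set \<Rightarrow> bool" where
  "irreducible_mats k \<C> \<longleftrightarrow>
     irreducible_forms class_ring (module_vec TYPE('a) k) (gram_form ` \<C>)"

definition equivalent_mats :: "nat \<Rightarrow> 'a::field mat set \<Rightarrow> 'a mat set \<Rightarrow> bool" where
  "equivalent_mats r \<X> \<Y> \<longleftrightarrow> (\<exists>P \<in> GL r. \<exists>Q \<in> GL r. \<Y> = (\<lambda>X. P * X * Q) ` \<X>)"

definition congruent_mats :: "nat \<Rightarrow> 'a::field mat set \<Rightarrow> 'a mat set \<Rightarrow> bool" where
  "congruent_mats r \<X> \<Y> \<longleftrightarrow> (\<exists>P \<in> GL r. \<Y> = (\<lambda>X. P * X * transpose_mat P) ` \<X>)"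

text \<open>The three-by-three block matrix is read as a two-by-two one: upper left
  \<open>[0, 0; 0, C]\<close>, upper right \<open>[M; B]\<close>, lower left \<open>[-M\<^sup>T, -B\<^sup>T] = -[M; B]\<^sup>T\<close>, lower
  right \<open>D\<close>.\<close>

definition bullet_block ::
  "nat \<Rightarrow> nat \<Rightarrow> 'a::field mat \<Rightarrow> 'a mat \<Rightarrow> 'a mat \<Rightarrow> 'a mat \<Rightarrow> 'a mat" where
  "bullet_block r t M C B D =
     four_block_mat
       (four_block_mat (0\<^sub>m r r) (0\<^sub>m r (2 * t)) (0\<^sub>m (2 * t) r) C) (M @\<^sub>r B)
       (- transpose_mat (M @\<^sub>r B)) D"

definition bullet :: "nat \<Rightarrow> nat \<Rightarrow> 'a::field mat set \<Rightarrow> 'a mat set \<Rightarrow> 'a mat set" where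
  "bullet r t \<W> \<C> =
     {bullet_block r t M C B D |M C B D.
        M \<in> \<W> \<and> C \<in> \<C> \<and> B \<in> carrier_mat (2 * t) r \<and> D \<in> alternating_mats r}"

definition bullet_decomposition ::
  "nat \<Rightarrow> 'a::field mat set \<Rightarrow> nat \<Rightarrow> 'a mat set \<Rightarrow> 'a mat set \<Rightarrow> bool" where
  "bullet_decomposition n \<S> r \<W> \<C> \<longleftrightarrow> r \<le> n
     \<and> optimal_invertible_affine r \<W>
     \<and> optimal_symplectic_affine (2 * (n - r)) \<C> \<and> irreducible_mats (2 * (n - r)) \<C>
     \<and> congruent_mats (2 * n) \<S> (bullet r (n - r) \<W> \<C>)"

end

theory Submission
  imports Defs
begin

text \<open>Idea. For the existence, take \<open>r\<close> maximal such that, after a congruence, all elements of the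
  space vanish on the first \<open>r\<close> rows and \<open>2 n - r\<close> columns. The space is then included in the set
  \<open>W \<bullet> C\<close> built from its blocks, and optimality turns this inclusion into an equality and transfers
  to both factors; a reduction of \<open>C\<close> would produce a larger zero block.

  For the uniqueness, let \<open>P\<close> be a congruence between two such sets and look at its top right block.
  If this block vanishes, irreducibility of \<open>C\<close> forces the middle part of the top rows to vanish as
  well, so that \<open>P\<close> is block lower triangular and induces the equivalence of the \<open>W\<close> parts and the
  congruence of the \<open>C\<close> parts. Otherwise, testing against the free blocks \<open>B\<close> and \<open>D\<close> shows that the
  top right block has rank one, whence the \<open>C\<close> parts have size zero; after a change of bases all
  elements of \<open>W\<close> vanish on a column outside its diagonal entry, and exchanging the two dual basis
  vectors at this position preserves the set and brings us back to the first case.\<close>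

section \<open>Dimensions of spaces of matrices\<close>

text \<open>Nothing forces a congruence to respect the zero block. For r = n = 1 the set is a single
  multiple of the 2 x 2 symplectic matrix J, and P J P^T = det(P) J, so every P of determinant one
  preserves it. Uniqueness therefore cannot rest on a canonical choice of the space spanned by the
  first r basis vectors, and a nonzero top right block has to be treated on its own. Optimality acts
  as a maximality principle: a symplectic affine set that contains an optimal one is equal to it.
  Equalities of sets thus reduce to inclusions, and dimensions are only compared; no formula for the
  greatest dimension enters. The rank one claim comes from adding to an element of the set an
  elementary alternating matrix inside the free blocks: an entry that must stay zero after
  congruence by P changes by a 2 x 2 minor of P, so that minor vanishes.\<close>

abbreviation mat_dim :: "nat \<Rightarrow> 'a::field mat set \<Rightarrow> nat" where
  "mat_dim k U \<equiv> vectorspace.dim class_ring ((module_mat TYPE('a) k k)\<lparr>carrier := U\<rparr>)"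

text \<open>Addition and scaling are merged into one closure condition on matrices; the subspace
  predicate on modules is reached through \<open>mat_subspace_iff\<close>.\<close>

definition mat_subspace :: "nat \<Rightarrow> 'a::field mat set \<Rightarrow> bool" where
  "mat_subspace k U \<longleftrightarrow> U \<subseteq> carrier_mat k k \<and> 0\<^sub>m k k \<in> U \<and> (\<forall>X\<in>U. \<forall>Y\<in>U. \<forall>c. X + c \<cdot>\<^sub>m Y \<in> U)"

lemma mat_subspace_iff:
  "VectorSpace.subspace class_ring U (module_mat TYPE('a::field) k k) \<longleftrightarrow> mat_subspace k U"
proof
  assume "VectorSpace.subspace class_ring U (module_mat TYPE('a) k k)"
  then have s: "submodule class_ring U (module_mat TYPE('a) k k)"
    by (simp add: VectorSpace.subspace_def)
  show "mat_subspace k U" unfolding mat_subspace_def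
    using submodule.subset[OF s] submodule.m_closed[OF s] submodule.zero_closed[OF s]
      submodule.smult_closed[OF s] by (auto simp: module_mat_simps)
next
  assume a: "mat_subspace k U"
  then have U: "U \<subseteq> carrier_mat k k" and z: "0\<^sub>m k k \<in> U"
    and c: "\<And>X Y c. X \<in> U \<Longrightarrow> Y \<in> U \<Longrightarrow> X + c \<cdot>\<^sub>m Y \<in> U" by (auto simp: mat_subspace_def)
  have v: "vectorspace class_ring (module_mat TYPE('a) k k)" by (rule matrix_vs)
  have add: "X + Y \<in> U" if "X \<in> U" "Y \<in> U" for X Y
  proof -
    have "1 \<cdot>\<^sub>m Y = Y" by (intro eq_matI) auto
    then show ?thesis using c[OF that, of 1] by simp
  qed
  have sm: "c \<cdot>\<^sub>m Y \<in> U" if "Y \<in> U" for c Y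
  proof -
    have "0\<^sub>m k k + c \<cdot>\<^sub>m Y = c \<cdot>\<^sub>m Y" using that U by (intro left_add_zero_mat) auto
    then show ?thesis using c[OF z that, of c] by simp
  qed
  have m: "Module.module class_ring (module_mat TYPE('a) k k)" using v by (simp add: vectorspace_def)
  have "submodule class_ring U (module_mat TYPE('a) k k)"
    using m U z add sm by (unfold submodule_def, auto simp: module_mat_simps)
  then show "VectorSpace.subspace class_ring U (module_mat TYPE('a) k k)"
    using v by (simp add: VectorSpace.subspace_def)
qed

text \<open>Linearity is asked only on the carrier, because one type holds the matrices of all
  sizes.\<close>

definition lin_mat_map :: "nat \<Rightarrow> nat \<Rightarrow> ('a::field mat \<Rightarrow> 'a mat) \<Rightarrow> bool" where
  "lin_mat_map k l f \<longleftrightarrow> (\<forall>X\<in>carrier_mat k k. f X \<in> carrier_mat l l)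
     \<and> (\<forall>X\<in>carrier_mat k k. \<forall>Y\<in>carrier_mat k k. \<forall>c. f (X + c \<cdot>\<^sub>m Y) = f X + c \<cdot>\<^sub>m f Y)"

lemma lin_mat_mapD:
  assumes "lin_mat_map k l f" "X \<in> carrier_mat k k" "Y \<in> carrier_mat k k"
  shows "f X \<in> carrier_mat l l" "f (X + c \<cdot>\<^sub>m Y) = f X + c \<cdot>\<^sub>m f Y" "f (X + Y) = f X + f Y"
    "f (X - Y) = f X - f Y" "f (c \<cdot>\<^sub>m X) = c \<cdot>\<^sub>m f X" "f (0\<^sub>m k k) = 0\<^sub>m l l"
proof -
  have c: "f A \<in> carrier_mat l l" if "A \<in> carrier_mat k k" for A
    using that assms(1) by (auto simp: lin_mat_map_def)
  have l: "f (A + c \<cdot>\<^sub>m B) = f A + c \<cdot>\<^sub>m f B" if "A \<in> carrier_mat k k" "B \<in> carrier_mat k k" for A B c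
    using that assms(1) by (auto simp: lin_mat_map_def)
  show "f X \<in> carrier_mat l l" "f (X + c \<cdot>\<^sub>m Y) = f X + c \<cdot>\<^sub>m f Y" using c l assms by auto
  have o: "1 \<cdot>\<^sub>m A = A" for A :: "'a mat" by (intro eq_matI) auto
  show "f (X + Y) = f X + f Y" using l[OF assms(2,3), of 1] by (simp add: o)
  have m: "A + (-1) \<cdot>\<^sub>m B = A - B" if "A \<in> carrier_mat r r" "B \<in> carrier_mat r r" for A B :: "'a mat" and r
    using that by (intro eq_matI) auto
  show "f (X - Y) = f X - f Y"
    using l[OF assms(2,3), of "-1"] m[OF assms(2,3)] m[OF c[OF assms(2)] c[OF assms(3)]] by simp
  have "f (0\<^sub>m k k) = f (0\<^sub>m k k + (-1) \<cdot>\<^sub>m 0\<^sub>m k k)"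
    by (rule arg_cong[where f = f]) (intro eq_matI, auto)
  also have "\<dots> = f (0\<^sub>m k k) + (-1) \<cdot>\<^sub>m f (0\<^sub>m k k)" by (rule l) auto
  also have "\<dots> = 0\<^sub>m l l" using c[of "0\<^sub>m k k"] by (intro eq_matI) auto
  finally show z: "f (0\<^sub>m k k) = 0\<^sub>m l l" .
  have "f (0\<^sub>m k k + c \<cdot>\<^sub>m X) = f (0\<^sub>m k k) + c \<cdot>\<^sub>m f X" using assms by (intro l) auto
  then show "f (c \<cdot>\<^sub>m X) = c \<cdot>\<^sub>m f X" using assms c[OF assms(2)] z by simp
qed

text \<open>The matrices are the image of the vectors of length \<open>k * k\<close> under the
  linear reshaping \<open>?T\<close>, which reads row i from the coordinates starting at
  \<open>i * k\<close>.\<close>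

lemma fin_dim_mat: "vectorspace.fin_dim class_ring (module_mat TYPE('a::field) k k)"
proof -
  let ?T = "\<lambda>v :: 'a vec. mat k k (\<lambda>(i,j). v $ (i * k + j))"
  have ix: "i * k + j < k * k" if "i < k" "j < k" for i j
  proof -
    have "i * k + j < Suc i * k" using that by simp
    also have "\<dots> \<le> k * k" using that by (intro mult_le_mono1) auto
    finally show ?thesis .
  qed
  have l: "linear_map class_ring (module_vec TYPE('a) (k * k)) (module_mat TYPE('a) k k) ?T"
    unfolding linear_map_def mod_hom_def mod_hom_axioms_def LinearCombinations.module_hom_def
    using vec_vs[of "k*k"] matrix_vs[of k k] 
    by (auto simp: vectorspace_def module_mat_simps module_vec_simps ix intro!: eq_matI)
  show ?thesis
  proof (rule linear_map.image_fin_dim[OF l])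
    interpret vec_space "TYPE('a)" "k * k" .
    show "vectorspace.fin_dim class_ring (module_vec TYPE('a) (k * k))" by simp
    have "A \<in> ?T ` carrier_vec (k * k)" if A: "A \<in> carrier_mat k k" for A
    proof (rule image_eqI)
      show "A = ?T (vec (k * k) (\<lambda>m. A $$ (m div k, m mod k)))"
        using A ix by (intro eq_matI) auto
    qed auto
    then show "?T ` carrier (module_vec TYPE('a) (k * k)) = carrier (module_mat TYPE('a) k k)"
      by (auto simp: module_mat_simps module_vec_simps)
  qed
qed

text \<open>A maximal independent subset exists because independent sets are bounded by the
  dimension of the ambient space. Independence and span are recorded in the ambient space as well,
  so that bases of nested subspaces can be compared.\<close>

lemma mat_subspace_basis:
  assumes "mat_subspace k (U :: 'a::field mat set)"
  obtains B where "finite B" "B \<subseteq> U" "vectorspace.basis class_ring ((module_mat TYPE('a) k k)\<lparr>carrier := U\<rparr>) B"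
    "\<not> LinearCombinations.module.lin_dep class_ring (module_mat TYPE('a) k k) B"
    "LinearCombinations.module.span class_ring (module_mat TYPE('a) k k) B = U"
proof -
  interpret V: vectorspace class_ring "module_mat TYPE('a) k k" by (rule matrix_vs)
  have s: "VectorSpace.subspace class_ring U (module_mat TYPE('a) k k)"
    using assms by (simp add: mat_subspace_iff)
  have sm: "submodule class_ring U (module_mat TYPE('a) k k)" using s by simp
  interpret U: vectorspace class_ring "V.vs U" by (rule V.subspace_is_vs[OF s])
  have UV: "U \<subseteq> carrier (module_mat TYPE('a) k k)" using assms by (auto simp: mat_subspace_def module_mat_simps)
  have li: "V.lin_indpt A \<longleftrightarrow> U.lin_indpt A" if "A \<subseteq> U" for A
    using V.span_li_not_depend(2)[OF that sm] by simp
  have "\<exists>A. finite A \<and> maximal A (\<lambda>A. A \<subseteq> carrier (V.vs U) \<and> U.lin_indpt A)"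
  proof (rule maximal_exists)
    show "finite A \<and> card A \<le> V.dim" if "A \<subseteq> carrier (V.vs U) \<and> U.lin_indpt A" for A
    proof -
      have a: "A \<subseteq> U" "U.lin_indpt A" using that by auto
      have "A \<subseteq> carrier (module_mat TYPE('a) k k)" using a UV by auto
      moreover have "V.lin_indpt A" using li[OF a(1)] a(2) by blast
      ultimately show ?thesis using V.li_le_dim[OF fin_dim_mat] by auto
    qed
    show "{} \<subseteq> carrier (V.vs U) \<and> U.lin_indpt {}" by (auto simp: U.lin_dep_def)
  qed
  then obtain B where B: "finite B" "maximal B (\<lambda>A. A \<subseteq> carrier (V.vs U) \<and> U.lin_indpt A)" by auto
  have b: "U.basis B" by (rule U.max_li_is_basis[OF B(2)])
  have BU: "B \<subseteq> U" and BI: "U.lin_indpt B" and BS: "U.span B = U" using b by (auto simp: U.basis_def)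
  have 1: "V.lin_indpt B" using li[OF BU] BI by blast
  have 2: "V.span B = U" using V.span_li_not_depend(1)[OF BU sm] BS by simp
  show thesis by (rule that[OF B(1) BU b 1 2])
qed

text \<open>A basis of \<open>U\<close> stays independent in \<open>U'\<close>, and its cardinality
  reaches the dimension of \<open>U'\<close>; it is then a basis of both.\<close>

lemma mat_subspace_eqI:
  assumes U: "mat_subspace k (U :: 'a::field mat set)" and U': "mat_subspace k U'"
    and sub: "U \<subseteq> U'" and d: "mat_dim k U' \<le> mat_dim k U"
  shows "U = U'"
proof -
  interpret V: vectorspace class_ring "module_mat TYPE('a) k k" by (rule matrix_vs)
  have s: "VectorSpace.subspace class_ring U (module_mat TYPE('a) k k)"
    using U by (simp add: mat_subspace_iff)
  have s': "VectorSpace.subspace class_ring U' (module_mat TYPE('a) k k)"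
    using U' by (simp add: mat_subspace_iff)
  have sm': "submodule class_ring U' (module_mat TYPE('a) k k)" using s' by simp
  interpret U: vectorspace class_ring "V.vs U" by (rule V.subspace_is_vs[OF s])
  interpret U': vectorspace class_ring "V.vs U'" by (rule V.subspace_is_vs[OF s'])
  obtain B where B: "finite B" "B \<subseteq> U" "U.basis B" "V.lin_indpt B" "V.span B = U"
    using mat_subspace_basis[OF U] by blast
  obtain B' where B': "finite B'" "B' \<subseteq> U'" "U'.basis B'" "V.lin_indpt B'" "V.span B' = U'"
    using mat_subspace_basis[OF U'] by blast
  have fd: "U'.fin_dim" unfolding U'.fin_dim_def using B' by (auto simp: U'.basis_def)
  have c: "U'.dim \<le> card B" using d U.dim_basis[OF B(1,3)] by simp
  have BU': "B \<subseteq> U'" using B(2) sub by auto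
  have "U'.lin_indpt B" using V.span_li_not_depend(2)[OF BU' sm'] B(4) by simp
  then have "U'.basis B" using BU' c by (intro U'.dim_li_is_basis fd B(1)) auto
  then have "U'.span B = U'" by (auto simp: U'.basis_def)
  then show ?thesis using V.span_li_not_depend(1)[OF BU' sm'] B(5) by simp
qed

lemma mat_rank_nullity:
  assumes U: "mat_subspace k (U :: 'a::field mat set)" and f: "lin_mat_map k l f"
  shows "mat_dim k U = mat_dim l (f ` U) + mat_dim k {X \<in> U. f X = 0\<^sub>m l l}"
proof -
  interpret V: vectorspace class_ring "module_mat TYPE('a) k k" by (rule matrix_vs)
  interpret W: vectorspace class_ring "module_mat TYPE('a) l l" by (rule matrix_vs)
  have s: "VectorSpace.subspace class_ring U (module_mat TYPE('a) k k)"
    using U by (simp add: mat_subspace_iff)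
  interpret U: vectorspace class_ring "V.vs U" by (rule V.subspace_is_vs[OF s])
  have Uc: "\<And>X. X \<in> U \<Longrightarrow> X \<in> carrier_mat k k" using U by (auto simp: mat_subspace_def)
  interpret T: linear_map class_ring "V.vs U" "module_mat TYPE('a) l l" f
    unfolding linear_map_def mod_hom_def mod_hom_axioms_def LinearCombinations.module_hom_def
    using U.vectorspace_axioms W.vectorspace_axioms lin_mat_mapD(1)[OF f Uc Uc]
      lin_mat_mapD(3)[OF f Uc Uc] lin_mat_mapD(5)[OF f Uc Uc]
    by (auto simp: vectorspace_def module_mat_simps)
  obtain B where B: "finite B" "B \<subseteq> U" "U.basis B" "V.lin_indpt B" "V.span B = U"
    using mat_subspace_basis[OF U] by blast
  have fd: "U.fin_dim" unfolding U.fin_dim_def using B by (auto simp: U.basis_def)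
  show ?thesis using T.rank_nullity[OF fd] by (simp add: T.im_def T.ker_def module_mat_simps)
qed

section \<open>Affine subspaces and their directions\<close>

definition mat_direction :: "'a::field mat set \<Rightarrow> 'a mat set" where
  "mat_direction S = {X - Y |X Y. X \<in> S \<and> Y \<in> S}"

lemma affine_dim_mat_direction: "affine_dim_mat k S = mat_dim k (mat_direction S)"
  by (simp add: affine_dim_mat_def mat_direction_def)

text \<open>The closure condition involves three points: over the field with two elements every set
  is closed under affine combinations of two of its points.\<close>

lemma affine_subspace_mat_iff:
  "affine_subspace_mat k S \<longleftrightarrow> S \<noteq> {} \<and> S \<subseteq> carrier_mat k k
     \<and> (\<forall>A\<in>S. \<forall>X\<in>S. \<forall>Y\<in>S. \<forall>c. A + c \<cdot>\<^sub>m (X - Y) \<in> S)" (is "?L \<longleftrightarrow> ?R")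
proof
  assume ?L
  then obtain A W where A: "A \<in> carrier_mat k k" and W: "mat_subspace k W"
    and S: "S = {A + X |X. X \<in> W}" by (auto simp: affine_subspace_mat_def mat_subspace_iff)
  have Wc: "\<And>X. X \<in> W \<Longrightarrow> X \<in> carrier_mat k k" and W0: "0\<^sub>m k k \<in> W"
    and Wl: "\<And>X Y c. X \<in> W \<Longrightarrow> Y \<in> W \<Longrightarrow> X + c \<cdot>\<^sub>m Y \<in> W"
    using W by (auto simp: mat_subspace_def)
  have "A + B + c \<cdot>\<^sub>m ((A + X) - (A + Y)) \<in> S" if h: "B \<in> W" "X \<in> W" "Y \<in> W" for B X Y c
  proof -
    have "(B + c \<cdot>\<^sub>m X) + (-c) \<cdot>\<^sub>m Y \<in> W" using h by (intro Wl)
    moreover have "A + B + c \<cdot>\<^sub>m ((A + X) - (A + Y)) = A + ((B + c \<cdot>\<^sub>m X) + (-c) \<cdot>\<^sub>m Y)"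
      using A h[THEN Wc] by (intro eq_matI) (auto simp: algebra_simps)
    ultimately show ?thesis unfolding S by blast
  qed
  then show ?R using A Wc W0 unfolding S by auto
next
  assume R: ?R
  then obtain A where A: "A \<in> S" by auto
  have Sc: "\<And>X. X \<in> S \<Longrightarrow> X \<in> carrier_mat k k" using R by auto
  have cl: "\<And>B X Y c. B \<in> S \<Longrightarrow> X \<in> S \<Longrightarrow> Y \<in> S \<Longrightarrow> B + c \<cdot>\<^sub>m (X - Y) \<in> S" using R by auto
  let ?W = "{X - A |X. X \<in> S}"
  have "mat_subspace k ?W" unfolding mat_subspace_def
  proof (intro conjI ballI allI)
    show "?W \<subseteq> carrier_mat k k" using Sc A by (auto intro: minus_carrier_mat)
    have "A - A = 0\<^sub>m k k" using Sc[OF A] by auto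
    then show "0\<^sub>m k k \<in> ?W" using A by (metis (mono_tags, lifting) mem_Collect_eq)
  next
    fix X Y c assume "X \<in> ?W" "Y \<in> ?W"
    then obtain X' Y' where h: "X' \<in> S" "Y' \<in> S" "X = X' - A" "Y = Y' - A" by auto
    have "X + c \<cdot>\<^sub>m Y = (X' + c \<cdot>\<^sub>m (Y' - A)) - A"
      using Sc[OF A] Sc[OF h(1)] Sc[OF h(2)] unfolding h(3,4) by (intro eq_matI) (auto simp: algebra_simps)
    then show "X + c \<cdot>\<^sub>m Y \<in> ?W" using cl[OF h(1,2) A] by auto
  qed
  moreover have "S = {A + X |X. X \<in> ?W}"
  proof -
    have e: "A + (X - A) = X" if "X \<in> S" for X using Sc[OF A] Sc[OF that] by (intro eq_matI) auto
    have "X \<in> {A + X |X. X \<in> ?W}" if "X \<in> S" for X using e[OF that] that by (metis (mono_tags, lifting) mem_Collect_eq)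
    moreover have "X \<in> S" if "X \<in> {A + X |X. X \<in> ?W}" for X using that e by auto
    ultimately show ?thesis by blast
  qed
  ultimately show ?L using Sc[OF A] unfolding affine_subspace_mat_def mat_subspace_iff by blast
qed

lemma affine_subspace_matD:
  assumes "affine_subspace_mat k S"
  shows "S \<noteq> {}" "\<And>X. X \<in> S \<Longrightarrow> X \<in> carrier_mat k k"
    "\<And>A X Y c. A \<in> S \<Longrightarrow> X \<in> S \<Longrightarrow> Y \<in> S \<Longrightarrow> A + c \<cdot>\<^sub>m (X - Y) \<in> S"
  using assms by (auto simp: affine_subspace_mat_iff)

lemma add_direction_mem:
  assumes S: "affine_subspace_mat k S" and A: "A \<in> S" and D: "D \<in> mat_direction S"
  shows "A + c \<cdot>\<^sub>m D \<in> S"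
  using affine_subspace_matD(3)[OF S A] D by (auto simp: mat_direction_def)

lemma mat_subspace_direction:
  assumes S: "affine_subspace_mat k S"
  shows "mat_subspace k (mat_direction S)"
  unfolding mat_subspace_def
proof (intro conjI ballI allI)
  note Sc = affine_subspace_matD(2)[OF S]
  obtain A where A: "A \<in> S" using affine_subspace_matD(1)[OF S] by auto
  show "mat_direction S \<subseteq> carrier_mat k k" using Sc by (auto simp: mat_direction_def intro: minus_carrier_mat)
  have "A - A = 0\<^sub>m k k" using Sc[OF A] by auto
  then show "0\<^sub>m k k \<in> mat_direction S" using A unfolding mat_direction_def by (metis (mono_tags, lifting) mem_Collect_eq)
next
  note Sc = affine_subspace_matD(2)[OF S]
  fix X Y c assume "X \<in> mat_direction S" "Y \<in> mat_direction S"
  then obtain P Q R T where h: "P \<in> S" "Q \<in> S" "R \<in> S" "T \<in> S" "X = P - Q" "Y = R - T"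
    by (auto simp: mat_direction_def)
  have "X + c \<cdot>\<^sub>m Y = (P + c \<cdot>\<^sub>m (R - T)) - Q"
    using h(1-4)[THEN Sc] unfolding h(5,6) by (intro eq_matI) (auto simp: algebra_simps)
  then show "X + c \<cdot>\<^sub>m Y \<in> mat_direction S"
    using affine_subspace_matD(3)[OF S h(1,3,4)] h(2) unfolding mat_direction_def by blast
qed

text \<open>The directions coincide by dimension, and then \<open>S\<close> reaches any X of
  \<open>S'\<close> from a point A of \<open>S\<close> along X - A.\<close>

lemma affine_subspace_mat_eqI:
  assumes S: "affine_subspace_mat k S" and S': "affine_subspace_mat k S'" and sub: "S \<subseteq> S'"
    and d: "affine_dim_mat k S' \<le> affine_dim_mat k S"
  shows "S = S'"
proof -
  have D: "mat_direction S = mat_direction S'"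
  proof (rule mat_subspace_eqI[OF mat_subspace_direction[OF S] mat_subspace_direction[OF S']])
    show "mat_direction S \<subseteq> mat_direction S'" using sub unfolding mat_direction_def by blast
  qed (use d in \<open>simp add: affine_dim_mat_direction\<close>)
  obtain A where A: "A \<in> S" using affine_subspace_matD(1)[OF S] by auto
  have "X \<in> S" if X: "X \<in> S'" for X
  proof -
    have "X - A \<in> mat_direction S" using X A sub unfolding D by (auto simp: mat_direction_def)
    from add_direction_mem[OF S A this, of 1] have "A + 1 \<cdot>\<^sub>m (X - A) \<in> S" .
    moreover have "A + 1 \<cdot>\<^sub>m (X - A) = X"
      using affine_subspace_matD(2)[OF S A] affine_subspace_matD(2)[OF S' X] by (intro eq_matI) auto
    ultimately show ?thesis by simp
  qed
  then show ?thesis using sub by auto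
qed

lemma mat_direction_image:
  assumes f: "lin_mat_map k l f" and S: "S \<subseteq> carrier_mat k k"
  shows "mat_direction (f ` S) = f ` mat_direction S"
proof -
  have "f X - f Y = f (X - Y)" if "X \<in> S" "Y \<in> S" for X Y
    using lin_mat_mapD(4)[OF f subsetD[OF S that(1)] subsetD[OF S that(2)]] by simp
  note e = this
  show ?thesis
  proof
    show "mat_direction (f ` S) \<subseteq> f ` mat_direction S"
    proof
      fix Z assume "Z \<in> mat_direction (f ` S)"
      then obtain X Y where h: "X \<in> S" "Y \<in> S" "Z = f X - f Y" by (auto simp: mat_direction_def)
      then show "Z \<in> f ` mat_direction S" using e[OF h(1,2)] unfolding mat_direction_def by blast
    qed
    show "f ` mat_direction S \<subseteq> mat_direction (f ` S)"
    proof
      fix Z assume "Z \<in> f ` mat_direction S"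
      then obtain X Y where h: "X \<in> S" "Y \<in> S" "Z = f (X - Y)" by (auto simp: mat_direction_def)
      then have "Z = f X - f Y" "f X \<in> f ` S" "f Y \<in> f ` S" using e[OF h(1,2)] by auto
      then show "Z \<in> mat_direction (f ` S)" unfolding mat_direction_def by blast
    qed
  qed
qed

lemma affine_subspace_mat_image:
  assumes S: "affine_subspace_mat k S" and f: "lin_mat_map k l f"
  shows "affine_subspace_mat l (f ` S)"
  unfolding affine_subspace_mat_iff
proof (intro conjI ballI allI)
  note Sc = affine_subspace_matD(2)[OF S]
  show "f ` S \<noteq> {}" using affine_subspace_matD(1)[OF S] by auto
  show "f ` S \<subseteq> carrier_mat l l" using lin_mat_mapD(1)[OF f] Sc by auto
  fix A X Y c assume "A \<in> f ` S" "X \<in> f ` S" "Y \<in> f ` S"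
  then obtain A' X' Y' where h: "A' \<in> S" "X' \<in> S" "Y' \<in> S" "A = f A'" "X = f X'" "Y = f Y'" by auto
  have "f (A' + c \<cdot>\<^sub>m (X' - Y')) = A + c \<cdot>\<^sub>m (X - Y)"
    using lin_mat_mapD(2)[OF f Sc[OF h(1)] minus_carrier_mat[OF Sc[OF h(3)]], of c X']
      lin_mat_mapD(4)[OF f Sc[OF h(2)] Sc[OF h(3)]] h(4-6) by simp
  then show "A + c \<cdot>\<^sub>m (X - Y) \<in> f ` S" using affine_subspace_matD(3)[OF S h(1-3)] by (metis imageI)
qed

lemma affine_rank_nullity:
  assumes S: "affine_subspace_mat k S" and f: "lin_mat_map k l f"
  shows "affine_dim_mat k S = affine_dim_mat l (f ` S) + mat_dim k {X \<in> mat_direction S. f X = 0\<^sub>m l l}"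
proof -
  have "S \<subseteq> carrier_mat k k" using affine_subspace_matD(2)[OF S] by auto
  then show ?thesis unfolding affine_dim_mat_direction
    using mat_rank_nullity[OF mat_subspace_direction[OF S] f] mat_direction_image[OF f] by simp
qed

lemma affine_dim_mat_image_inj:
  assumes S: "affine_subspace_mat k S" and f: "lin_mat_map k l f"
    and inj: "\<And>X. X \<in> carrier_mat k k \<Longrightarrow> f X = 0\<^sub>m l l \<Longrightarrow> X = 0\<^sub>m k k"
  shows "affine_dim_mat l (f ` S) = affine_dim_mat k S"
proof -
  note D = mat_subspace_direction[OF S]
  \<comment> \<open>The kernel of \<open>f\<close> on the direction is that of the identity map;
    rank-nullity for the identity then shows that its dimension is zero.\<close>
  have "{X \<in> mat_direction S. f X = 0\<^sub>m l l} = {X \<in> mat_direction S. (\<lambda>X. X) X = 0\<^sub>m k k}"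
    using D inj lin_mat_mapD(6)[OF f zero_carrier_mat zero_carrier_mat] by (auto simp: mat_subspace_def)
  moreover have "lin_mat_map k k (\<lambda>X :: 'a mat. X)" by (auto simp: lin_mat_map_def)
  ultimately show ?thesis using mat_rank_nullity[OF D, of k "\<lambda>X. X"] affine_rank_nullity[OF S f] by simp
qed
section \<open>Invertible matrices, blocks and congruences\<close>

lemma GL_iff_det: "P \<in> GL n \<longleftrightarrow> P \<in> carrier_mat n n \<and> det P \<noteq> (0 :: 'a::field)"
proof -
  have "invertible_mat P \<longleftrightarrow> det P \<noteq> 0" if P: "P \<in> carrier_mat n n"
  proof
    assume "invertible_mat P"
    then obtain Q where Q: "P * Q = 1\<^sub>m (dim_row P)" "Q * P = 1\<^sub>m (dim_row Q)"
      by (auto simp: invertible_mat_def inverts_mat_def)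
    \<comment> \<open>The definition of invertibility leaves the shape of \<open>Q\<close> open; the
      two identities force it to be square of size \<open>n\<close>.\<close>
    have "dim_col Q = n" using arg_cong[OF Q(1), of dim_col] P by simp
    moreover have "dim_row Q = n" using arg_cong[OF Q(2), of dim_col] P by simp
    ultimately have "Q \<in> carrier_mat n n" by auto
    then have "det P * det Q = 1" using Q(1) det_mult[OF P, of Q] P by simp
    then show "det P \<noteq> 0" by auto
  next
    assume "det P \<noteq> 0"
    from det_non_zero_imp_unit[OF P this, of undefined] obtain Q where
      "Q \<in> carrier_mat n n" "P * Q = 1\<^sub>m n" "Q * P = 1\<^sub>m n"
      by (auto simp: Units_def ring_mat_def)
    then show "invertible_mat P" using P by (auto simp: invertible_mat_def inverts_mat_def)
  qed
  then show ?thesis by (auto simp: GL_def)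
qed

lemma GL_carrier: "P \<in> GL n \<Longrightarrow> P \<in> carrier_mat n n" by (simp add: GL_def)

lemma invertible_mat_iff_GL: "A \<in> carrier_mat n n \<Longrightarrow> invertible_mat A \<longleftrightarrow> A \<in> GL n"
  by (simp add: GL_def)

lemma GL_mult: "P \<in> GL n \<Longrightarrow> Q \<in> GL n \<Longrightarrow> P * Q \<in> GL n"
  by (auto simp: GL_iff_det det_mult)

lemma GL_transpose: "P \<in> GL n \<Longrightarrow> transpose_mat P \<in> GL n"
  by (auto simp: GL_iff_det det_transpose)

lemma GL_one: "1\<^sub>m n \<in> GL n"
  by (auto simp: GL_iff_det)

lemma GL_inverse:
  assumes "P \<in> GL n"
  obtains Q where "Q \<in> GL n" "P * Q = 1\<^sub>m n" "Q * P = 1\<^sub>m n"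
proof -
  have P: "P \<in> carrier_mat n n" "det P \<noteq> 0" using assms by (auto simp: GL_iff_det)
  from det_non_zero_imp_unit[OF P, of undefined] obtain Q where Q:
      "Q \<in> carrier_mat n n" "P * Q = 1\<^sub>m n" "Q * P = 1\<^sub>m n"
    by (auto simp: Units_def ring_mat_def)
  moreover have "det P * det Q = 1" using Q det_mult[OF P(1) Q(1)] by simp
  ultimately have "Q \<in> GL n" by (auto simp: GL_iff_det)
  then show thesis using that Q by blast
qed

text \<open>Vectors are given as coordinate functions, so that block computations become splittings
  of finite sums.\<close>

lemma GL_iff_kernel:
  assumes P: "P \<in> carrier_mat n n"
  shows "P \<in> GL n \<longleftrightarrow> (\<forall>v. (\<forall>i<n. (\<Sum>j<n. P $$ (i,j) * v j) = (0 :: 'a::field)) \<longrightarrow> (\<forall>j<n. v j = 0))"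
proof
  assume "P \<in> GL n"
  then have d: "\<not> (\<exists>v. v \<in> carrier_vec n \<and> v \<noteq> 0\<^sub>v n \<and> P *\<^sub>v v = 0\<^sub>v n)"
    using det_0_iff_vec_prod_zero_field[OF P] by (simp add: GL_iff_det)
  show "\<forall>v. (\<forall>i<n. (\<Sum>j<n. P $$ (i,j) * v j) = 0) \<longrightarrow> (\<forall>j<n. v j = 0)"
  proof (intro allI impI)
    fix v :: "nat \<Rightarrow> 'a" and j assume z: "\<forall>i<n. (\<Sum>j<n. P $$ (i,j) * v j) = 0" and j: "j < n"
    have "P *\<^sub>v vec n v = 0\<^sub>v n"
      using P z by (intro eq_vecI) (auto simp: scalar_prod_def lessThan_atLeast0)
    moreover have "vec n v \<in> carrier_vec n" by simp
    ultimately have "vec n v = 0\<^sub>v n" using d by blast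
    then show "v j = 0" using j by (metis index_vec index_zero_vec(1))
  qed
next
  assume k: "\<forall>v. (\<forall>i<n. (\<Sum>j<n. P $$ (i,j) * v j) = 0) \<longrightarrow> (\<forall>j<n. v j = 0)"
  have "v = 0\<^sub>v n" if v: "v \<in> carrier_vec n" "P *\<^sub>v v = 0\<^sub>v n" for v
  proof -
    have "(\<Sum>j<n. P $$ (i,j) * v $ j) = 0" if "i < n" for i
      using arg_cong[OF v(2), of "\<lambda>w. w $ i"] P v(1) that
      by (auto simp: scalar_prod_def lessThan_atLeast0)
    then show ?thesis using k v(1) by (intro eq_vecI) auto
  qed
  then show "P \<in> GL n" using P det_0_iff_vec_prod_zero_field[OF P] by (auto simp: GL_iff_det)
qed

lemma GL_iff_left_kernel:
  assumes P: "P \<in> carrier_mat n n"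
  shows "P \<in> GL n \<longleftrightarrow> (\<forall>v. (\<forall>j<n. (\<Sum>i<n. v i * P $$ (i,j)) = (0 :: 'a::field)) \<longrightarrow> (\<forall>i<n. v i = 0))"
proof -
  have "P \<in> GL n \<longleftrightarrow> transpose_mat P \<in> GL n"
    using GL_transpose[of P n] GL_transpose[of "transpose_mat P" n] by auto
  also have "\<dots> \<longleftrightarrow> (\<forall>v. (\<forall>j<n. (\<Sum>i<n. v i * P $$ (i,j)) = 0) \<longrightarrow> (\<forall>i<n. v i = 0))"
  proof -
    have "(\<Sum>i<n. transpose_mat P $$ (j,i) * v i) = (\<Sum>i<n. v i * P $$ (i,j))" if "j < n" for j v
      using P that by (intro sum.cong) auto
    then show ?thesis using P by (subst GL_iff_kernel) auto
  qed
  finally show ?thesis .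
qed

lemma GL_kernel:
  assumes "P \<in> GL n" "\<And>i. i < n \<Longrightarrow> (\<Sum>j<n. P $$ (i,j) * v j) = (0 :: 'a::field)" "j < n"
  shows "v j = 0"
  using assms GL_iff_kernel[OF GL_carrier[OF assms(1)]] by blast

lemma GL_left_kernel:
  assumes "P \<in> GL n" "\<And>j. j < n \<Longrightarrow> (\<Sum>i<n. v i * P $$ (i,j)) = (0 :: 'a::field)" "i < n"
  shows "v i = 0"
  using assms GL_iff_left_kernel[OF GL_carrier[OF assms(1)]] by blast

lemma mat_mult_index:
  assumes "A \<in> carrier_mat n m" "B \<in> carrier_mat m k" "i < n" "j < k"
  shows "(A * B) $$ (i,j) = (\<Sum>l<m. A $$ (i,l) * B $$ (l,j))"
  using assms by (auto simp: scalar_prod_def lessThan_atLeast0)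

lemma GL_left_solve:
  assumes P: "P \<in> GL n"
  obtains x where "\<And>j. j < n \<Longrightarrow> (\<Sum>i<n. x i * P $$ (i,j)) = (w j :: 'a::field)"
proof -
  obtain Q where Q: "Q \<in> GL n" "P * Q = 1\<^sub>m n" "Q * P = 1\<^sub>m n" using GL_inverse[OF P] by blast
  show thesis
  proof (rule that)
    fix j assume j: "j < n"
    have "(\<Sum>i<n. (\<Sum>l<n. w l * Q $$ (l,i)) * P $$ (i,j)) = (\<Sum>i<n. \<Sum>l<n. w l * Q $$ (l,i) * P $$ (i,j))"
      by (simp add: sum_distrib_right)
    also have "\<dots> = (\<Sum>l<n. \<Sum>i<n. w l * Q $$ (l,i) * P $$ (i,j))" by (rule sum.swap)
    also have "\<dots> = (\<Sum>l<n. w l * (Q * P) $$ (l,j))"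
      using mat_mult_index[OF GL_carrier[OF Q(1)] GL_carrier[OF P] _ j]
      by (intro sum.cong) (auto simp: sum_distrib_left mult.assoc)
    also have "\<dots> = (\<Sum>l<n. if l = j then w l else 0)"
      unfolding Q(3) using j by (intro sum.cong) auto
    also have "\<dots> = w j" using j by simp
    finally show "(\<Sum>i<n. (\<Sum>l<n. w l * Q $$ (l,i)) * P $$ (i,j)) = w j" .
  qed
qed

text \<open>The m equations are padded with zero rows to a square system. Its row m is zero, so the
  matrix is singular and has a nonzero kernel vector.\<close>

lemma underdetermined_solution:
  assumes "m < n"
  obtains v :: "nat \<Rightarrow> 'a::field" where "\<And>i. i < m \<Longrightarrow> (\<Sum>j<n. a i j * v j) = 0" "\<exists>j<n. v j \<noteq> 0"
proof -
  let ?P = "mat n n (\<lambda>(i,j). if i < m then a i j else 0)"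
  have P: "?P \<in> carrier_mat n n" by simp
  have "?P \<notin> GL n"
  proof
    assume g: "?P \<in> GL n"
    have "(if m = m then 1 else 0 :: 'a) = 0"
    proof (rule GL_left_kernel[OF g, where v = "\<lambda>i. if i = m then 1 else 0" and i = m])
      show "(\<Sum>i<n. (if i = m then 1 else 0) * ?P $$ (i,j)) = 0" if "j < n" for j
        using that assms by (intro sum.neutral) auto
    qed (rule assms)
    then show False by simp
  qed
  then obtain v j where v: "\<forall>i<n. (\<Sum>j<n. ?P $$ (i,j) * v j) = 0" "j < n" "v j \<noteq> 0"
    unfolding GL_iff_kernel[OF P] by blast
  show thesis
  proof (rule that)
    show "(\<Sum>j<n. a i j * v j) = 0" if "i < m" for i
      using v(1)[rule_format, of i] that assms by simp
    show "\<exists>j<n. v j \<noteq> 0" using v by auto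
  qed
qed

text \<open>\<open>f\<close> lists rows and \<open>g\<close> the columns that may carry them. If l <
  m, the rows restricted to these columns satisfy a nontrivial relation, which persists on the other
  columns since the entries there are zero.\<close>

lemma GL_rows_support:
  fixes f g :: "nat \<Rightarrow> nat"
  assumes P: "P \<in> GL n" and inj: "inj_on f {..<m}" and fm: "\<And>i. i < m \<Longrightarrow> f i < n"
    and z: "\<And>i j. i < m \<Longrightarrow> j < n \<Longrightarrow> j \<notin> g ` {..<l} \<Longrightarrow> P $$ (f i, j) = (0 :: 'a::field)"
  shows "m \<le> l"
proof (rule ccontr)
  assume "\<not> m \<le> l"
  then obtain v :: "nat \<Rightarrow> 'a" where v: "\<And>j. j < l \<Longrightarrow> (\<Sum>i<m. P $$ (f i, g j) * v i) = 0" "\<exists>i<m. v i \<noteq> 0"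
    using underdetermined_solution[of l m "\<lambda>j i. P $$ (f i, g j)"] by auto
  obtain i where i: "i < m" "v i \<noteq> 0" using v(2) by auto
  \<comment> \<open>The coefficients \<open>v\<close> are moved to the row indices
    \<open>f i\<close>; injectivity of \<open>f\<close> ensures that no two of them are
    added.\<close>
  define w where "w k = (\<Sum>i<m. if f i = k then v i else 0)" for k
  have "w (f i) = 0"
  proof (rule GL_left_kernel[OF P])
    fix j assume j: "j < n"
    have "(\<Sum>k<n. w k * P $$ (k,j)) = (\<Sum>k<n. \<Sum>i<m. (if f i = k then v i * P $$ (k,j) else 0))"
      unfolding w_def sum_distrib_right by (intro sum.cong) auto
    also have "\<dots> = (\<Sum>i<m. \<Sum>k<n. (if f i = k then v i * P $$ (k,j) else 0))" by (rule sum.swap)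
    also have "\<dots> = (\<Sum>i<m. P $$ (f i,j) * v i)"
      using fm by (intro sum.cong) (auto simp: mult.commute)
    also have "\<dots> = 0"
    proof (cases "j \<in> g ` {..<l}")
      case True then show ?thesis using v(1) by auto
    next
      case False then show ?thesis using z j by auto
    qed
    finally show "(\<Sum>k<n. w k * P $$ (k,j)) = 0" .
  qed (use fm i in auto)
  moreover have "w (f i) = (\<Sum>i'<m. if i' = i then v i else 0)"
    unfolding w_def using inj i by (intro sum.cong) (auto simp: inj_on_def)
  ultimately show False using i by simp
qed

section \<open>Blocks, alternating matrices and the congruence action\<close>

definition blk :: "'a mat \<Rightarrow> nat \<Rightarrow> nat \<Rightarrow> nat \<Rightarrow> nat \<Rightarrow> 'a mat" where
  "blk A a p b q = mat p q (\<lambda>(i,j). A $$ (a + i, b + j))"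

lemma blk_carrier [simp]: "blk A a p b q \<in> carrier_mat p q" "dim_row (blk A a p b q) = p" "dim_col (blk A a p b q) = q"
  by (auto simp: blk_def)

lemma blk_index [simp]: "i < p \<Longrightarrow> j < q \<Longrightarrow> blk A a p b q $$ (i,j) = A $$ (a + i, b + j)"
  by (auto simp: blk_def)

lemma sum_split_at: "(\<Sum>j<a + b :: nat. f j) = (\<Sum>j<a. f j) + (\<Sum>j<b. (f (a + j) :: 'a::comm_monoid_add))"
  by (induct b) (auto simp: add.assoc)

lemma alternating_mats_iff:
  "A \<in> alternating_mats k \<longleftrightarrow> A \<in> carrier_mat k k \<and> (\<forall>i<k. \<forall>j<k. A $$ (i,j) = - A $$ (j,i)) \<and> (\<forall>i<k. A $$ (i,i) = 0)"
proof -
  have "transpose_mat A = - A \<longleftrightarrow> (\<forall>i<k. \<forall>j<k. A $$ (i,j) = - A $$ (j,i))" if A: "A \<in> carrier_mat k k"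
  proof
    assume t: "transpose_mat A = - A"
    have "A $$ (i,j) = - A $$ (j,i)" if "i < k" "j < k" for i j
      using arg_cong[OF t, of "\<lambda>B. B $$ (j,i)"] A that by simp
    then show "\<forall>i<k. \<forall>j<k. A $$ (i,j) = - A $$ (j,i)" by blast
  next
    assume a: "\<forall>i<k. \<forall>j<k. A $$ (i,j) = - A $$ (j,i)"
    show "transpose_mat A = - A"
    proof (rule eq_matI)
      fix i j assume "i < dim_row (- A)" "j < dim_col (- A)"
      then have ij: "i < k" "j < k" using A by auto
      have "A $$ (j,i) = - A $$ (i,j)" using a ij by blast
      then show "transpose_mat A $$ (i,j) = (- A) $$ (i,j)" using A ij by simp
    qed (use A in auto)
  qed
  then show ?thesis by (auto simp: alternating_mats_def)
qed

lemma alternating_matsD: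
  assumes "A \<in> alternating_mats k"
  shows "A \<in> carrier_mat k k" "\<And>i j. i < k \<Longrightarrow> j < k \<Longrightarrow> A $$ (i,j) = - A $$ (j,i)" "\<And>i. i < k \<Longrightarrow> A $$ (i,i) = 0"
  using assms unfolding alternating_mats_iff by blast+

text \<open>The diagonal hypothesis is what makes this work in characteristic two.\<close>

lemma alternating_form_self:
  fixes a :: "nat \<Rightarrow> nat \<Rightarrow> 'a::comm_ring_1"
  assumes "\<And>i j. i < n \<Longrightarrow> j < n \<Longrightarrow> a i j = - a j i" "\<And>i. i < n \<Longrightarrow> a i i = 0"
  shows "(\<Sum>k<n. \<Sum>l<n. x k * a k l * x l) = 0"
  using assms
proof (induct n)
  case (Suc n)
  have "(\<Sum>k<Suc n. \<Sum>l<Suc n. x k * a k l * x l)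
    = (\<Sum>k<n. \<Sum>l<n. x k * a k l * x l) + ((\<Sum>k<n. x k * a k n * x n) + (\<Sum>l<n. x n * a n l * x l)) + x n * a n n * x n"
    by (simp add: sum.distrib algebra_simps)
  also have "(\<Sum>k<n. \<Sum>l<n. x k * a k l * x l) = 0"
  proof (rule Suc.hyps)
    show "a i j = - a j i" if "i < n" "j < n" for i j using that by (intro Suc.prems(1)) auto
    show "a i i = 0" if "i < n" for i using that by (intro Suc.prems(2)) auto
  qed
  also have "(\<Sum>k<n. x k * a k n * x n) + (\<Sum>l<n. x n * a n l * x l) = (\<Sum>k<n. x k * a k n * x n + x n * a n k * x k)"
    by (simp add: sum.distrib)
  also have "\<dots> = 0"
  proof (rule sum.neutral, rule ballI)
    fix k assume "k \<in> {..<n}"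
    then have "a k n = - a n k" by (intro Suc.prems(1)) auto
    then show "x k * a k n * x n + x n * a n k * x k = 0" by (simp add: algebra_simps)
  qed
  finally show ?case using Suc.prems(2) by simp
qed simp

definition cong_mat :: "'a::field mat \<Rightarrow> 'a mat \<Rightarrow> 'a mat" where
  "cong_mat P A = P * A * transpose_mat P"

lemma cong_mat_carrier: "P \<in> carrier_mat n n \<Longrightarrow> A \<in> carrier_mat n n \<Longrightarrow> cong_mat P A \<in> carrier_mat n n"
  unfolding cong_mat_def by auto

lemma cong_mat_index:
  assumes P: "P \<in> carrier_mat n n" and A: "A \<in> carrier_mat n n" and ij: "i < n" "j < n"
  shows "cong_mat P A $$ (i,j) = (\<Sum>k<n. \<Sum>l<n. P $$ (i,k) * A $$ (k,l) * P $$ (j,l))"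
proof -
  have "cong_mat P A $$ (i,j) = (\<Sum>l<n. (P * A) $$ (i,l) * transpose_mat P $$ (l,j))"
    unfolding cong_mat_def using assms by (intro mat_mult_index) auto
  also have "\<dots> = (\<Sum>l<n. \<Sum>k<n. P $$ (i,k) * A $$ (k,l) * P $$ (j,l))"
    using P ij by (intro sum.cong) (auto simp: mat_mult_index[OF P A] sum_distrib_right simp del: index_mult_mat(1))
  finally show ?thesis by (subst sum.swap) 
qed

lemma cong_mat_mult:
  assumes "P \<in> carrier_mat n n" "Q \<in> carrier_mat n n" "A \<in> carrier_mat n n"
  shows "cong_mat P (cong_mat Q A) = cong_mat (P * Q) A"
  using assms unfolding cong_mat_def
  by (simp add: transpose_mult[of P n n Q n] assoc_mult_mat[of _ n n _ n _ n])

lemma cong_mat_one: "A \<in> carrier_mat n n \<Longrightarrow> cong_mat (1\<^sub>m n) A = A"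
  by (simp add: cong_mat_def)

lemma cong_mat_GL: "P \<in> GL n \<Longrightarrow> A \<in> GL n \<Longrightarrow> cong_mat P A \<in> GL n"
  unfolding cong_mat_def by (intro GL_mult GL_transpose)

text \<open>Skew-symmetry alone does not give the zero diagonal in characteristic two. Entry (i,i)
  is the form of \<open>A\<close> at row i of \<open>P\<close> taken twice, so it vanishes by
  \<open>alternating_form_self\<close>.\<close>

lemma cong_mat_alternating:
  assumes P: "P \<in> carrier_mat n n" and A: "A \<in> alternating_mats n"
  shows "cong_mat P A \<in> alternating_mats n"
  unfolding alternating_mats_iff
proof (intro conjI allI impI)
  note Ad = alternating_matsD[OF A]
  show "cong_mat P A \<in> carrier_mat n n" by (rule cong_mat_carrier[OF P Ad(1)])
  fix i assume i: "i < n"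
  show "cong_mat P A $$ (i,i) = 0"
    unfolding cong_mat_index[OF P Ad(1) i i] by (rule alternating_form_self[OF Ad(2) Ad(3)])
  fix j assume j: "j < n"
  have "cong_mat P A $$ (i,j) = (\<Sum>l<n. \<Sum>k<n. P $$ (i,k) * A $$ (k,l) * P $$ (j,l))"
    unfolding cong_mat_index[OF P Ad(1) i j] by (rule sum.swap)
  also have "\<dots> = (\<Sum>l<n. \<Sum>k<n. - (P $$ (j,l) * A $$ (l,k) * P $$ (i,k)))"
  proof (intro sum.cong refl)
    fix l k assume "l \<in> {..<n}" "k \<in> {..<n}"
    then have "A $$ (k,l) = - A $$ (l,k)" by (intro Ad(2)) auto
    then show "P $$ (i,k) * A $$ (k,l) * P $$ (j,l) = - (P $$ (j,l) * A $$ (l,k) * P $$ (i,k))"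
      by (simp add: mult.commute mult.left_commute)
  qed
  also have "\<dots> = - cong_mat P A $$ (j,i)"
    unfolding cong_mat_index[OF P Ad(1) j i] by (simp add: sum_negf)
  finally show "cong_mat P A $$ (i,j) = - cong_mat P A $$ (j,i)" .
qed

lemma lin_mat_map_mult:
  fixes P Q :: "'a::field mat"
  assumes P: "P \<in> carrier_mat k k" and Q: "Q \<in> carrier_mat k k"
  shows "lin_mat_map k k (\<lambda>X. P * X * Q)"
  unfolding lin_mat_map_def
proof (intro conjI ballI allI)
  fix X Y :: "'a mat" and c assume X: "X \<in> carrier_mat k k" and Y: "Y \<in> carrier_mat k k"
  have "P * (X + c \<cdot>\<^sub>m Y) = P * X + c \<cdot>\<^sub>m (P * Y)"
    using P X Y by (subst mult_add_distrib_mat[OF P X]) auto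
  then show "P * (X + c \<cdot>\<^sub>m Y) * Q = P * X * Q + c \<cdot>\<^sub>m (P * Y * Q)"
    using P Q X Y by (simp add: add_mult_distrib_mat[of _ k k _ _ k] mult_smult_assoc_mat[of _ k k _ k])
qed (use P Q in auto)

lemma lin_mat_map_cong_mat: "P \<in> carrier_mat k k \<Longrightarrow> lin_mat_map k k (cong_mat P)"
  unfolding cong_mat_def by (rule lin_mat_map_mult) auto

lemma lin_mat_map_blk:
  assumes "a + p \<le> k" "b + p \<le> k"
  shows "lin_mat_map k p (\<lambda>A. blk A a p b p)"
  unfolding lin_mat_map_def using assms by (auto intro!: eq_matI)

lemma mult_GL_eq_0:
  assumes P: "P \<in> GL k" and Q: "Q \<in> GL k" and X: "X \<in> carrier_mat k k" and z: "P * X * Q = 0\<^sub>m k k"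
  shows "X = 0\<^sub>m k k"
proof -
  obtain P' where P': "P' \<in> GL k" "P' * P = 1\<^sub>m k" using GL_inverse[OF P] by blast
  obtain Q' where Q': "Q' \<in> GL k" "Q * Q' = 1\<^sub>m k" using GL_inverse[OF Q] by blast
  note c = GL_carrier[OF P] GL_carrier[OF Q] GL_carrier[OF P'(1)] GL_carrier[OF Q'(1)] X
  have "P' * (P * X * Q) * Q' = (P' * P) * X * (Q * Q')"
    using c by (simp add: assoc_mult_mat[of _ k k _ k _ k])
  also have "\<dots> = X" using c P' Q' by simp
  finally show ?thesis using z c by simp
qed
section \<open>The bullet construction and optimality\<close>

lemma alternating_mats_lin:
  assumes A: "A \<in> alternating_mats k" and B: "B \<in> alternating_mats k"
  shows "A + c \<cdot>\<^sub>m B \<in> alternating_mats k"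
proof -
  note a = alternating_matsD[OF A] and b = alternating_matsD[OF B]
  have "(A + c \<cdot>\<^sub>m B) $$ (i,j) = - (A + c \<cdot>\<^sub>m B) $$ (j,i)" if ij: "i < k" "j < k" for i j
  proof -
    have "(A + c \<cdot>\<^sub>m B) $$ (i,j) = A $$ (i,j) + c * B $$ (i,j)" using a(1) b(1) ij by simp
    also have "\<dots> = - (A $$ (j,i) + c * B $$ (j,i))" unfolding a(2)[OF ij] b(2)[OF ij] by simp
    also have "\<dots> = - (A + c \<cdot>\<^sub>m B) $$ (j,i)" using a(1) b(1) ij by simp
    finally show ?thesis .
  qed
  moreover have "A + c \<cdot>\<^sub>m B \<in> carrier_mat k k" "\<forall>i<k. (A + c \<cdot>\<^sub>m B) $$ (i,i) = 0"
    using a(1,3) b(1,3) by auto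
  ultimately show ?thesis unfolding alternating_mats_iff by blast
qed

lemma alternating_mats_minus:
  assumes A: "A \<in> alternating_mats k" and B: "B \<in> alternating_mats k"
  shows "A - B \<in> alternating_mats k"
proof -
  have "A + (-1) \<cdot>\<^sub>m B = A - B"
    using alternating_matsD(1)[OF A] alternating_matsD(1)[OF B] by (intro eq_matI) auto
  then show ?thesis using alternating_mats_lin[OF A B, of "-1"] by simp
qed

text \<open>The set \<open>W \<bullet> C\<close> described by the blocks of its elements; \<open>s\<close> is the size of the elements of
  \<open>C\<close>, and the total size is kept in the form \<open>r + s + r\<close> to match the block structure.\<close>

definition bul :: "nat \<Rightarrow> nat \<Rightarrow> 'a::field mat set \<Rightarrow> 'a mat set \<Rightarrow> 'a mat set" where
  "bul r s W C = {A \<in> alternating_mats (r + s + r). (\<forall>i<r. \<forall>j<r + s. A $$ (i,j) = 0)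
     \<and> blk A 0 r (r + s) r \<in> W \<and> blk A r s r s \<in> C}"

lemma bulD:
  assumes "A \<in> bul r s W C"
  shows "A \<in> alternating_mats (r + s + r)" "\<And>i j. i < r \<Longrightarrow> j < r + s \<Longrightarrow> A $$ (i,j) = 0"
    "blk A 0 r (r + s) r \<in> W" "blk A r s r s \<in> C" "A \<in> carrier_mat (r + s + r) (r + s + r)"
  using assms alternating_matsD(1) unfolding bul_def by blast+

lemma blk_alternating:
  assumes A: "A \<in> alternating_mats k" and "a + p \<le> k"
  shows "blk A a p a p \<in> alternating_mats p"
  unfolding alternating_mats_iff
proof (intro conjI allI impI)
  fix i assume i: "i < p" then show "blk A a p a p $$ (i,i) = 0" using assms alternating_matsD(3)[OF A] by simp
  fix j assume j: "j < p"
  have "A $$ (a+i,a+j) = - A $$ (a+j,a+i)" using assms i j by (intro alternating_matsD(2)[OF A]) auto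
  then show "blk A a p a p $$ (i,j) = - blk A a p a p $$ (j,i)" using i j by simp
qed simp

text \<open>The element with prescribed blocks, given entrywise: case distinctions then run on index
  ranges instead of nested \<open>four_block_mat\<close> terms.\<close>

definition bul_mat :: "nat \<Rightarrow> nat \<Rightarrow> 'a::field mat \<Rightarrow> 'a mat \<Rightarrow> 'a mat \<Rightarrow> 'a mat \<Rightarrow> 'a mat" where
  "bul_mat r s M C B D = mat (r + s + r) (r + s + r) (\<lambda>(i,j).
     if i < r then (if j < r + s then 0 else M $$ (i, j - (r + s)))
     else if i < r + s then (if j < r then 0 else if j < r + s then C $$ (i - r, j - r) else B $$ (i - r, j - (r + s)))
     else if j < r then - M $$ (j, i - (r + s)) else if j < r + s then - B $$ (j - r, i - (r + s))
     else D $$ (i - (r + s), j - (r + s)))"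

lemma bullet_block_eq:
  assumes "M \<in> carrier_mat r r" "C \<in> carrier_mat (2*t) (2*t)" "B \<in> carrier_mat (2*t) r" "D \<in> carrier_mat r r"
  shows "bullet_block r t M C B D = bul_mat r (2 * t) M C B D"
  unfolding bullet_block_def bul_mat_def append_rows_def using assms
  by (intro eq_matI) auto

lemma bul_mat_mem:
  assumes M: "M \<in> W" "M \<in> carrier_mat r r" and C: "C \<in> CC" "C \<in> alternating_mats s"
    and D: "D \<in> alternating_mats r"
  shows "bul_mat r s M C B D \<in> bul r s W CC"
proof -
  note c = alternating_matsD[OF C(2)] and d = alternating_matsD[OF D]
  have "bul_mat r s M C B D \<in> alternating_mats (r + s + r)"
    unfolding alternating_mats_iff
  proof (intro conjI allI impI)
    show "bul_mat r s M C B D \<in> carrier_mat (r + s + r) (r + s + r)" by (simp add: bul_mat_def)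
    fix i assume i: "i < r + s + r"
    then show "bul_mat r s M C B D $$ (i,i) = 0" using c(3) d(3) by (auto simp: bul_mat_def)
    fix j assume j: "j < r + s + r"
    have 1: "C $$ (i - r, j - r) = - C $$ (j - r, i - r)" if "r \<le> i" "i < r + s" "r \<le> j" "j < r + s"
      using that by (intro c(2)) auto
    have 2: "D $$ (i - (r + s), j - (r + s)) = - D $$ (j - (r + s), i - (r + s))" if "r + s \<le> i" "r + s \<le> j"
      using that i j by (intro d(2)) auto
    show "bul_mat r s M C B D $$ (i,j) = - bul_mat r s M C B D $$ (j,i)"
      using i j 1 2 by (auto simp: bul_mat_def)
  qed
  moreover have "blk (bul_mat r s M C B D) 0 r (r + s) r = M"
    using M by (intro eq_matI) (auto simp: bul_mat_def)
  moreover have "blk (bul_mat r s M C B D) r s r s = C"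
    using c(1) by (intro eq_matI) (auto simp: bul_mat_def)
  ultimately show ?thesis using M C by (auto simp: bul_def bul_mat_def)
qed

lemma bul_mat_blk:
  assumes A: "A \<in> alternating_mats (r + s + r)" and z: "\<And>i j. i < r \<Longrightarrow> j < r + s \<Longrightarrow> A $$ (i,j) = 0"
  shows "A = bul_mat r s (blk A 0 r (r + s) r) (blk A r s r s) (blk A r s (r + s) r) (blk A (r + s) r (r + s) r)"
    (is "_ = ?B")
proof (rule eq_matI)
  note a = alternating_matsD[OF A]
  fix i j assume "i < dim_row ?B" "j < dim_col ?B"
  then have i: "i < r + s + r" and j: "j < r + s + r" by (auto simp: bul_mat_def)
  have 1: "A $$ (i,j) = - A $$ (j,i)" by (rule a(2)[OF i j])
  \<comment> \<open>Cases 3, 6 and 7 are the blocks below the diagonal; they are read off their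
    mirror images through skew-symmetry.\<close>
  consider "i < r" "j < r + s" | "i < r" "r + s \<le> j" | "r \<le> i" "i < r + s" "j < r" | "r \<le> i" "i < r + s" "r \<le> j" "j < r + s"
    | "r \<le> i" "i < r + s" "r + s \<le> j" | "r + s \<le> i" "j < r" | "r + s \<le> i" "r \<le> j" "j < r + s" | "r + s \<le> i" "r + s \<le> j"
    by linarith
  then show "A $$ (i,j) = ?B $$ (i,j)"
  proof cases
    case 3 then show ?thesis using i j 1 z[of j i] by (simp add: bul_mat_def)
  next
    case 6 then show ?thesis unfolding 1 using i j by (simp add: bul_mat_def)
  next
    case 7 then show ?thesis unfolding 1 using i j by (simp add: bul_mat_def)
  qed (use i j z in \<open>auto simp: bul_mat_def\<close>)
qed (use alternating_matsD(1)[OF A] in \<open>auto simp: bul_mat_def\<close>)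

lemma bullet_eq_bul:
  assumes W: "W \<subseteq> carrier_mat r r" and C: "CC \<subseteq> alternating_mats (2 * t)"
  shows "bullet r t W CC = bul r (2 * t) W CC"
proof -
  have e: "bullet_block r t M C B D = bul_mat r (2 * t) M C B D"
    if "M \<in> W" "C \<in> CC" "B \<in> carrier_mat (2*t) r" "D \<in> alternating_mats r" for M C B D
    using that W C alternating_matsD(1) by (intro bullet_block_eq) blast+
  have "bullet r t W CC \<subseteq> bul r (2 * t) W CC"
  proof
    fix A assume "A \<in> bullet r t W CC"
    then obtain M C' B D where h: "M \<in> W" "C' \<in> CC" "B \<in> carrier_mat (2*t) r" "D \<in> alternating_mats r"
      "A = bullet_block r t M C' B D" by (auto simp: bullet_def)
    show "A \<in> bul r (2 * t) W CC" unfolding h(5) e[OF h(1-4)] using h W C by (intro bul_mat_mem) auto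
  qed
  moreover have "bul r (2 * t) W CC \<subseteq> bullet r t W CC"
  proof
    fix A assume A: "A \<in> bul r (2 * t) W CC"
    let ?M = "blk A 0 r (r + 2 * t) r" and ?C = "blk A r (2 * t) r (2 * t)"
      and ?B = "blk A r (2 * t) (r + 2 * t) r" and ?D = "blk A (r + 2 * t) r (r + 2 * t) r"
    have D: "?D \<in> alternating_mats r" by (rule blk_alternating[OF bulD(1)[OF A]]) auto
    have "A = bul_mat r (2 * t) ?M ?C ?B ?D" by (rule bul_mat_blk[OF bulD(1)[OF A] bulD(2)[OF A]])
    also have "\<dots> = bullet_block r t ?M ?C ?B ?D" using bulD(3,4)[OF A] D by (intro e[symmetric]) auto
    finally have eq: "A = bullet_block r t ?M ?C ?B ?D" .
    show "A \<in> bullet r t W CC" unfolding bullet_def mem_Collect_eq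
      by (intro exI conjI) (rule eq, use bulD(3,4)[OF A] D in auto)
  qed
  ultimately show ?thesis by blast
qed

text \<open>By blocks \<open>A\<close> is anti-triangular with M, C and -M^T on the antidiagonal.
  The three block rows, applied to a vector, give everything needed for an argument on
  kernels.\<close>

lemma bul_GL_iff:
  assumes A: "A \<in> alternating_mats (r + s + r)" and z: "\<And>i j. i < r \<Longrightarrow> j < r + s \<Longrightarrow> A $$ (i,j) = 0"
  shows "A \<in> GL (r + s + r) \<longleftrightarrow> blk A 0 r (r + s) r \<in> GL r \<and> blk A r s r s \<in> GL s"
proof -
  note a = alternating_matsD[OF A]
  let ?M = "blk A 0 r (r + s) r" and ?C = "blk A r s r s" and ?N = "r + s + r"
  have sp: "(\<Sum>j<r + s + r. f j) = (\<Sum>j<r. f j) + (\<Sum>j<s. f (r + j)) + (\<Sum>j<r. f (r + s + j))" for f :: "nat \<Rightarrow> 'a"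
    by (simp add: sum_split_at)
  have z2: "A $$ (r + i, j) = 0" if "i < s" "j < r" for i j
    using a(2)[of "r + i" j] z[of j "r + i"] that by simp
  have row1: "(\<Sum>j<?N. A $$ (i,j) * v j) = (\<Sum>j<r. ?M $$ (i,j) * v (r + s + j))" if "i < r" for i v
    using that z by (simp add: sp)
  have row2: "(\<Sum>j<?N. A $$ (r + i,j) * v j)
      = (\<Sum>j<s. ?C $$ (i,j) * v (r + j)) + (\<Sum>j<r. A $$ (r + i, r + s + j) * v (r + s + j))" if "i < s" for i v
    using that z2 by (simp add: sp)
  have row3: "(\<Sum>j<?N. A $$ (r + s + i,j) * v j)
      = - (\<Sum>j<r. v j * ?M $$ (j,i)) + (\<Sum>j<s. A $$ (r + s + i, r + j) * v (r + j))
        + (\<Sum>j<r. A $$ (r + s + i, r + s + j) * v (r + s + j))" if i: "i < r" for i v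
  proof -
    have "(\<Sum>j<r. A $$ (r + s + i, j) * v j) = (\<Sum>j<r. - (v j * ?M $$ (j,i)))"
    proof (rule sum.cong[OF refl])
      fix j assume "j \<in> {..<r}"
      then show "A $$ (r + s + i, j) * v j = - (v j * ?M $$ (j,i))"
        using a(2)[of "r + s + i" j] i by simp
    qed
    then show ?thesis by (simp add: sp sum_negf)
  qed
  show ?thesis
  proof (intro iffI conjI)
    assume g: "A \<in> GL ?N"
    show M: "?M \<in> GL r" unfolding GL_iff_left_kernel[OF blk_carrier(1)]
    proof (intro allI impI)
      fix u :: "nat \<Rightarrow> 'a" and i assume u: "\<forall>j<r. (\<Sum>i<r. u i * ?M $$ (i,j)) = 0" and i: "i < r"
      \<comment> \<open>A left kernel vector u of M, extended by zero, meets only the block -M^T of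
        \<open>A\<close>, hence lies in the kernel of \<open>A\<close>.\<close>
      let ?v = "\<lambda>j. if j < r then u j else 0"
      have "?v i = 0"
      proof (rule GL_kernel[OF g, where v = ?v and j = i])
        fix k assume k: "k < ?N"
        consider "k < r" | i where "k = r + i" "i < s" | i where "k = r + s + i" "i < r"
          using k by (metis add_diff_inverse_nat add_less_cancel_left not_less)
        then show "(\<Sum>j<?N. A $$ (k,j) * ?v j) = 0"
        proof cases
          case 1 then show ?thesis by (subst row1) auto
        next
          case 2 then show ?thesis by (simp only:, subst row2) auto
        next
          case 3
          have "(\<Sum>j<r. ?v j * ?M $$ (j,i)) = 0" using u 3 by simp
          then show ?thesis using 3 by (simp only:, subst row3) auto
        qed
      qed (use i in auto)
      then show "u i = 0" using i by simp
    qed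
    show "?C \<in> GL s" unfolding GL_iff_kernel[OF blk_carrier(1)]
    proof (intro allI impI)
      fix y :: "nat \<Rightarrow> 'a" and l assume y: "\<forall>i<s. (\<Sum>j<s. ?C $$ (i,j) * y j) = 0" and l: "l < s"
      \<comment> \<open>For y in the kernel of C, the part x is chosen so that -M^T x cancels the
        contribution of y to the last block row; then (x, y, 0) is in the kernel of
        \<open>A\<close>.\<close>
      obtain x where x: "\<And>j. j < r \<Longrightarrow> (\<Sum>i<r. x i * ?M $$ (i,j)) = (\<Sum>k<s. A $$ (r + s + j, r + k) * y k)"
        using GL_left_solve[OF M, of "\<lambda>j. (\<Sum>k<s. A $$ (r + s + j, r + k) * y k)"] by blast
      let ?v = "\<lambda>j. if j < r then x j else if j < r + s then y (j - r) else 0"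
      have "?v (r + l) = 0"
      proof (rule GL_kernel[OF g, where v = ?v and j = "r + l"])
        fix k assume k: "k < ?N"
        consider "k < r" | i where "k = r + i" "i < s" | i where "k = r + s + i" "i < r"
          using k by (metis add_diff_inverse_nat add_less_cancel_left not_less)
        then show "(\<Sum>j<?N. A $$ (k,j) * ?v j) = 0"
        proof cases
          case 1 then show ?thesis by (subst row1) auto
        next
          case 2
          have "(\<Sum>j<s. ?C $$ (i,j) * ?v (r + j)) = 0" using y 2 by simp
          then show ?thesis using 2 by (simp only:, subst row2) auto
        next
          case 3
          have "(\<Sum>j<r. ?v j * ?M $$ (j,i)) = (\<Sum>j<s. A $$ (r + s + i, r + j) * ?v (r + j))" using x 3 by simp
          then show ?thesis using 3 by (simp only:, subst row3) auto
        qed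
      qed (use l in auto)
      then show "y l = 0" using l by simp
    qed
  next
    assume g: "?M \<in> GL r \<and> ?C \<in> GL s"
    show "A \<in> GL ?N" unfolding GL_iff_kernel[OF a(1)]
    proof (intro allI impI)
      fix v :: "nat \<Rightarrow> 'a" and l assume v: "\<forall>i<?N. (\<Sum>j<?N. A $$ (i,j) * v j) = 0" and l: "l < ?N"
      \<comment> \<open>Back substitution: the first block row kills the last part of v, the second
        then the middle part, the third the first part.\<close>
      have v3: "v (r + s + j) = 0" if "j < r" for j
        using g v row1[of _ v] by (intro GL_kernel[of ?M r "\<lambda>j. v (r + s + j)" j, OF _ _ that]) auto
      have v2: "v (r + j) = 0" if "j < s" for j
      proof (rule GL_kernel[of ?C s "\<lambda>j. v (r + j)" j, OF _ _ that])
        show "?C \<in> GL s" using g by simp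
        show "(\<Sum>j<s. ?C $$ (i,j) * v (r + j)) = 0" if "i < s" for i
          using v[rule_format, of "r + i"] row2[OF that, of v] v3 that by simp
      qed
      have v1: "v j = 0" if "j < r" for j
      proof (rule GL_left_kernel[of ?M r v, OF _ _ that])
        show "?M \<in> GL r" using g by simp
        show "(\<Sum>i<r. v i * ?M $$ (i,j)) = 0" if "j < r" for j
          using v[rule_format, of "r + s + j"] row3[OF that, of v] v3 v2 that by simp
      qed
      consider "l < r" | i where "l = r + i" "i < s" | i where "l = r + s + i" "i < r"
        using l by (metis add_diff_inverse_nat add_less_cancel_left not_less)
      then show "v l = 0" using v1 v2 v3 by cases auto
    qed
  qed
qed

section \<open>Projections to the two factors, dimensions and optimality\<close>

lemma blk_minus:
  assumes "X \<in> carrier_mat k k" "Y \<in> carrier_mat k k" "a + p \<le> k" "b + p \<le> k"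
  shows "blk (X - Y) a p b p = blk X a p b p - blk Y a p b p"
  using assms by (intro eq_matI) auto

lemma blk_add_smult:
  assumes "X \<in> carrier_mat k k" "Y \<in> carrier_mat k k" "a + p \<le> k" "b + p \<le> k"
  shows "blk (X + c \<cdot>\<^sub>m Y) a p b p = blk X a p b p + c \<cdot>\<^sub>m blk Y a p b p"
  using assms by (intro eq_matI) auto

lemma bul_ex:
  assumes W: "W \<subseteq> carrier_mat r r" and C: "CC \<subseteq> alternating_mats s" and M: "M \<in> W" and C': "C' \<in> CC"
  obtains A where "A \<in> bul r s W CC" "blk A 0 r (r + s) r = M" "blk A r s r s = C'"
proof -
  have 0: "0\<^sub>m r r \<in> alternating_mats r" by (auto simp: alternating_mats_iff)
  have Cm: "C' \<in> alternating_mats s" using C C' by auto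
  let ?A = "bul_mat r s M C' (0\<^sub>m s r) (0\<^sub>m r r)"
  \<comment> \<open>Membership in the set built from two singletons returns the blocks as
    equalities.\<close>
  have "?A \<in> bul r s {M} {C'}" using W M Cm 0 by (intro bul_mat_mem) auto
  from bulD[OF this] show thesis
    using M C' by (intro that[of ?A]) (auto simp: bul_def)
qed

lemma bul_blk_images:
  assumes W: "W \<subseteq> carrier_mat r r" "W \<noteq> {}" and C: "CC \<subseteq> alternating_mats s" "CC \<noteq> {}"
  shows "(\<lambda>A. blk A 0 r (r + s) r) ` bul r s W CC = W" "(\<lambda>A. blk A r s r s) ` bul r s W CC = CC"
proof -
  obtain M C' where h: "M \<in> W" "C' \<in> CC" using W C by auto
  have "M' \<in> (\<lambda>A. blk A 0 r (r + s) r) ` bul r s W CC" if "M' \<in> W" for M'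
    using bul_ex[OF W(1) C(1) that h(2)] by (metis imageI)
  then show "(\<lambda>A. blk A 0 r (r + s) r) ` bul r s W CC = W" using bulD(3) by blast
  have "C'' \<in> (\<lambda>A. blk A r s r s) ` bul r s W CC" if "C'' \<in> CC" for C''
    using bul_ex[OF W(1) C(1) h(1) that] by (metis imageI)
  then show "(\<lambda>A. blk A r s r s) ` bul r s W CC = CC" using bulD(4) by blast
qed

lemma symplectic_affine_bul:
  assumes W: "invertible_affine r W" and C: "symplectic_affine s CC"
  shows "symplectic_affine (r + s + r) (bul r s W CC)"
proof -
  have Wa: "affine_subspace_mat r W" and Ca: "affine_subspace_mat s CC" and Cal: "CC \<subseteq> alternating_mats s"
    using W C by (auto simp: invertible_affine_def symplectic_affine_def)
  have Wg: "\<And>M. M \<in> W \<Longrightarrow> M \<in> GL r" and Cg: "\<And>M. M \<in> CC \<Longrightarrow> M \<in> GL s"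
    using W C affine_subspace_matD(2)[OF Wa] affine_subspace_matD(2)[OF Ca]
    by (auto simp: invertible_affine_def symplectic_affine_def GL_def)
  have Wc: "W \<subseteq> carrier_mat r r" using affine_subspace_matD(2)[OF Wa] by auto
  show ?thesis unfolding symplectic_affine_def
  proof (intro conjI ballI)
    show "bul r s W CC \<subseteq> alternating_mats (r + s + r)" by (auto simp: bul_def)
    show "invertible_mat A" if A: "A \<in> bul r s W CC" for A
      using bul_GL_iff[OF bulD(1,2)[OF A]] bulD(3,4)[OF A] Wg Cg
      by (simp add: invertible_mat_iff_GL[OF bulD(5)[OF A]])
    obtain M C' where h: "M \<in> W" "C' \<in> CC"
      using affine_subspace_matD(1)[OF Wa] affine_subspace_matD(1)[OF Ca] by auto
    show "affine_subspace_mat (r + s + r) (bul r s W CC)" unfolding affine_subspace_mat_iff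
    proof (intro conjI ballI allI)
      show "bul r s W CC \<noteq> {}" using bul_ex[OF Wc Cal h] by blast
      show "bul r s W CC \<subseteq> carrier_mat (r + s + r) (r + s + r)" using bulD(5) by blast
      fix A X Y c assume A: "A \<in> bul r s W CC" and X: "X \<in> bul r s W CC" and Y: "Y \<in> bul r s W CC"
      note c = bulD(5)[OF A] bulD(5)[OF X] bulD(5)[OF Y]
      have al: "A + c \<cdot>\<^sub>m (X - Y) \<in> alternating_mats (r + s + r)"
        by (rule alternating_mats_lin[OF bulD(1)[OF A] alternating_mats_minus[OF bulD(1)[OF X] bulD(1)[OF Y]]])
      have z: "(A + c \<cdot>\<^sub>m (X - Y)) $$ (i,j) = 0" if "i < r" "j < r + s" for i j
        using c bulD(2)[OF A that] bulD(2)[OF X that] bulD(2)[OF Y that] that by simp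
      have "blk (A + c \<cdot>\<^sub>m (X - Y)) a p b p = blk A a p b p + c \<cdot>\<^sub>m (blk X a p b p - blk Y a p b p)"
        if "a + p \<le> r + s + r" "b + p \<le> r + s + r" for a b p
        using blk_add_smult[OF c(1) minus_carrier_mat[OF c(3)] that] blk_minus[OF c(2,3) that] by simp
      then have "blk (A + c \<cdot>\<^sub>m (X - Y)) 0 r (r + s) r \<in> W" "blk (A + c \<cdot>\<^sub>m (X - Y)) r s r s \<in> CC"
        using affine_subspace_matD(3)[OF Wa bulD(3)[OF A] bulD(3)[OF X] bulD(3)[OF Y]]
          affine_subspace_matD(3)[OF Ca bulD(4)[OF A] bulD(4)[OF X] bulD(4)[OF Y]] by simp_all
      then show "A + c \<cdot>\<^sub>m (X - Y) \<in> bul r s W CC" using al z by (simp add: bul_def)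
    qed
  qed
qed

text \<open>For the inclusion from right to left, the blocks of Z are differences M - N and P - Q;
  an element A with blocks N and Q is moved by Z to one with blocks M and P.\<close>

lemma mat_direction_bul:
  assumes W: "W \<subseteq> carrier_mat r r" "W \<noteq> {}" and C: "CC \<subseteq> alternating_mats s" "CC \<noteq> {}"
  shows "mat_direction (bul r s W CC) = bul r s (mat_direction W) (mat_direction CC)"
proof (intro equalityI subsetI)
  fix Z assume "Z \<in> mat_direction (bul r s W CC)"
  then obtain X Y where X: "X \<in> bul r s W CC" and Y: "Y \<in> bul r s W CC" and Z: "Z = X - Y"
    by (auto simp: mat_direction_def)
  note c = bulD(5)[OF X] bulD(5)[OF Y]
  have "Z \<in> alternating_mats (r + s + r)" unfolding Z by (rule alternating_mats_minus[OF bulD(1)[OF X] bulD(1)[OF Y]])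
  moreover have "Z $$ (i,j) = 0" if "i < r" "j < r + s" for i j
    using c bulD(2)[OF X that] bulD(2)[OF Y that] that by (simp add: Z)
  moreover have "blk Z 0 r (r + s) r \<in> mat_direction W" "blk Z r s r s \<in> mat_direction CC"
    using blk_minus[OF c, of 0 r "r + s"] blk_minus[OF c, of r s r] bulD(3,4)[OF X] bulD(3,4)[OF Y]
    unfolding mat_direction_def Z by auto
  ultimately show "Z \<in> bul r s (mat_direction W) (mat_direction CC)" by (simp add: bul_def)
next
  fix Z assume Z: "Z \<in> bul r s (mat_direction W) (mat_direction CC)"
  obtain M N where M: "M \<in> W" "N \<in> W" "blk Z 0 r (r + s) r = M - N"
    using bulD(3)[OF Z] by (auto simp: mat_direction_def)
  obtain P Q where P: "P \<in> CC" "Q \<in> CC" "blk Z r s r s = P - Q"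
    using bulD(4)[OF Z] by (auto simp: mat_direction_def)
  obtain A where A: "A \<in> bul r s W CC" "blk A 0 r (r + s) r = N" "blk A r s r s = Q"
    using bul_ex[OF W(1) C(1) M(2) P(2)] by blast
  note c = bulD(5)[OF A(1)] bulD(5)[OF Z]
  have "A + 1 \<cdot>\<^sub>m Z \<in> alternating_mats (r + s + r)" by (rule alternating_mats_lin[OF bulD(1)[OF A(1)] bulD(1)[OF Z]])
  moreover have "(A + 1 \<cdot>\<^sub>m Z) $$ (i,j) = 0" if "i < r" "j < r + s" for i j
    using c bulD(2)[OF A(1) that] bulD(2)[OF Z that] that by simp
  moreover have "blk (A + 1 \<cdot>\<^sub>m Z) 0 r (r + s) r = M"
  proof -
    have "M \<in> carrier_mat r r" "N \<in> carrier_mat r r" using M W by auto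
    then show ?thesis using blk_add_smult[OF c, of 0 r "r + s" 1] A M by (auto intro!: eq_matI)
  qed
  moreover have "blk (A + 1 \<cdot>\<^sub>m Z) r s r s = P"
  proof -
    have "P \<in> carrier_mat s s" "Q \<in> carrier_mat s s" using P C alternating_matsD(1) by auto
    then show ?thesis using blk_add_smult[OF c, of r s r 1] A P by (auto intro!: eq_matI)
  qed
  ultimately have "A + 1 \<cdot>\<^sub>m Z \<in> bul r s W CC" using M P by (simp add: bul_def)
  moreover have "Z = (A + 1 \<cdot>\<^sub>m Z) - A" using c by (intro eq_matI) auto
  ultimately show "Z \<in> mat_direction (bul r s W CC)" using A(1) unfolding mat_direction_def by blast
qed

text \<open>Rank-nullity for the projections to the two blocks: the remaining summand does not depend on
  the factor onto which one projects.\<close>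

lemma affine_dim_bul:
  assumes W: "invertible_affine r W" and C: "symplectic_affine s CC"
  shows "affine_dim_mat (r + s + r) (bul r s W CC) = affine_dim_mat r W + mat_dim (r + s + r) (bul r s {0\<^sub>m r r} (mat_direction CC))"
    "affine_dim_mat (r + s + r) (bul r s W CC) = affine_dim_mat s CC + mat_dim (r + s + r) (bul r s (mat_direction W) {0\<^sub>m s s})"
proof -
  have Wa: "affine_subspace_mat r W" and Ca: "affine_subspace_mat s CC" and Cal: "CC \<subseteq> alternating_mats s"
    using W C by (auto simp: invertible_affine_def symplectic_affine_def)
  have Wc: "W \<subseteq> carrier_mat r r" using affine_subspace_matD(2)[OF Wa] by auto
  note ne = affine_subspace_matD(1)[OF Wa] affine_subspace_matD(1)[OF Ca]
  have S: "affine_subspace_mat (r + s + r) (bul r s W CC)"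
    using symplectic_affine_bul[OF W C] by (simp add: symplectic_affine_def)
  have z: "0\<^sub>m r r \<in> mat_direction W" "0\<^sub>m s s \<in> mat_direction CC"
    using mat_subspace_direction[OF Wa] mat_subspace_direction[OF Ca] by (auto simp: mat_subspace_def)
  have "{X \<in> mat_direction (bul r s W CC). blk X 0 r (r + s) r = 0\<^sub>m r r} = bul r s {0\<^sub>m r r} (mat_direction CC)"
    unfolding mat_direction_bul[OF Wc ne(1) Cal ne(2)] using z by (auto simp: bul_def)
  then show "affine_dim_mat (r + s + r) (bul r s W CC) = affine_dim_mat r W + mat_dim (r + s + r) (bul r s {0\<^sub>m r r} (mat_direction CC))"
    using affine_rank_nullity[OF S, of r "\<lambda>A. blk A 0 r (r + s) r"] lin_mat_map_blk[of 0 r "r + s + r" "r + s"]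
      bul_blk_images[OF Wc ne(1) Cal ne(2)] by simp
  have "{X \<in> mat_direction (bul r s W CC). blk X r s r s = 0\<^sub>m s s} = bul r s (mat_direction W) {0\<^sub>m s s}"
    unfolding mat_direction_bul[OF Wc ne(1) Cal ne(2)] using z by (auto simp: bul_def)
  then show "affine_dim_mat (r + s + r) (bul r s W CC) = affine_dim_mat s CC + mat_dim (r + s + r) (bul r s (mat_direction W) {0\<^sub>m s s})"
    using affine_rank_nullity[OF S, of s "\<lambda>A. blk A r s r s"] lin_mat_map_blk[of r s "r + s + r" r]
      bul_blk_images[OF Wc ne(1) Cal ne(2)] by simp
qed

text \<open>Replacing one factor by a competitor changes the total dimension exactly by the change
  in that factor, so a better factor would give a better set.\<close>

lemma optimal_bul_factors:
  fixes W CC :: "'a::field mat set"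
  assumes O: "optimal_symplectic_affine (r + s + r) (bul r s W CC)"
    and W: "invertible_affine r W" and C: "symplectic_affine s CC"
  shows "optimal_invertible_affine r W" "optimal_symplectic_affine s CC"
proof -
  have max: "affine_dim_mat (r + s + r) (bul r s W' C') \<le> affine_dim_mat (r + s + r) (bul r s W CC)"
    if "invertible_affine r W'" "symplectic_affine s C'" for W' C' :: "'a mat set"
    using O symplectic_affine_bul[OF that] by (auto simp: optimal_symplectic_affine_def)
  show "optimal_invertible_affine r W" unfolding optimal_invertible_affine_def
  proof (intro conjI allI impI)
    fix W' :: "'a mat set" assume W': "invertible_affine r W'"
    show "affine_dim_mat r W' \<le> affine_dim_mat r W"
      using max[OF W' C] affine_dim_bul(1)[OF W C] affine_dim_bul(1)[OF W' C] by linarith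
  qed (rule W)
  show "optimal_symplectic_affine s CC" unfolding optimal_symplectic_affine_def
  proof (intro conjI allI impI)
    fix C' :: "'a mat set" assume C': "symplectic_affine s C'"
    show "affine_dim_mat s C' \<le> affine_dim_mat s CC"
      using max[OF W C'] affine_dim_bul(2)[OF W C] affine_dim_bul(2)[OF W C'] by linarith
  qed (rule C)
qed

lemma optimal_symplectic_affine_eq:
  assumes S: "optimal_symplectic_affine k S" and T: "symplectic_affine k T" and "S \<subseteq> T"
  shows "S = T"
  using assms by (intro affine_subspace_mat_eqI[of k]) (auto simp: optimal_symplectic_affine_def symplectic_affine_def)

lemma optimal_invertible_affine_eq:
  assumes S: "optimal_invertible_affine k S" and T: "invertible_affine k T" and "S \<subseteq> T"
  shows "S = T"
  using assms by (intro affine_subspace_mat_eqI[of k]) (auto simp: optimal_invertible_affine_def invertible_affine_def)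

lemma optimal_symplectic_affine_cong:
  fixes S :: "'a::field mat set"
  assumes S: "optimal_symplectic_affine k S" and P: "P \<in> GL k"
  shows "optimal_symplectic_affine k (cong_mat P ` S)"
proof -
  have Sa: "affine_subspace_mat k S" and Sal: "S \<subseteq> alternating_mats k" and Sg: "\<And>A. A \<in> S \<Longrightarrow> invertible_mat A"
    and mx: "\<And>T :: 'a mat set. symplectic_affine k T \<Longrightarrow> affine_dim_mat k T \<le> affine_dim_mat k S"
    using S by (auto simp: optimal_symplectic_affine_def symplectic_affine_def)
  note l = lin_mat_map_cong_mat[OF GL_carrier[OF P]]
  have "affine_dim_mat k (cong_mat P ` S) = affine_dim_mat k S"
    using mult_GL_eq_0[OF P GL_transpose[OF P]] by (intro affine_dim_mat_image_inj[OF Sa l]) (auto simp: cong_mat_def)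
  moreover have "symplectic_affine k (cong_mat P ` S)" unfolding symplectic_affine_def
  proof (intro conjI)
    show "cong_mat P ` S \<subseteq> alternating_mats k" using cong_mat_alternating[OF GL_carrier[OF P]] Sal by auto
    show "affine_subspace_mat k (cong_mat P ` S)" by (rule affine_subspace_mat_image[OF Sa l])
    have "cong_mat P A \<in> GL k" if "A \<in> S" for A
      using cong_mat_GL[OF P] Sg[OF that] affine_subspace_matD(2)[OF Sa that] by (simp add: GL_def)
    then show "\<forall>A\<in>cong_mat P ` S. invertible_mat A" by (auto simp: GL_def)
  qed
  ultimately show ?thesis using mx by (simp add: optimal_symplectic_affine_def)
qed

lemma optimal_invertible_affine_equiv:
  fixes S :: "'a::field mat set"
  assumes S: "optimal_invertible_affine k S" and P: "P \<in> GL k" and Q: "Q \<in> GL k"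
  shows "optimal_invertible_affine k ((\<lambda>X. P * X * Q) ` S)"
proof -
  have Sa: "affine_subspace_mat k S" and Sg: "\<And>A. A \<in> S \<Longrightarrow> invertible_mat A"
    and mx: "\<And>T :: 'a mat set. invertible_affine k T \<Longrightarrow> affine_dim_mat k T \<le> affine_dim_mat k S"
    using S by (auto simp: optimal_invertible_affine_def invertible_affine_def)
  note l = lin_mat_map_mult[OF GL_carrier[OF P] GL_carrier[OF Q]]
  have "affine_dim_mat k ((\<lambda>X. P * X * Q) ` S) = affine_dim_mat k S"
    using mult_GL_eq_0[OF P Q] by (intro affine_dim_mat_image_inj[OF Sa l]) auto
  moreover have "invertible_affine k ((\<lambda>X. P * X * Q) ` S)" unfolding invertible_affine_def
  proof (intro conjI)
    show "affine_subspace_mat k ((\<lambda>X. P * X * Q) ` S)" by (rule affine_subspace_mat_image[OF Sa l])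
    have "P * A * Q \<in> GL k" if "A \<in> S" for A
      using GL_mult[OF GL_mult[OF P] Q] Sg[OF that] affine_subspace_matD(2)[OF Sa that] by (simp add: GL_def)
    then show "\<forall>A\<in>(\<lambda>X. P * X * Q) ` S. invertible_mat A" by (auto simp: GL_def)
  qed
  ultimately show ?thesis using mx by (simp add: optimal_invertible_affine_def)
qed

lemma optimal_zero_block_eq_bul:
  assumes S: "optimal_symplectic_affine (r + s + r) S"
    and z: "\<And>A i j. A \<in> S \<Longrightarrow> i < r \<Longrightarrow> j < r + s \<Longrightarrow> A $$ (i,j) = 0"
  obtains W CC where "S = bul r s W CC" "optimal_invertible_affine r W" "optimal_symplectic_affine s CC"
proof -
  define W where "W = (\<lambda>A. blk A 0 r (r + s) r) ` S"
  define CC where "CC = (\<lambda>A. blk A r s r s) ` S"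
  have Sa: "affine_subspace_mat (r + s + r) S" and Sal: "S \<subseteq> alternating_mats (r + s + r)"
    and Sg: "\<And>A. A \<in> S \<Longrightarrow> invertible_mat A"
    using S by (auto simp: optimal_symplectic_affine_def symplectic_affine_def)
  have g: "blk A 0 r (r + s) r \<in> GL r \<and> blk A r s r s \<in> GL s" if A: "A \<in> S" for A
    using bul_GL_iff[of A r s] Sal A z[OF A] Sg[OF A] affine_subspace_matD(2)[OF Sa A]
    by (auto simp: invertible_mat_iff_GL)
  have W: "invertible_affine r W" unfolding invertible_affine_def
  proof
    show "affine_subspace_mat r W" unfolding W_def
      by (rule affine_subspace_mat_image[OF Sa lin_mat_map_blk]) auto
    show "\<forall>A\<in>W. invertible_mat A" using g by (auto simp: W_def GL_def)
  qed
  have C: "symplectic_affine s CC" unfolding symplectic_affine_def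
  proof (intro conjI)
    show "affine_subspace_mat s CC" unfolding CC_def
      by (rule affine_subspace_mat_image[OF Sa lin_mat_map_blk]) auto
    show "\<forall>A\<in>CC. invertible_mat A" using g by (auto simp: CC_def GL_def)
    show "CC \<subseteq> alternating_mats s" using Sal by (auto simp: CC_def intro!: blk_alternating)
  qed
  have "S \<subseteq> bul r s W CC" using Sal z by (auto simp: bul_def W_def CC_def)
  then have "S = bul r s W CC" by (rule optimal_symplectic_affine_eq[OF S symplectic_affine_bul[OF W C]])
  moreover from this have "optimal_invertible_affine r W" "optimal_symplectic_affine s CC"
    using optimal_bul_factors[OF _ W C] S by auto
  ultimately show thesis by (rule that)
qed
section \<open>Irreducibility and the existence of a decomposition\<close>

lemma GL_swap_rows:
  assumes Q: "Q \<in> GL m" and lj: "l < m" "j < m"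
  shows "mat m m (\<lambda>(i,c). (Q $$ (if i = l then j else if i = j then l else i, c) :: 'a::field)) \<in> GL m"
    (is "?R \<in> GL m")
proof -
  let ?s = "\<lambda>i. if i = l then j else if i = j then l else i"
  have b: "bij_betw ?s {..<m} {..<m}"
    by (rule bij_betw_byWitness[where f' = ?s]) (use lj in auto)
  show ?thesis
  proof (subst GL_iff_left_kernel, simp, intro allI impI)
    fix v :: "nat \<Rightarrow> 'a" and i assume v: "\<forall>c<m. (\<Sum>i<m. v i * ?R $$ (i,c)) = 0" and i: "i < m"
    have "v (?s (?s i)) = 0"
    proof (rule GL_left_kernel[OF Q, where v = "\<lambda>i. v (?s i)" and i = "?s i"])
      fix c assume c: "c < m"
      have "(\<Sum>i<m. v (?s i) * Q $$ (i,c)) = (\<Sum>i<m. v (?s (?s i)) * Q $$ (?s i,c))"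
        using sum.reindex_bij_betw[OF b, of "\<lambda>i. v (?s i) * Q $$ (i,c)"] by simp
      also have "\<dots> = (\<Sum>i<m. v i * ?R $$ (i,c))" using c lj by (intro sum.cong) auto
      finally show "(\<Sum>i<m. v (?s i) * Q $$ (i,c)) = 0" using v c by simp
    qed (use i lj in auto)
    then show "v i = 0" by (auto split: if_splits)
  qed
qed

text \<open>Exchange step: a combination of the rows with a nonzero coefficient at row l can take
  the place of row l.\<close>

lemma GL_replace_row:
  assumes Q: "Q \<in> GL m" and l: "l < m" "w l \<noteq> (0 :: 'a::field)"
    and x: "\<And>c. c < m \<Longrightarrow> x c = (\<Sum>i<m. w i * Q $$ (i,c))"
  shows "mat m m (\<lambda>(i,c). if i = l then x c else Q $$ (i,c)) \<in> GL m" (is "?R \<in> GL m")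
proof (subst GL_iff_left_kernel, simp, intro allI impI)
  fix v :: "nat \<Rightarrow> 'a" and i assume v: "\<forall>c<m. (\<Sum>i<m. v i * ?R $$ (i,c)) = 0" and i: "i < m"
  let ?u = "\<lambda>i. v l * w i + (if i = l then 0 else v i)"
  have u: "?u i = 0" if "i < m" for i
  proof (rule GL_left_kernel[OF Q, where v = ?u, OF _ that])
    fix c assume c: "c < m"
    have "(\<Sum>i<m. ?u i * Q $$ (i,c)) = v l * x c + (\<Sum>i<m. if i = l then 0 else v i * Q $$ (i,c))"
      unfolding x[OF c] sum_distrib_left sum.distrib[symmetric]
      by (intro sum.cong) (auto simp: algebra_simps)
    also have "v l * x c = (\<Sum>i<m. if i = l then v l * x c else 0)" using l by simp
    also have "\<dots> + (\<Sum>i<m. if i = l then 0 else v i * Q $$ (i,c)) = (\<Sum>i<m. v i * ?R $$ (i,c))"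
      unfolding sum.distrib[symmetric] using c by (intro sum.cong) auto
    finally show "(\<Sum>i<m. ?u i * Q $$ (i,c)) = 0" using v c by simp
  qed
  have "v l = 0" using u[OF l(1)] l(2) by simp
  then show "v i = 0" using u[OF i] by (cases "i = l") auto
qed

text \<open>The rows of index less than \<open>l\<close> form a basis of the subspace generated by \<open>U\<close>.\<close>

lemma GL_adapted_rows:
  assumes Q: "Q \<in> GL m" and k: "k \<le> m" and rU: "\<And>i. i < k \<Longrightarrow> row Q i \<in> U"
    and U: "U \<subseteq> carrier_vec m"
  obtains l Q' where "k \<le> l" "l \<le> m" "Q' \<in> GL m" "\<And>i. i < k \<Longrightarrow> row Q' i = row Q i"
    "\<And>i. i < l \<Longrightarrow> row Q' i \<in> U"
    "\<And>x w i. x \<in> U \<Longrightarrow> (\<And>c. c < m \<Longrightarrow> x $ c = (\<Sum>i<m. w i * Q' $$ (i,c))) \<Longrightarrow> l \<le> i \<Longrightarrow> i < m \<Longrightarrow> w i = (0 :: 'a::field)"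
proof -
  define good where "good l \<longleftrightarrow> k \<le> l \<and> l \<le> m \<and> (\<exists>Q'\<in>GL m. (\<forall>i<k. row Q' i = row Q i) \<and> (\<forall>i<l. row Q' i \<in> U))" for l
  define l where "l = (GREATEST l. good l)"
  have bd: "y \<le> m" if "good y" for y using that by (simp add: good_def)
  have "good k" using Q k rU by (auto simp: good_def)
  then have gl: "good l" unfolding l_def by (rule GreatestI_nat) (use bd in blast)
  have mx: "y \<le> l" if "good y" for y unfolding l_def by (rule Greatest_le_nat[of good, OF that]) (use bd in blast)
  obtain Q' where kl: "k \<le> l" "l \<le> m" and Q': "Q' \<in> GL m" "\<And>i. i < k \<Longrightarrow> row Q' i = row Q i" "\<And>i. i < l \<Longrightarrow> row Q' i \<in> U"
    using gl by (auto simp: good_def)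
  show thesis
  proof (rule that[OF kl Q'])
    fix x w j
    assume x: "x \<in> U" "\<And>c. c < m \<Longrightarrow> x $ c = (\<Sum>i<m. w i * Q' $$ (i,c))" and j: "l \<le> j" "j < m"
    show "w j = 0"
    proof (rule ccontr)
      assume wj: "w j \<noteq> 0"
      \<comment> \<open>Row j is moved to position l and there replaced by x, in which it has a
        nonzero coefficient. This yields one more leading row in \<open>U\<close>, against the
        choice of l as greatest.\<close>
      let ?s = "\<lambda>i. if i = l then j else if i = j then l else i"
      let ?R = "mat m m (\<lambda>(i,c). Q' $$ (?s i, c))"
      have lm: "l < m" using j by simp
      have R: "?R \<in> GL m" by (rule GL_swap_rows[OF Q'(1) lm j(2)])
      have b: "bij_betw ?s {..<m} {..<m}"
        by (rule bij_betw_byWitness[where f' = ?s]) (use lm j in auto)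
      let ?T = "mat m m (\<lambda>(i,c). if i = l then x $ c else ?R $$ (i,c))"
      have T: "?T \<in> GL m"
      proof (rule GL_replace_row[OF R lm, where w = "\<lambda>i. w (?s i)"])
        show "w (?s l) \<noteq> 0" using wj by simp
        fix c assume c: "c < m"
        have "x $ c = (\<Sum>i<m. w (?s i) * Q' $$ (?s i,c))"
          unfolding x(2)[OF c] using sum.reindex_bij_betw[OF b, of "\<lambda>i. w i * Q' $$ (i,c)"] by simp
        also have "\<dots> = (\<Sum>i<m. w (?s i) * ?R $$ (i,c))" using c by (intro sum.cong) auto
        finally show "x $ c = (\<Sum>i<m. w (?s i) * ?R $$ (i,c))" .
      qed
      have c: "Q' \<in> carrier_mat m m" using GL_carrier[OF Q'(1)] .
      have r1: "row ?T i = row Q' i" if "i < l" for i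
        using that lm j c by (intro eq_vecI) auto
      have r2: "row ?T l = x" using lm x(1) U by (intro eq_vecI) auto
      have "good (Suc l)" unfolding good_def
      proof (intro conjI bexI[of _ ?T] allI impI)
        show "row ?T i = row Q i" if "i < k" for i using r1[of i] Q'(2)[OF that] that kl by simp
        show "row ?T i \<in> U" if "i < Suc l" for i
          using r1[of i] r2 Q'(3)[of i] x(1) that by (cases "i = l") auto
      qed (use kl lm T in auto)
      then show False using mx[of "Suc l"] by simp
    qed
  qed
qed

section \<open>Gram matrices and reducible sets of forms\<close>

lemma gram_form_index:
  assumes "A \<in> carrier_mat k k" "x \<in> carrier_vec k" "y \<in> carrier_vec k"
  shows "gram_form A x y = (\<Sum>i<k. \<Sum>j<k. x $ i * A $$ (i,j) * y $ j)"
proof -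
  have "gram_form A x y = (\<Sum>i<k. x $ i * (\<Sum>j<k. A $$ (i,j) * y $ j))"
    using assms by (auto simp: gram_form_def scalar_prod_def lessThan_atLeast0 intro!: sum.cong)
  then show ?thesis by (simp add: sum_distrib_left mult.assoc)
qed

text \<open>Congruence by \<open>P\<close> is the passage to the basis formed by the rows of
  \<open>P\<close>.\<close>

lemma gram_form_cong_mat:
  assumes "P \<in> carrier_mat n n" "A \<in> carrier_mat n n" "i < n" "j < n"
  shows "cong_mat P A $$ (i,j) = gram_form A (row P i) (row P j)"
  using assms by (subst cong_mat_index, auto, subst gram_form_index[of _ n], auto)

lemma symplectic_form_gram_form:
  assumes A: "A \<in> alternating_mats k" and g: "A \<in> GL k"
  shows "symplectic_form class_ring (module_vec TYPE('a::field) k) (gram_form A)"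
proof -
  note a = alternating_matsD[OF A]
  have "bilinear_form class_ring (module_vec TYPE('a) k) (gram_form A)"
    unfolding bilinear_form_def using a(1)
    by (auto simp: module_vec_simps gram_form_def mult_add_distrib_mat_vec[of A k k]
        scalar_prod_add_distrib[of _ k] add_scalar_prod_distrib[of _ k] mult_mat_vec[of A k k])
  moreover have "gram_form A x x = 0" if "x \<in> carrier_vec k" for x
    unfolding gram_form_index[OF a(1) that that] by (rule alternating_form_self[OF a(2) a(3)])
  moreover have "x = 0\<^sub>v k" if x: "x \<in> carrier_vec k" and z: "\<forall>y\<in>carrier_vec k. gram_form A x y = 0" for x
  proof (rule eq_vecI)
    fix i assume "i < dim_vec (0\<^sub>v k :: 'a vec)"
    then have i: "i < k" by simp
    have "x $ i = 0"
    proof (rule GL_left_kernel[OF g _ i])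
      fix j assume j: "j < k"
      have "gram_form A x (unit_vec k j) = (\<Sum>i<k. \<Sum>l<k. if l = j then x $ i * A $$ (i,j) else 0)"
        using j by (subst gram_form_index[OF a(1) x], simp, intro sum.cong) auto
      also have "\<dots> = (\<Sum>i<k. x $ i * A $$ (i,j))" using j by simp
      finally show "(\<Sum>i<k. x $ i * A $$ (i,j)) = 0" using z by simp
    qed
    then show "x $ i = 0\<^sub>v k $ i" using i by simp
  qed (use x in simp)
  ultimately show ?thesis by (simp add: symplectic_form_def module_vec_simps)
qed

text \<open>Invertible alternating matrices always give symplectic forms, so irreducibility comes
  down to the absence of a subspace \<open>U\<close>.\<close>

lemma irreducible_mats_iff:
  fixes CC :: "'a::field mat set"
  assumes "CC \<subseteq> alternating_mats k" "CC \<subseteq> GL k" "CC \<noteq> {}"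
  shows "irreducible_mats k CC \<longleftrightarrow> \<not> (\<exists>U. VectorSpace.subspace class_ring U (module_vec TYPE('a) k) \<and> U \<noteq> {0\<^sub>v k}
     \<and> (\<forall>A\<in>CC. \<forall>x\<in>U. \<forall>y\<in>U. gram_form A x y = 0)
     \<and> (\<forall>A\<in>CC. \<forall>B\<in>CC. {y \<in> carrier_vec k. \<forall>x\<in>U. gram_form A x y = 0} = {y \<in> carrier_vec k. \<forall>x\<in>U. gram_form B x y = 0}))"
proof -
  have "\<forall>s\<in>gram_form ` CC. symplectic_form class_ring (module_vec TYPE('a) k) s"
    using symplectic_form_gram_form assms by blast
  moreover have "U \<subseteq> {y \<in> carrier_vec k. \<forall>x\<in>U. gram_form A x y = 0} \<longleftrightarrow> (\<forall>x\<in>U. \<forall>y\<in>U. gram_form A x y = 0)"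
    if "VectorSpace.subspace class_ring U (module_vec TYPE('a) k)" for U A
    using submodule.subset[of class_ring U "module_vec TYPE('a) k"] that
    by (auto simp: VectorSpace.subspace_def module_vec_simps)
  ultimately show ?thesis using assms(3)
    by (auto simp: irreducible_mats_def irreducible_forms_def form_orthogonal_def module_vec_simps)
qed
lemma gram_form_lincomb:
  assumes A: "A \<in> carrier_mat k k" and Q: "Q \<in> carrier_mat m k" and x: "x \<in> carrier_vec k" and y: "y \<in> carrier_vec k"
  shows "(\<And>c. c < k \<Longrightarrow> x $ c = (\<Sum>i<m. v i * Q $$ (i,c))) \<Longrightarrow> gram_form A x y = (\<Sum>i<m. v i * gram_form A (row Q i) y)"
    "(\<And>c. c < k \<Longrightarrow> y $ c = (\<Sum>i<m. v i * Q $$ (i,c))) \<Longrightarrow> gram_form A x y = (\<Sum>i<m. v i * gram_form A x (row Q i))"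
proof -
  have lin: "(\<Sum>p<k. (\<Sum>i<m. v i * Q $$ (i,p)) * f p) = (\<Sum>i<m. v i * (\<Sum>p<k. Q $$ (i,p) * f p))" for f
    unfolding sum_distrib_right sum_distrib_left by (subst sum.swap) (simp add: mult.assoc)
  have l: "gram_form A u w = (\<Sum>p<k. u $ p * (\<Sum>q<k. A $$ (p,q) * w $ q))"
    if "u \<in> carrier_vec k" "w \<in> carrier_vec k" for u w
    unfolding gram_form_index[OF A that] by (simp add: sum_distrib_left mult.assoc)
  have r: "gram_form A u w = (\<Sum>q<k. w $ q * (\<Sum>p<k. u $ p * A $$ (p,q)))"
    if "u \<in> carrier_vec k" "w \<in> carrier_vec k" for u w
    unfolding gram_form_index[OF A that] by (subst sum.swap) (simp add: sum_distrib_left sum_distrib_right mult.commute)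
  have rw: "row Q i \<in> carrier_vec k" for i using Q by (simp add: carrier_vecI)
  show "gram_form A x y = (\<Sum>i<m. v i * gram_form A (row Q i) y)"
    if e: "\<And>c. c < k \<Longrightarrow> x $ c = (\<Sum>i<m. v i * Q $$ (i,c))"
    unfolding l[OF x y] l[OF rw y] using Q by (simp add: e lin)
  show "gram_form A x y = (\<Sum>i<m. v i * gram_form A x (row Q i))"
    if e: "\<And>c. c < k \<Longrightarrow> y $ c = (\<Sum>i<m. v i * Q $$ (i,c))"
    unfolding r[OF x y] r[OF x rw] using Q by (simp add: e lin)
qed

text \<open>In a basis adapted to the chain formed by \<open>U\<close> and its common orthogonal,
  all forms vanish between the first k vectors, spanning \<open>U\<close>, and the first l, spanning
  the orthogonal. Nondegeneracy bounds k by s / 2, and counting equations bounds l from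
  below.\<close>

lemma reducible_zero_block:
  fixes CC :: "'a::field mat set"
  assumes al: "CC \<subseteq> alternating_mats s" and g: "CC \<subseteq> GL s" and ne: "CC \<noteq> {}" and red: "\<not> irreducible_mats s CC"
  obtains k Q where "0 < k" "2 * k \<le> s" "Q \<in> GL s"
    "\<And>A i j. A \<in> CC \<Longrightarrow> i < k \<Longrightarrow> j < s - k \<Longrightarrow> cong_mat Q A $$ (i,j) = 0"
proof -
  obtain U where U: "VectorSpace.subspace class_ring U (module_vec TYPE('a) s)" "U \<noteq> {0\<^sub>v s}"
    and iso: "\<And>A x y. A \<in> CC \<Longrightarrow> x \<in> U \<Longrightarrow> y \<in> U \<Longrightarrow> gram_form A x y = 0"
    and ind: "\<And>A B. A \<in> CC \<Longrightarrow> B \<in> CC \<Longrightarrow> {y \<in> carrier_vec s. \<forall>x\<in>U. gram_form A x y = 0} = {y \<in> carrier_vec s. \<forall>x\<in>U. gram_form B x y = 0}"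
    using red unfolding irreducible_mats_iff[OF al g ne] by blast
  have sm: "submodule class_ring U (module_vec TYPE('a) s)" using U(1) by (simp add: VectorSpace.subspace_def)
  have Uc: "U \<subseteq> carrier_vec s" and U0: "0\<^sub>v s \<in> U"
    using submodule.subset[OF sm] submodule.zero_closed[OF sm] by (auto simp: module_vec_simps)
  obtain A0 where A0: "A0 \<in> CC" using ne by auto
  \<comment> \<open>The orthogonal is taken for one form \<open>A0\<close>; by \<open>ind\<close> it
    is the orthogonal for every form of the set.\<close>
  define O' where "O' = {y \<in> carrier_vec s. \<forall>x\<in>U. gram_form A0 x y = 0}"
  have Oc: "O' \<subseteq> carrier_vec s" and UO: "U \<subseteq> O'" using iso[OF A0] Uc by (auto simp: O'_def)
  have OA: "gram_form A x y = 0" if "A \<in> CC" "x \<in> U" "y \<in> O'" for A x y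
    using ind[OF that(1) A0] that by (auto simp: O'_def)
  \<comment> \<open>The standard basis is adapted to \<open>U\<close> here, and the result is then
    adapted to \<open>O'\<close> while its first k rows are kept.\<close>
  obtain k Q1 where k: "k \<le> s" and Q1: "Q1 \<in> GL s" "\<And>i. i < k \<Longrightarrow> row Q1 i \<in> U"
    and Q1c: "\<And>x w i. x \<in> U \<Longrightarrow> (\<And>c. c < s \<Longrightarrow> x $ c = (\<Sum>i<s. w i * Q1 $$ (i,c))) \<Longrightarrow> k \<le> i \<Longrightarrow> i < s \<Longrightarrow> w i = 0"
    using GL_adapted_rows[OF GL_one[of s], of 0 U] Uc by auto
  have rO: "\<And>i. i < k \<Longrightarrow> row Q1 i \<in> O'" using Q1(2) UO by auto
  obtain l Q where l: "k \<le> l" "l \<le> s" and Q: "Q \<in> GL s" "\<And>i. i < k \<Longrightarrow> row Q i = row Q1 i" "\<And>i. i < l \<Longrightarrow> row Q i \<in> O'"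
    and Qc: "\<And>x w i. x \<in> O' \<Longrightarrow> (\<And>c. c < s \<Longrightarrow> x $ c = (\<Sum>i<s. w i * Q $$ (i,c))) \<Longrightarrow> l \<le> i \<Longrightarrow> i < s \<Longrightarrow> w i = 0"
    using GL_adapted_rows[OF Q1(1) k rO Oc] by blast
  have Qm: "Q \<in> carrier_mat s s" and Q1m: "Q1 \<in> carrier_mat s s" using GL_carrier Q(1) Q1(1) by auto
  have Acm: "A \<in> carrier_mat s s" if "A \<in> CC" for A using g GL_carrier that by blast
  have QU: "row Q i \<in> U" if "i < k" for i using Q(2) Q1(2) that by simp
  have Qe: "Q $$ (i,c) = Q1 $$ (i,c)" if "i < k" "c < s" for i c
    using arg_cong[OF Q(2)[OF that(1)], of "\<lambda>v. v $ c"] that k Qm Q1m by simp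
  have k0: "0 < k"
  proof (rule ccontr)
    assume "\<not> 0 < k"
    then have k0: "k = 0" by simp
    have "x = 0\<^sub>v s" if x: "x \<in> U" for x
    proof -
      obtain w where w: "\<And>j. j < s \<Longrightarrow> (\<Sum>i<s. w i * Q1 $$ (i,j)) = x $ j"
        using GL_left_solve[OF Q1(1), of "\<lambda>j. x $ j"] by blast
      have "w i = 0" if "i < s" for i by (rule Q1c[OF x]) (use w k0 that in auto)
      then have "x $ j = 0" if "j < s" for j using w[OF that] by simp
      then show ?thesis using x Uc by (intro eq_vecI) auto
    qed
    then show False using U(2) U0 by blast
  qed
  \<comment> \<open>Otherwise k equations in s - l > k unknowns have a nonzero solution: a
    combination y of the rows from l on that is orthogonal to \<open>U\<close>. It lies in
    \<open>O'\<close> but has a nonzero coordinate beyond l, which \<open>Qc\<close>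
    excludes.\<close>
  have lk: "s - k \<le> l"
  proof (rule ccontr)
    assume n: "\<not> s - k \<le> l"
    let ?B = "cong_mat Q A0"
    have kl: "k < s - l" using n by simp
    obtain z where z: "\<And>i. i < k \<Longrightarrow> (\<Sum>j<s - l. ?B $$ (i, l + j) * z j) = 0" "\<exists>j<s - l. z j \<noteq> 0"
      using underdetermined_solution[OF kl, of "\<lambda>i j. ?B $$ (i, l + j)"] by blast
    define w where "w i = (if i < l then 0 else z (i - l))" for i
    define y where "y = vec s (\<lambda>c. \<Sum>i<s. w i * Q $$ (i,c))"
    have "gram_form A0 x y = 0" if x: "x \<in> U" for x
    proof -
      obtain v where v: "\<And>j. j < s \<Longrightarrow> (\<Sum>i<s. v i * Q1 $$ (i,j)) = x $ j"
        using GL_left_solve[OF Q1(1), of "\<lambda>j. x $ j"] by blast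
      have v0: "v i = 0" if "k \<le> i" "i < s" for i by (rule Q1c[OF x]) (use v that in auto)
      have xe: "x $ c = (\<Sum>i<s. v i * Q $$ (i,c))" if c: "c < s" for c
        unfolding v[OF c, symmetric]
      proof (rule sum.cong[OF refl])
        fix i assume "i \<in> {..<s}"
        then show "v i * Q1 $$ (i,c) = v i * Q $$ (i,c)" using v0[of i] Qe[of i c] c by (cases "i < k") auto
      qed
      have xc: "x \<in> carrier_vec s" and yc: "y \<in> carrier_vec s" using x Uc by (auto simp: y_def)
      have "gram_form A0 x y = (\<Sum>i<s. v i * gram_form A0 (row Q i) y)"
        by (rule gram_form_lincomb(1)[OF Acm[OF A0] Qm xc yc xe])
      also have "\<dots> = (\<Sum>i<s. v i * (\<Sum>j<s. ?B $$ (i,j) * w j))"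
      proof (rule sum.cong[OF refl])
        fix i assume "i \<in> {..<s}"
        then have i: "i < s" by simp
        have "gram_form A0 (row Q i) y = (\<Sum>j<s. w j * gram_form A0 (row Q i) (row Q j))"
          by (rule gram_form_lincomb(2)[OF Acm[OF A0] Qm _ yc]) (use Qm in \<open>auto simp: y_def\<close>)
        also have "\<dots> = (\<Sum>j<s. ?B $$ (i,j) * w j)"
          using i by (intro sum.cong) (auto simp: gram_form_cong_mat[OF Qm Acm[OF A0]] mult.commute)
        finally show "v i * gram_form A0 (row Q i) y = v i * (\<Sum>j<s. ?B $$ (i,j) * w j)" by simp
      qed
      also have "\<dots> = 0"
      proof (rule sum.neutral, rule ballI)
        fix i assume i: "i \<in> {..<s}"
        show "v i * (\<Sum>j<s. ?B $$ (i,j) * w j) = 0"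
        proof (cases "i < k")
          case True
          have "(\<Sum>j<l + (s - l). ?B $$ (i,j) * w j) = (\<Sum>j<s - l. ?B $$ (i, l + j) * z j)"
            unfolding sum_split_at by (simp add: w_def)
          then show ?thesis using z(1)[OF True] l by simp
        next
          case False then show ?thesis using v0[of i] i by simp
        qed
      qed
      finally show ?thesis .
    qed
    then have yO: "y \<in> O'" by (auto simp: O'_def y_def)
    obtain j where j: "j < s - l" "z j \<noteq> 0" using z(2) by auto
    have "w (l + j) = 0" by (rule Qc[OF yO]) (use j in \<open>auto simp: y_def\<close>)
    then show False using j by (simp add: w_def)
  qed
  have zero: "cong_mat Q A $$ (i,j) = 0" if "A \<in> CC" "i < k" "j < l" for A i j
    using gram_form_cong_mat[OF Qm Acm[OF that(1)], of i j] OA[OF that(1) QU[OF that(2)] Q(3)[OF that(3)]] that k l by simp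
  \<comment> \<open>The first k rows of an invertible matrix vanish on the first k columns, so they
    are carried by the remaining s - k columns.\<close>
  have "k \<le> s - k"
  proof (rule GL_rows_support[where P = "cong_mat Q A0" and n = s and f = "\<lambda>i. i" and g = "\<lambda>i. k + i"])
    show "cong_mat Q A0 \<in> GL s" using cong_mat_GL[OF Q(1)] A0 g by blast
    fix i j assume h: "i < k" "j < s" "j \<notin> (\<lambda>i. k + i) ` {..<s - k}"
    have "j < k"
    proof (rule ccontr)
      assume "\<not> j < k"
      then have "j = k + (j - k)" "j - k \<in> {..<s - k}" using h by auto
      then show False using h by blast
    qed
    then show "cong_mat Q A0 $$ (i,j) = 0" using zero[OF A0 h(1)] l by simp
  qed (use k in auto)
  then have "2 * k \<le> s" using k by simp
  then show thesis using that[OF k0 _ Q(1)] zero lk by auto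
qed

section \<open>Block triangular congruences\<close>

text \<open>\<open>P1\<close> and \<open>P2\<close> make \<open>P\<close> block lower triangular for
  the partition r, s, r. Its diagonal blocks X, Y, Z act by M \<mapsto> X M Z^T and C \<mapsto> Y C
  Y^T, because every other product that could contribute meets a zero block.\<close>

lemma cong_mat_block_triangular:
  assumes P: "P \<in> carrier_mat (r + s + r) (r + s + r)" and A: "A \<in> alternating_mats (r + s + r)"
    and P1: "\<And>i j. i < r \<Longrightarrow> r \<le> j \<Longrightarrow> j < r + s + r \<Longrightarrow> P $$ (i,j) = 0"
    and P2: "\<And>i j. i < r + s \<Longrightarrow> r + s \<le> j \<Longrightarrow> j < r + s + r \<Longrightarrow> P $$ (i,j) = 0"
    and z: "\<And>i j. i < r \<Longrightarrow> j < r + s \<Longrightarrow> A $$ (i,j) = 0"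
  shows "\<And>i j. i < r \<Longrightarrow> j < r + s \<Longrightarrow> cong_mat P A $$ (i,j) = 0"
    "blk (cong_mat P A) 0 r (r + s) r = blk P 0 r 0 r * blk A 0 r (r + s) r * transpose_mat (blk P (r + s) r (r + s) r)"
    "blk (cong_mat P A) r s r s = cong_mat (blk P r s r s) (blk A r s r s)"
proof -
  note a = alternating_matsD[OF A]
  have z2: "A $$ (r + i, j) = 0" if "i < s" "j < r" for i j
    using a(2)[of "r + i" j] z[of j "r + i"] that by simp
  have sp: "(\<Sum>j<r + s + r. f j) = (\<Sum>j<r. f j) + (\<Sum>j<s. f (r + j)) + (\<Sum>j<r. f (r + s + j))" for f :: "nat \<Rightarrow> 'a"
    by (simp add: sum_split_at)
  have top: "cong_mat P A $$ (i,j) = (\<Sum>k<r. \<Sum>l<r. P $$ (i,k) * A $$ (k, r + s + l) * P $$ (j, r + s + l))"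
    if "i < r" "j < r + s + r" for i j
    using that P1 z by (simp add: cong_mat_index[OF P a(1)] sp)
  show "cong_mat P A $$ (i,j) = 0" if "i < r" "j < r + s" for i j
    using that P2 by (simp add: top)
  show "blk (cong_mat P A) 0 r (r + s) r = blk P 0 r 0 r * blk A 0 r (r + s) r * transpose_mat (blk P (r + s) r (r + s) r)"
    (is "_ = ?X * ?M * transpose_mat ?Y")
  proof (rule eq_matI)
    fix i j assume "i < dim_row (?X * ?M * transpose_mat ?Y)" "j < dim_col (?X * ?M * transpose_mat ?Y)"
    then have i: "i < r" and j: "j < r" by auto
    have "(?X * ?M * transpose_mat ?Y) $$ (i,j) = (\<Sum>l<r. (\<Sum>k<r. P $$ (i,k) * A $$ (k, r + s + l)) * P $$ (r + s + j, r + s + l))"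
      using i j by (subst mat_mult_index[of _ r r _ r], auto simp: mat_mult_index[of _ r r _ r] simp del: index_mult_mat(1) intro!: sum.cong)
    also have "\<dots> = (\<Sum>l<r. \<Sum>k<r. P $$ (i,k) * A $$ (k, r + s + l) * P $$ (r + s + j, r + s + l))"
      by (simp add: sum_distrib_right)
    also have "\<dots> = blk (cong_mat P A) 0 r (r + s) r $$ (i,j)"
      using i j by (subst sum.swap) (simp add: top)
    finally show "blk (cong_mat P A) 0 r (r + s) r $$ (i,j) = (?X * ?M * transpose_mat ?Y) $$ (i,j)" ..
  qed auto
  show "blk (cong_mat P A) r s r s = cong_mat (blk P r s r s) (blk A r s r s)" (is "?L = cong_mat ?X ?C")
  proof (rule eq_matI)
    fix i j assume "i < dim_row (cong_mat ?X ?C)" "j < dim_col (cong_mat ?X ?C)"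
    then have i: "i < s" and j: "j < s" by (auto simp: cong_mat_def)
    show "?L $$ (i,j) = cong_mat ?X ?C $$ (i,j)"
      using i j P2 z z2 by (simp add: cong_mat_index[OF P a(1)] cong_mat_index[of ?X s ?C] sp)
  qed (auto simp: cong_mat_def)
qed

text \<open>The block diagonal matrix diag(I, Q, I), which extends a congruence of the middle block
  to full size.\<close>

definition mid_mat :: "nat \<Rightarrow> nat \<Rightarrow> 'a::field mat \<Rightarrow> 'a mat" where
  "mid_mat r s Q = mat (r + s + r) (r + s + r) (\<lambda>(i,j).
     if r \<le> i \<and> i < r + s \<and> r \<le> j \<and> j < r + s then Q $$ (i - r, j - r) else if i = j then 1 else 0)"

lemma mid_mat_GL:
  assumes Q: "Q \<in> GL s"
  shows "mid_mat r s Q \<in> GL (r + s + r)"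
proof -
  let ?R = "mid_mat r s Q"
  have R: "?R \<in> carrier_mat (r + s + r) (r + s + r)" by (simp add: mid_mat_def)
  show ?thesis unfolding GL_iff_left_kernel[OF R]
  proof (intro allI impI)
    fix v :: "nat \<Rightarrow> 'a" and i assume v: "\<forall>j<r + s + r. (\<Sum>i<r + s + r. v i * ?R $$ (i,j)) = 0" and i: "i < r + s + r"
    have out: "v j = 0" if j: "j < r \<or> r + s \<le> j" "j < r + s + r" for j
    proof -
      have "(\<Sum>i<r + s + r. v i * ?R $$ (i,j)) = (\<Sum>i<r + s + r. if i = j then v i else 0)"
      proof (rule sum.cong[OF refl])
        fix i assume i: "i \<in> {..<r + s + r}"
        have "?R $$ (i,j) = (if i = j then 1 else 0)"
          using j(1) by (elim disjE) (use i j(2) in \<open>simp_all add: mid_mat_def\<close>)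
        then show "v i * ?R $$ (i,j) = (if i = j then v i else 0)" by simp
      qed
      also have "\<dots> = v j" using j(2) by simp
      finally show ?thesis using v j(2) by simp
    qed
    have "v (r + j) = 0" if j: "j < s" for j
    proof (rule GL_left_kernel[OF Q _ j, where v = "\<lambda>j. v (r + j)"])
      fix c assume c: "c < s"
      have "(\<Sum>i<r + s + r. v i * ?R $$ (i,r + c)) = (\<Sum>i<s. v (r + i) * ?R $$ (r + i,r + c))"
      proof -
        have o1: "v i = 0" if "i < r" for i by (rule out) (use that in auto)
        have o2: "v (r + s + i) = 0" if "i < r" for i by (rule out) (use that in auto)
        show ?thesis unfolding sum_split_at using o1 o2 by simp
      qed
      also have "\<dots> = (\<Sum>i<s. v (r + i) * Q $$ (i,c))" using c by (intro sum.cong) (auto simp: mid_mat_def)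
      finally show "(\<Sum>i<s. v (r + i) * Q $$ (i,c)) = 0" using v c by simp
    qed
    from this[of "i - r"] show "v i = 0" using out[of i] i by (cases "i < r \<or> r + s \<le> i") auto
  qed
qed

section \<open>Existence\<close>

lemma congruent_mats_iff: "congruent_mats k S T \<longleftrightarrow> (\<exists>P\<in>GL k. T = cong_mat P ` S)"
  by (simp add: congruent_mats_def cong_mat_def)

lemma symplectic_affineD:
  assumes "symplectic_affine k CC"
  shows "CC \<subseteq> alternating_mats k" "CC \<subseteq> GL k" "CC \<noteq> {}" "affine_subspace_mat k CC"
  using assms affine_subspace_matD(1,2)[of k CC] by (auto simp: symplectic_affine_def GL_def)

lemma bullet_decomposition_exists:
  fixes S :: "'a::field mat set"
  assumes O: "optimal_symplectic_affine (2 * n) S"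
  shows "\<exists>r W CC. bullet_decomposition n S r W CC"
proof -
  \<comment> \<open>The width 2n - r is the dimension of the orthogonal of an r-dimensional space.
    So \<open>good r\<close> provides r independent vectors whose span is totally singular and has
    the same orthogonal for all elements of \<open>S\<close>.\<close>
  define good where "good r \<longleftrightarrow> r \<le> n \<and> (\<exists>P\<in>GL (2 * n). \<forall>A\<in>S. \<forall>i<r. \<forall>j<2 * n - r. cong_mat P A $$ (i,j) = 0)" for r
  define r where "r = (GREATEST r. good r)"
  have bd: "y \<le> n" if "good y" for y using that by (simp add: good_def)
  have "good 0" using GL_one by (auto simp: good_def)
  then have gr: "good r" unfolding r_def by (rule GreatestI_nat) (use bd in blast)
  have mx: "y \<le> r" if "good y" for y unfolding r_def by (rule Greatest_le_nat[of good, OF that]) (use bd in blast)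
  obtain P where rn: "r \<le> n" and P: "P \<in> GL (2 * n)"
    and Pz: "\<And>A i j. A \<in> S \<Longrightarrow> i < r \<Longrightarrow> j < 2 * n - r \<Longrightarrow> cong_mat P A $$ (i,j) = 0"
    using gr by (auto simp: good_def)
  define s where "s = 2 * (n - r)"
  have N: "2 * n = r + s + r" using rn by (simp add: s_def)
  have Os: "optimal_symplectic_affine (r + s + r) (cong_mat P ` S)"
    using optimal_symplectic_affine_cong[OF O P] by (simp add: N)
  obtain W CC where S': "cong_mat P ` S = bul r s W CC" and W: "optimal_invertible_affine r W" and C: "optimal_symplectic_affine s CC"
  proof (rule optimal_zero_block_eq_bul[OF Os])
    show "A $$ (i,j) = 0" if "A \<in> cong_mat P ` S" "i < r" "j < r + s" for A i j
      using that Pz[of _ i j] N by auto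
  qed
  have Cs: "symplectic_affine s CC" using C by (simp add: optimal_symplectic_affine_def)
  note CD = symplectic_affineD[OF Cs]
  have "irreducible_mats s CC"
  proof (rule ccontr)
    assume red: "\<not> irreducible_mats s CC"
    obtain k Q where k: "0 < k" "2 * k \<le> s" and Q: "Q \<in> GL s"
      and Qz: "\<And>A i j. A \<in> CC \<Longrightarrow> i < k \<Longrightarrow> j < s - k \<Longrightarrow> cong_mat Q A $$ (i,j) = 0"
      using reducible_zero_block[OF CD(1-3) red] by blast
    let ?M = "mid_mat r s Q"
    have M: "?M \<in> GL (r + s + r)" by (rule mid_mat_GL[OF Q])
    note Mc = GL_carrier[OF M]
    have bM: "blk ?M r s r s = Q" using GL_carrier[OF Q] by (intro eq_matI) (auto simp: mid_mat_def)
    have M1: "?M $$ (i,j) = 0" if "i < r" "r \<le> j" "j < r + s + r" for i j using that by (auto simp: mid_mat_def)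
    have M2: "?M $$ (i,j) = 0" if "i < r + s" "r + s \<le> j" "j < r + s + r" for i j using that by (auto simp: mid_mat_def)
    \<comment> \<open>The lifted congruence keeps the zero rows of index less than r. For the k new
      rows, the columns below r vanish by skew-symmetry and the others by the zero block obtained
      inside \<open>CC\<close>.\<close>
    have "good (r + k)" unfolding good_def
    proof (intro conjI bexI[of _ "?M * P"] ballI allI impI)
      show "r + k \<le> n" using k rn by (simp add: s_def)
      show "?M * P \<in> GL (2 * n)" using GL_mult[OF M] P by (simp add: N)
      fix A i j assume A: "A \<in> S" and i: "i < r + k" and j: "j < 2 * n - (r + k)"
      have "affine_subspace_mat (2 * n) S" using O by (simp add: optimal_symplectic_affine_def symplectic_affine_def)
      then have Ac: "A \<in> carrier_mat (r + s + r) (r + s + r)" using affine_subspace_matD(2) A N by metis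
      have B: "cong_mat P A \<in> bul r s W CC" using A S' by auto
      have j': "j < r + s - k" using j N by simp
      note al = cong_mat_alternating[OF Mc bulD(1)[OF B]]
      note t = cong_mat_block_triangular[OF Mc bulD(1)[OF B] M1 M2 bulD(2)[OF B]]
      have "cong_mat ?M (cong_mat P A) $$ (i,j) = 0"
      proof (cases "i < r")
        case True then show ?thesis using t(1) j' by simp
      next
        case False
        show ?thesis
        proof (cases "j < r")
          case True
          have "cong_mat ?M (cong_mat P A) $$ (i,j) = - cong_mat ?M (cong_mat P A) $$ (j,i)"
            by (rule alternating_matsD(2)[OF al]) (use i j' True k in auto)
          also have "cong_mat ?M (cong_mat P A) $$ (j,i) = 0" by (rule t(1)) (use i True k in auto)
          finally show ?thesis by simp
        next
          case jr: False
          have "cong_mat ?M (cong_mat P A) $$ (i,j) = blk (cong_mat ?M (cong_mat P A)) r s r s $$ (i - r, j - r)"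
            using i j' False jr k by simp
          also have "\<dots> = cong_mat Q (blk (cong_mat P A) r s r s) $$ (i - r, j - r)" using t(3) bM by simp
          also have "\<dots> = 0" using bulD(4)[OF B] by (rule Qz) (use i j' False jr k in auto)
          finally show ?thesis .
        qed
      qed
      then show "cong_mat (?M * P) A $$ (i,j) = 0"
        using cong_mat_mult[OF Mc _ Ac, of P] GL_carrier[OF P] by (simp add: N)
    qed
    then show False using mx[of "r + k"] k by simp
  qed
  moreover have "bullet r (n - r) W CC = bul r s W CC"
  proof -
    have "W \<subseteq> carrier_mat r r" using W affine_subspace_matD(2)
      by (auto simp: optimal_invertible_affine_def invertible_affine_def)
    then show ?thesis using CD(1) bullet_eq_bul[of W r CC "n - r"] by (simp add: s_def)
  qed
  moreover have "congruent_mats (2 * n) S (bul r s W CC)" using P S' by (auto simp: congruent_mats_iff)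
  ultimately have "bullet_decomposition n S r W CC"
    using rn W C by (simp add: bullet_decomposition_def s_def)
  then show ?thesis by blast
qed
section \<open>Uniqueness of the decomposition\<close>

text \<open>\<open>E\<close> is an elementary alternating matrix located in the free blocks B, D and
  the transpose of B, so the constrained blocks are unchanged.\<close>

lemma bul_add_unit:
  assumes A: "A \<in> bul r s W CC" and k: "r \<le> k" "k < r + s + r" and l: "r + s \<le> l" "l < r + s + r" and kl: "k \<noteq> l"
  defines "E \<equiv> mat (r + s + r) (r + s + r) (\<lambda>(p,q). (if p = k \<and> q = l then 1 else 0) - (if p = l \<and> q = k then 1 else 0))"
  shows "A + 1 \<cdot>\<^sub>m E \<in> bul r s W CC"
proof -
  have Ec: "E \<in> carrier_mat (r + s + r) (r + s + r)" by (simp add: E_def)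
  have E: "E \<in> alternating_mats (r + s + r)" using kl by (auto simp: alternating_mats_iff E_def)
  have z: "E $$ (i,j) = 0" if "i < r" "j < r + s" for i j using that k l by (auto simp: E_def)
  have e1: "blk (A + 1 \<cdot>\<^sub>m E) 0 r (r + s) r = blk A 0 r (r + s) r"
    using bulD(5)[OF A] k l by (intro eq_matI) (auto simp: E_def)
  have e2: "blk (A + 1 \<cdot>\<^sub>m E) r s r s = blk A r s r s"
    using bulD(5)[OF A] k l by (intro eq_matI) (auto simp: E_def)
  have "A + 1 \<cdot>\<^sub>m E \<in> alternating_mats (r + s + r)" by (rule alternating_mats_lin[OF bulD(1)[OF A] E])
  moreover have "(A + 1 \<cdot>\<^sub>m E) $$ (i,j) = 0" if "i < r" "j < r + s" for i j
    using z[OF that] bulD(2)[OF A that] bulD(5)[OF A] Ec that by simp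
  ultimately show ?thesis using e1 e2 bulD(3,4)[OF A] by (simp add: bul_def)
qed

text \<open>Entry (i,j) vanishes for the congruents of both A and A + E, hence for that of E, where
  it is the minor of \<open>P\<close> on rows i, j and columns k, l.\<close>

lemma bul_minors:
  assumes ne: "bul r s W CC \<noteq> {}" and P: "P \<in> carrier_mat (r + s + r) (r + s + r)"
    and z: "\<And>A. A \<in> bul r s W CC \<Longrightarrow> cong_mat P A $$ (i,j) = (0 :: 'a::field)"
    and ij: "i < r + s + r" "j < r + s + r"
    and k: "r \<le> k" "k < r + s + r" and l: "r + s \<le> l" "l < r + s + r"
  shows "P $$ (i,k) * P $$ (j,l) = P $$ (i,l) * P $$ (j,k)"
proof (cases "k = l")
  case False
  let ?N = "r + s + r"
  define E :: "'a mat" where "E = mat ?N ?N (\<lambda>(p,q). (if p = k \<and> q = l then 1 else 0) - (if p = l \<and> q = k then 1 else 0))"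
  have Ec: "E \<in> carrier_mat ?N ?N" by (simp add: E_def)
  obtain A where A: "A \<in> bul r s W CC" using ne by auto
  note Ac = bulD(5)[OF A]
  have "cong_mat P (A + 1 \<cdot>\<^sub>m E) = cong_mat P A + 1 \<cdot>\<^sub>m cong_mat P E"
    by (rule lin_mat_mapD(2)[OF lin_mat_map_cong_mat[OF P] Ac Ec])
  then have "cong_mat P (A + 1 \<cdot>\<^sub>m E) $$ (i,j) = cong_mat P A $$ (i,j) + cong_mat P E $$ (i,j)"
    using ij cong_mat_carrier[OF P Ac] cong_mat_carrier[OF P Ec] by simp
  moreover have "A + 1 \<cdot>\<^sub>m E \<in> bul r s W CC" unfolding E_def by (rule bul_add_unit[OF A k l False])
  ultimately have "cong_mat P E $$ (i,j) = 0" using z A by simp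
  moreover have "cong_mat P E $$ (i,j) = P $$ (i,k) * P $$ (j,l) - P $$ (i,l) * P $$ (j,k)"
  proof -
    have "cong_mat P E $$ (i,j) = (\<Sum>p<?N. \<Sum>q<?N. (if q = l then if p = k then P $$ (i,p) * P $$ (j,q) else 0 else 0)
        - (if q = k then if p = l then P $$ (i,p) * P $$ (j,q) else 0 else 0))"
      unfolding cong_mat_index[OF P Ec ij]
      by (intro sum.cong refl) (auto simp: E_def algebra_simps)
    also have "\<dots> = P $$ (i,k) * P $$ (j,l) - P $$ (i,l) * P $$ (j,k)"
      using k l by (simp add: sum_subtractf)
    finally show ?thesis .
  qed
  ultimately show ?thesis by simp
qed simp

text \<open>Once the last blocks of x and y vanish, C is the only nonzero block of \<open>A\<close>
  that still contributes.\<close>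

lemma gram_form_bul:
  assumes A: "A \<in> bul r s W CC" and x: "x \<in> carrier_vec (r + s + r)" and y: "y \<in> carrier_vec (r + s + r)"
    and x0: "\<And>l. r + s \<le> l \<Longrightarrow> l < r + s + r \<Longrightarrow> x $ l = 0" and y0: "\<And>l. r + s \<le> l \<Longrightarrow> l < r + s + r \<Longrightarrow> y $ l = 0"
  shows "gram_form A x y = gram_form (blk A r s r s) (vec s (\<lambda>k. x $ (r + k))) (vec s (\<lambda>k. y $ (r + k)))"
proof -
  have z2: "A $$ (r + i, j) = 0" if "i < s" "j < r" for i j
    using alternating_matsD(2)[OF bulD(1)[OF A], of "r + i" j] bulD(2)[OF A, of j "r + i"] that by simp
  have "gram_form A x y = (\<Sum>i<s. \<Sum>j<s. x $ (r + i) * A $$ (r + i, r + j) * y $ (r + j))"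
    using x0 y0 bulD(2)[OF A] z2 by (simp add: gram_form_index[OF bulD(5)[OF A] x y] sum_split_at)
  also have "\<dots> = gram_form (blk A r s r s) (vec s (\<lambda>k. x $ (r + k))) (vec s (\<lambda>k. y $ (r + k)))"
    by (subst gram_form_index[of _ s]) auto
  finally show ?thesis .
qed

text \<open>The parameters r and r' may differ here, because the result also serves to compare them.
  Hypothesis \<open>z\<close> places the first r' rows of \<open>P\<close> in the region where the
  form depends on C alone.\<close>

lemma irreducible_rows_eq_0:
  fixes P :: "'a::field mat"
  assumes W: "invertible_affine r W" and C: "symplectic_affine s CC" and irr: "irreducible_mats s CC"
    and C': "symplectic_affine s' CC'"
    and N: "r' + s' + r' = r + s + r" and P: "P \<in> GL (r + s + r)"
    and S: "bul r' s' W' CC' = cong_mat P ` bul r s W CC"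
    and z: "\<And>i l. i < r' \<Longrightarrow> r + s \<le> l \<Longrightarrow> l < r + s + r \<Longrightarrow> P $$ (i,l) = 0"
    and W': "invertible_affine r' W'"
    and ik: "i < r'" "r \<le> k" "k < r + s + r"
  shows "P $$ (i,k) = 0"
proof (cases "k < r + s")
  case False then show ?thesis using z ik by simp
next
  case True
  note CD = symplectic_affineD[OF C]
  let ?N = "r + s + r"
  note Pc = GL_carrier[OF P]
  have r'N: "r' \<le> ?N" using N by linarith
  have Wc: "W \<subseteq> carrier_mat r r" and Wne: "W \<noteq> {}"
    using W affine_subspace_matD(1,2) by (auto simp: invertible_affine_def)
  obtain M0 where M0: "M0 \<in> W" using Wne by auto
  have ex: "\<exists>A\<in>bul r s W CC. blk A r s r s = A0" if "A0 \<in> CC" for A0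
    using bul_ex[OF Wc CD(1) M0 that] by blast
  define Q where "Q = blk P 0 r' r s"
  have Qc: "Q \<in> carrier_mat r' s" by (simp add: Q_def)
  have rQ: "row Q i = vec s (\<lambda>k. row P i $ (r + k))" if "i < r'" for i
    using that Pc r'N by (intro eq_vecI) (auto simp: Q_def)
  have cz: "cong_mat P A $$ (i,j) = 0" if "A \<in> bul r s W CC" "i < r'" "j < r' + s'" for A i j
    using that S bulD(2)[of "cong_mat P A" r' s' W' CC' i j] by blast
  txt \<open>The middle parts of the top rows of \<open>P\<close> span a subspace \<open>U\<close> that would witness reducibility.\<close>
  define U where "U = {x \<in> carrier_vec s. \<exists>u. \<forall>c<s. x $ c = (\<Sum>i<r'. u i * Q $$ (i,c))}"
  have Uc: "U \<subseteq> carrier_vec s" by (auto simp: U_def)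
  have rU: "row Q i \<in> U" if "i < r'" for i
  proof -
    have "row Q i $ c = (\<Sum>p<r'. (if p = i then 1 else 0) * Q $$ (p,c))" if "c < s" for c
    proof -
      have "(\<Sum>p<r'. (if p = i then 1 else 0) * Q $$ (p,c)) = (\<Sum>p<r'. if p = i then Q $$ (p,c) else 0)"
        by (intro sum.cong) auto
      then show ?thesis using \<open>i < r'\<close> that Qc by simp
    qed
    moreover have "row Q i \<in> carrier_vec s" using Qc by (simp add: carrier_vecI)
    ultimately show ?thesis unfolding U_def mem_Collect_eq
      by (intro conjI exI[of _ "\<lambda>p. if p = i then 1 else 0"]) auto
  qed
  have Usp: "VectorSpace.subspace class_ring U (module_vec TYPE('a) s)"
  proof -
    have add: "x + y \<in> U" if xy: "x \<in> U" "y \<in> U" for x y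
    proof -
      obtain u v where "x \<in> carrier_vec s" "y \<in> carrier_vec s"
        "\<forall>c<s. x $ c = (\<Sum>i<r'. u i * Q $$ (i,c))" "\<forall>c<s. y $ c = (\<Sum>i<r'. v i * Q $$ (i,c))"
        using xy by (auto simp: U_def)
      then show ?thesis unfolding U_def mem_Collect_eq
        by (intro conjI exI[of _ "\<lambda>i. u i + v i"]) (auto simp: sum.distrib algebra_simps)
    qed
    have sm: "a \<cdot>\<^sub>v x \<in> U" if x: "x \<in> U" for x a
    proof -
      obtain u where "x \<in> carrier_vec s" "\<forall>c<s. x $ c = (\<Sum>i<r'. u i * Q $$ (i,c))"
        using x by (auto simp: U_def)
      then show ?thesis unfolding U_def mem_Collect_eq
        by (intro conjI exI[of _ "\<lambda>i. a * u i"]) (auto simp: sum_distrib_left mult.assoc)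
    qed
    have z: "0\<^sub>v s \<in> U" unfolding U_def mem_Collect_eq by (intro conjI exI[of _ "\<lambda>i. 0"]) auto
    have "vectorspace class_ring (module_vec TYPE('a) s)" by (rule vec_vs)
    then show ?thesis using Uc add sm z
      by (auto simp: VectorSpace.subspace_def submodule_def vectorspace_def module_vec_simps)
  qed
  have gU: "(\<forall>x\<in>U. gram_form A0 x y = 0) \<longleftrightarrow> (\<forall>i<r'. gram_form A0 (row Q i) y = 0)"
    if A0: "A0 \<in> CC" and y: "y \<in> carrier_vec s" for A0 y
  proof
    assume "\<forall>x\<in>U. gram_form A0 x y = 0" then show "\<forall>i<r'. gram_form A0 (row Q i) y = 0" using rU by blast
  next
    assume h: "\<forall>i<r'. gram_form A0 (row Q i) y = 0"
    show "\<forall>x\<in>U. gram_form A0 x y = 0"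
    proof
      fix x assume "x \<in> U"
      then obtain u where x: "x \<in> carrier_vec s" "\<And>c. c < s \<Longrightarrow> x $ c = (\<Sum>i<r'. u i * Q $$ (i,c))" by (auto simp: U_def)
      have A0c: "A0 \<in> carrier_mat s s" using CD(2) A0 GL_carrier by blast
      have "gram_form A0 x y = (\<Sum>i<r'. u i * gram_form A0 (row Q i) y)"
        by (rule gram_form_lincomb(1)[OF A0c Qc x(1) y x(2)])
      then show "gram_form A0 x y = 0" using h by simp
    qed
  qed
  have up: "gram_form (blk A r s r s) (row Q i) (vec s (\<lambda>k. y $ (r + k))) = gram_form A (row P i) y"
    if A: "A \<in> bul r s W CC" and i: "i < r'" and y: "y \<in> carrier_vec ?N" "\<And>l. r + s \<le> l \<Longrightarrow> l < ?N \<Longrightarrow> y $ l = 0" for A i y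
    unfolding rQ[OF i]
    by (rule gram_form_bul[OF A _ y(1) _ y(2), symmetric]) (use z Pc i r'N in \<open>auto simp: carrier_vecI\<close>)
  have iso: "gram_form A0 x y = 0" if A0: "A0 \<in> CC" and x: "x \<in> U" and y: "y \<in> U" for A0 x y
  proof -
    obtain A where A: "A \<in> bul r s W CC" "blk A r s r s = A0" using ex[OF A0] by blast
    have A0c: "A0 \<in> carrier_mat s s" using CD(2) A0 GL_carrier by blast
    \<comment> \<open>The value is entry (i,j) of an element of the second set with i, j < r', which
      lies in its zero block.\<close>
    have 1: "gram_form A0 (row Q i) (row Q j) = 0" if "i < r'" "j < r'" for i j
    proof -
      have "gram_form A0 (row Q i) (row Q j) = gram_form A (row P i) (row P j)"
        using up[OF A(1) that(1), of "row P j"] that z Pc r'N by (simp add: A(2) rQ carrier_vecI)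
      also have "\<dots> = 0" using gram_form_cong_mat[OF Pc bulD(5)[OF A(1)], of i j] cz[OF A(1), of i j] that r'N by simp
      finally show ?thesis .
    qed
    obtain v where yv: "y \<in> carrier_vec s" "\<And>c. c < s \<Longrightarrow> y $ c = (\<Sum>i<r'. v i * Q $$ (i,c))" using y by (auto simp: U_def)
    have "gram_form A0 (row Q i) y = 0" if i: "i < r'" for i
    proof -
      have "row Q i \<in> carrier_vec s" using Qc by (simp add: carrier_vecI)
      then have "gram_form A0 (row Q i) y = (\<Sum>j<r'. v j * gram_form A0 (row Q i) (row Q j))"
        by (rule gram_form_lincomb(2)[OF A0c Qc _ yv])
      then show ?thesis using 1[OF i] by simp
    qed
    then show ?thesis using gU[OF A0 yv(1)] x by blast
  qed
  txt \<open>Membership of \<open>y\<close> in the orthogonal of \<open>U\<close> is read off the coordinates \<open>v\<close> of \<open>(0, y, 0)\<close> in the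
    rows of \<open>P\<close>, hence is independent of the form.\<close>
  have orth: "(\<forall>x\<in>U. gram_form A0 x y = 0) \<longleftrightarrow> (\<forall>j<r'. v (r' + s' + j) = 0)"
    if A0: "A0 \<in> CC" and y: "y \<in> carrier_vec s"
      and v: "\<And>c. c < ?N \<Longrightarrow> (\<Sum>i<?N. v i * P $$ (i,c)) = (if r \<le> c \<and> c < r + s then y $ (c - r) else 0)" for A0 y v
  proof -
    obtain A where A: "A \<in> bul r s W CC" "blk A r s r s = A0" using ex[OF A0] by blast
    define y' where "y' = vec ?N (\<lambda>c. if r \<le> c \<and> c < r + s then y $ (c - r) else 0)"
    have y'c: "y' \<in> carrier_vec ?N" by (simp add: y'_def)
    have yy: "vec s (\<lambda>k. y' $ (r + k)) = y" using y by (intro eq_vecI) (auto simp: y'_def)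
    let ?B = "cong_mat P A"
    have B: "?B \<in> bul r' s' W' CC'" using S A by auto
    have Mg: "blk ?B 0 r' (r' + s') r' \<in> GL r'"
      using bulD(3)[OF B] W' affine_subspace_matD(2) by (auto simp: invertible_affine_def GL_def)
    \<comment> \<open>Row i of the congruent matrix is zero outside its last block, which is
      invertible; so orthogonality to all rows of \<open>Q\<close> means that the last coordinates
      of v vanish.\<close>
    have e: "gram_form A0 (row Q i) y = (\<Sum>j<r'. blk ?B 0 r' (r' + s') r' $$ (i,j) * v (r' + s' + j))" if i: "i < r'" for i
    proof -
      have "gram_form A0 (row Q i) y = gram_form A (row P i) y'"
        using up[OF A(1) i y'c] unfolding yy A(2) by (simp add: y'_def)
      also have "\<dots> = (\<Sum>j<?N. v j * gram_form A (row P i) (row P j))"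
        by (rule gram_form_lincomb(2)[OF bulD(5)[OF A(1)] Pc _ y'c]) (use Pc v in \<open>auto simp: y'_def carrier_vecI\<close>)
      also have "\<dots> = (\<Sum>j<r' + s' + r'. ?B $$ (i,j) * v j)" unfolding N
        using i r'N by (intro sum.cong refl) (simp add: gram_form_cong_mat[OF Pc bulD(5)[OF A(1)]] mult.commute)
      also have "\<dots> = (\<Sum>j<r'. ?B $$ (i,r' + s' + j) * v (r' + s' + j))"
        using cz[OF A(1) i] unfolding sum_split_at[of _ "r' + s'"] by simp
      finally show ?thesis using i by simp
    qed
    show ?thesis unfolding gU[OF A0 y]
    proof
      assume h: "\<forall>i<r'. gram_form A0 (row Q i) y = 0"
      show "\<forall>j<r'. v (r' + s' + j) = 0"
      proof (intro allI impI)
        fix j assume j: "j < r'"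
        show "v (r' + s' + j) = 0"
        proof (rule GL_kernel[OF Mg _ j, where v = "\<lambda>j. v (r' + s' + j)"])
          show "(\<Sum>j<r'. blk ?B 0 r' (r' + s') r' $$ (i,j) * v (r' + s' + j)) = 0" if "i < r'" for i
            unfolding e[OF that, symmetric] using h that by blast
        qed
      qed
    next
      assume "\<forall>j<r'. v (r' + s' + j) = 0" then show "\<forall>i<r'. gram_form A0 (row Q i) y = 0" using e by simp
    qed
  qed
  have orth_eq: "{y \<in> carrier_vec s. \<forall>x\<in>U. gram_form A x y = 0} = {y \<in> carrier_vec s. \<forall>x\<in>U. gram_form B x y = 0}"
    if AB: "A \<in> CC" "B \<in> CC" for A B
  proof -
    have "(\<forall>x\<in>U. gram_form A x y = 0) \<longleftrightarrow> (\<forall>x\<in>U. gram_form B x y = 0)" if y: "y \<in> carrier_vec s" for y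
    proof -
      obtain v where v: "\<And>c. c < ?N \<Longrightarrow> (\<Sum>i<?N. v i * P $$ (i,c)) = (if r \<le> c \<and> c < r + s then y $ (c - r) else 0)"
        using GL_left_solve[OF P, of "\<lambda>c. if r \<le> c \<and> c < r + s then y $ (c - r) else 0"] by blast
      show ?thesis using orth[OF AB(1) y v] orth[OF AB(2) y v] by simp
    qed
    then show ?thesis by blast
  qed
  have "U = {0\<^sub>v s}" using irr iso orth_eq Usp unfolding irreducible_mats_iff[OF CD(1-3)] by blast
  then have "row Q i = 0\<^sub>v s" using rU[OF ik(1)] by auto
  then have "row Q i $ (k - r) = 0" using ik True by simp
  then show ?thesis using ik True Qc r'N by (simp add: Q_def)
qed

section \<open>Congruences according to their top right block\<close>

text \<open>A relation between the sheared rows is a relation between rows of \<open>P\<close> in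
  which the shears change only the coefficient at q; comparison of the other coefficients gives the
  claim.\<close>

lemma sheared_rows_independent:
  assumes P: "P \<in> GL N" and m: "m \<le> N" and q: "q < m" and aq: "a q = 0"
    and z: "\<And>k. k < N \<Longrightarrow> (\<Sum>j<m. a j * (P $$ (j,k) - c j * P $$ (q,k))) = (0 :: 'a::field)"
    and j: "j < m"
  shows "a j = 0"
proof (cases "j = q")
  case False
  let ?d = "\<Sum>i<m. a i * c i"
  let ?u = "\<lambda>j. (if j < m then a j else 0) - (if j = q then ?d else 0)"
  have "?u j = 0"
  proof (rule GL_left_kernel[OF P, where v = ?u and i = j])
    fix k assume k: "k < N"
    have "(\<Sum>j<N. ?u j * P $$ (j,k)) = (\<Sum>j<N. (if j < m then a j else 0) * P $$ (j,k)) - (\<Sum>j<N. if j = q then ?d * P $$ (j,k) else 0)"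
      by (simp add: left_diff_distrib sum_subtractf if_distrib[of "\<lambda>x. x * _"] cong: if_cong)
    also have "(\<Sum>j<N. if j = q then ?d * P $$ (j,k) else 0) = ?d * P $$ (q,k)" using q m by simp
    also have "(\<Sum>j<N. (if j < m then a j else 0) * P $$ (j,k)) = (\<Sum>j<m. a j * P $$ (j,k))"
    proof -
      have "N = m + (N - m)" using m by simp
      then have "(\<Sum>j<N. (if j < m then a j else 0) * P $$ (j,k)) = (\<Sum>j<m + (N - m). (if j < m then a j else 0) * P $$ (j,k))" by metis
      then show ?thesis by (simp add: sum_split_at)
    qed
    also have "(\<Sum>j<m. a j * P $$ (j,k)) - ?d * P $$ (q,k) = (\<Sum>j<m. a j * (P $$ (j,k) - c j * P $$ (q,k)))"
      by (simp add: sum_subtractf sum_distrib_right right_diff_distrib mult.assoc)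
    finally show "(\<Sum>j<N. ?u j * P $$ (j,k)) = 0" using z[OF k] by simp
  qed (use j m in auto)
  then show ?thesis using False j by simp
qed (use aq in simp)

text \<open>On a plane all symplectic forms are proportional and every line is its own orthogonal;
  \<open>U\<close> is the first coordinate axis.\<close>

lemma not_irreducible_mats_2:
  assumes C: "symplectic_affine 2 (CC :: 'a::field mat set)"
  shows "\<not> irreducible_mats 2 CC"
proof -
  note CD = symplectic_affineD[OF C]
  define U where "U = {x \<in> carrier_vec 2. x $ 1 = (0 :: 'a)}"
  have two: "(\<Sum>i<2. f i) = f 0 + f 1" for f :: "nat \<Rightarrow> 'a" by (simp add: numeral_2_eq_2)
  have e: "gram_form A x y = x $ 0 * A $$ (0,1) * y $ 1" if "A \<in> CC" "x \<in> U" "y \<in> carrier_vec 2" for A x y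
  proof -
    have A: "A \<in> alternating_mats 2" using CD that by auto
    show ?thesis using that alternating_matsD(3)[OF A, of 0]
      by (simp add: gram_form_index[OF alternating_matsD(1)[OF A]] two U_def)
  qed
  have A01: "A $$ (0,1) \<noteq> 0" if "A \<in> CC" for A
  proof
    assume z: "A $$ (0,1) = 0"
    have A: "A \<in> alternating_mats 2" "A \<in> GL 2" using CD that by auto
    have z2: "A $$ (1,0) = 0" using alternating_matsD(2)[OF A(1), of 1 0] z by simp
    have "(\<lambda>_. 1 :: 'a) (0::nat) = 0"
    proof (rule GL_kernel[OF A(2), where v = "\<lambda>_. 1" and j = 0])
      show "(\<Sum>j<2. A $$ (i,j) * 1) = 0" if "i < 2" for i
        using that z z2 alternating_matsD(3)[OF A(1), of 0] alternating_matsD(3)[OF A(1), of 1] by (auto simp: two less_2_cases_iff)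
    qed simp
    then show False by simp
  qed
  have "vectorspace class_ring (module_vec TYPE('a) 2)" by (rule vec_vs)
  then have sp: "VectorSpace.subspace class_ring U (module_vec TYPE('a) 2)"
    by (auto simp: VectorSpace.subspace_def submodule_def vectorspace_def module_vec_simps U_def)
  have un: "unit_vec 2 0 \<in> U" by (auto simp: U_def)
  have ne: "U \<noteq> {0\<^sub>v 2}"
  proof
    assume "U = {0\<^sub>v 2}"
    then have "unit_vec 2 0 $ 0 = (0\<^sub>v 2 :: 'a vec) $ 0" using un by auto
    then show False by simp
  qed
  have "{y \<in> carrier_vec 2. \<forall>x\<in>U. gram_form A x y = 0} = {y \<in> carrier_vec 2. y $ 1 = 0}" if A: "A \<in> CC" for A
  proof -
    have "(\<forall>x\<in>U. gram_form A x y = 0) \<longleftrightarrow> y $ 1 = 0" if y: "y \<in> carrier_vec 2" for y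
    proof
      assume "\<forall>x\<in>U. gram_form A x y = 0"
      then have "gram_form A (unit_vec 2 0) y = 0" using un by blast
      then show "y $ 1 = 0" using e[OF A un y] A01[OF A] by simp
    qed (use e[OF A _ y] in simp)
    then show ?thesis by blast
  qed
  moreover have "\<forall>A\<in>CC. \<forall>x\<in>U. \<forall>y\<in>U. gram_form A x y = 0" using e by (auto simp: U_def)
  ultimately show ?thesis unfolding irreducible_mats_iff[OF CD(1-3)] using sp ne by blast
qed

text \<open>Beyond column r the first r' + s' rows of \<open>P\<close> are multiples of row q: entry
  (q,j) of each congruent matrix is zero, so the minors on rows q, j vanish. Column l0 determines
  the factor.\<close>

lemma bul_top_right_collinear:
  fixes P :: "'a::field mat"
  assumes ne: "bul r s W CC \<noteq> {}" and N: "r' + s' + r' = r + s + r" and P: "P \<in> GL (r + s + r)"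
    and S: "bul r' s' W' CC' = cong_mat P ` bul r s W CC"
    and q: "q < r'" "r + s \<le> l0" "l0 < r + s + r" "P $$ (q,l0) \<noteq> 0"
    and jk: "j < r' + s'" "r \<le> k" "k < r + s + r"
  shows "P $$ (j,k) = P $$ (j,l0) / P $$ (q,l0) * P $$ (q,k)"
proof -
  have "P $$ (q,k) * P $$ (j,l0) = P $$ (q,l0) * P $$ (j,k)"
  proof (rule bul_minors[OF ne GL_carrier[OF P] _ _ _ jk(2,3) q(2,3)])
    fix A assume "A \<in> bul r s W CC"
    then have "cong_mat P A \<in> bul r' s' W' CC'" using S by auto
    then show "cong_mat P A $$ (q,j) = 0" using bulD(2) q jk by metis
  qed (use q jk N in linarith)+
  then show ?thesis using q(4) by (simp add: field_simps)
qed

lemma bul_top_right_nonzero: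
  fixes P :: "'a::field mat"
  assumes ne: "bul r s W CC \<noteq> {}" and N: "r' + s' + r' = r + s + r" and P: "P \<in> GL (r + s + r)"
    and S: "bul r' s' W' CC' = cong_mat P ` bul r s W CC"
    and C: "symplectic_affine s CC" "irreducible_mats s CC" "even s"
    and C': "symplectic_affine s' CC'" "irreducible_mats s' CC'" "even s'"
    and q: "q < r'" "r + s \<le> l0" "l0 < r + s + r" "P $$ (q,l0) \<noteq> 0"
  shows "s = 0 \<and> s' = 0 \<and> r = r'"
proof -
  let ?N = "r + s + r" and ?m = "r' + s'"
  define c where "c j = P $$ (j,l0) / P $$ (q,l0)" for j
  note col = bul_top_right_collinear[OF ne N P S q, folded c_def]
  have cq: "c q = 1" using q by (simp add: c_def)
  txt \<open>Up to multiples of row \<open>q\<close>, the first \<open>r' + s'\<close> rows of \<open>P\<close> are supported on \<open>r\<close> columns.\<close>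
  have "?m \<le> r + 1"
  proof (rule ccontr)
    assume "\<not> ?m \<le> r + 1"
    then have lt: "r + 1 < ?m" by simp
    \<comment> \<open>The first r equations cancel the sheared rows on the first r columns; the last
      one, of index r, imposes a q = 0.\<close>
    obtain a where a: "\<And>i. i < r + 1 \<Longrightarrow> (\<Sum>j<?m. (if i < r then P $$ (j,i) - c j * P $$ (q,i) else if j = q then 1 else 0) * a j) = 0"
      and nz: "\<exists>j<?m. a j \<noteq> 0"
      using underdetermined_solution[OF lt, of "\<lambda>i j. if i < r then P $$ (j,i) - c j * P $$ (q,i) else if j = q then 1 else 0"] by blast
    have qm: "q < ?m" using q by simp
    have "(\<Sum>j<?m. (if j = q then 1 else 0) * a j) = (\<Sum>j<?m. if j = q then a j else 0)" by (intro sum.cong) auto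
    then have aq: "a q = 0" using a[of r] qm by simp
    have "a j = 0" if "j < ?m" for j
    proof (rule sheared_rows_independent[of P ?N ?m q a c, OF P _ qm aq _ that])
      fix k assume k: "k < ?N"
      show "(\<Sum>j<?m. a j * (P $$ (j,k) - c j * P $$ (q,k))) = 0"
      proof (cases "k < r")
        case True
        have "(\<Sum>j<?m. a j * (P $$ (j,k) - c j * P $$ (q,k))) = (\<Sum>j<?m. (P $$ (j,k) - c j * P $$ (q,k)) * a j)"
          by (simp add: mult.commute)
        then show ?thesis using a[of k] True by simp
      next
        case False
        show ?thesis
        proof (rule sum.neutral, rule ballI)
          fix j assume "j \<in> {..<?m}"
          then have "P $$ (j,k) - c j * P $$ (q,k) = 0" using col[of j k] False k by simp
          then show "a j * (P $$ (j,k) - c j * P $$ (q,k)) = 0" by simp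
        qed
      qed
    qed (use N in linarith)
    then show False using nz by blast
  qed
  moreover have "s \<noteq> 2" using not_irreducible_mats_2 C by auto
  moreover have "s' \<noteq> 2" using not_irreducible_mats_2 C' by auto
  moreover obtain t t' where t: "s = 2 * t" "s' = 2 * t'" using C(3) C'(3) unfolding dvd_def by blast
  \<comment> \<open>From r' + s' \<le> r + 1 and 2r + s = 2r' + s' follows s + s' \<le> 2; evenness
    and the exclusion of size two leave only zero.\<close>
  ultimately have "t + t' \<le> 1" "t \<noteq> 1" "t' \<noteq> 1" using N by auto
  then have "t = 0" "t' = 0" by linarith+
  then show ?thesis using t N by simp
qed

text \<open>Only the first block row of \<open>P\<close> is assumed to be triangular. The zero block
  of the target set propagates this to the second block row, after which the diagonal blocks of
  \<open>P\<close> act separately on the two factors.\<close>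

lemma bul_lower_triangular_unique:
  fixes P :: "'a::field mat"
  assumes W: "invertible_affine r W" and C: "symplectic_affine s CC"
    and W': "invertible_affine r W'" and C': "symplectic_affine s CC'"
    and P: "P \<in> GL (r + s + r)" and S: "bul r s W' CC' = cong_mat P ` bul r s W CC"
    and z: "\<And>i j. i < r \<Longrightarrow> r \<le> j \<Longrightarrow> j < r + s + r \<Longrightarrow> P $$ (i,j) = 0"
  shows "equivalent_mats r W W' \<and> congruent_mats s CC CC'"
proof -
  let ?N = "r + s + r"
  note Pc = GL_carrier[OF P] and CD = symplectic_affineD[OF C] and CD' = symplectic_affineD[OF C']
  have Wc: "W \<subseteq> carrier_mat r r" "W \<noteq> {}" and Wc': "W' \<subseteq> carrier_mat r r" "W' \<noteq> {}"
    using W W' affine_subspace_matD(1,2) by (auto simp: invertible_affine_def)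
  have Wg: "M \<in> GL r" if "M \<in> W" for M using that W Wc by (auto simp: invertible_affine_def GL_def)
  have Wg': "M \<in> GL r" if "M \<in> W'" for M using that W' Wc' by (auto simp: invertible_affine_def GL_def)
  obtain A where A: "A \<in> bul r s W CC"
    using bul_ex[OF Wc(1) CD(1)] Wc(2) CD(3) by blast
  have B: "cong_mat P A \<in> bul r s W' CC'" using A S by auto
  have sp: "(\<Sum>j<r + s + r. f j) = (\<Sum>j<r. f j) + (\<Sum>j<s. f (r + j)) + (\<Sum>j<r. f (r + s + j))" for f :: "nat \<Rightarrow> 'a"
    by (simp add: sum_split_at)
  let ?X = "blk P 0 r 0 r"
  have X: "?X \<in> GL r" unfolding GL_iff_left_kernel[OF blk_carrier(1)]
  proof (intro allI impI)
    fix v :: "nat \<Rightarrow> 'a" and i assume v: "\<forall>j<r. (\<Sum>i<r. v i * ?X $$ (i,j)) = 0" and i: "i < r"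
    let ?v = "\<lambda>i. if i < r then v i else 0"
    have "?v i = 0"
    proof (rule GL_left_kernel[OF P, where v = ?v and i = i])
      fix j assume j: "j < ?N"
      have "(\<Sum>i<?N. ?v i * P $$ (i,j)) = (\<Sum>i<r. v i * P $$ (i,j))" by (simp add: sp)
      also have "\<dots> = 0"
      proof (cases "j < r")
        case True
        have "(\<Sum>i<r. v i * P $$ (i,j)) = (\<Sum>i<r. v i * ?X $$ (i,j))" using True by (intro sum.cong) auto
        then show ?thesis using v True by simp
      qed (use z j in simp)
      finally show "(\<Sum>i<?N. ?v i * P $$ (i,j)) = 0" .
    qed (use i in auto)
    then show "v i = 0" using i by simp
  qed
  \<comment> \<open>The entries (i,j) with i < r of the congruent matrix form X M applied to the
    last part of row j of \<open>P\<close>. They vanish, and X and M are invertible.\<close>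
  have z2: "P $$ (j,l) = 0" if j: "j < r + s" and l: "r + s \<le> l" "l < ?N" for j l
  proof -
    let ?M = "blk A 0 r (r + s) r"
    have M: "?M \<in> GL r" by (rule Wg[OF bulD(3)[OF A]])
    define w where "w k = (\<Sum>l<r. ?M $$ (k,l) * P $$ (j, r + s + l))" for k
    have "w k = 0" if "k < r" for k
    proof (rule GL_kernel[OF X _ that, where v = w])
      fix i assume i: "i < r"
      have "(\<Sum>k<r. ?X $$ (i,k) * w k) = (\<Sum>k<r. \<Sum>l<r. P $$ (i,k) * A $$ (k, r + s + l) * P $$ (j, r + s + l))"
        using i by (simp add: w_def sum_distrib_left mult.assoc)
      also have "\<dots> = cong_mat P A $$ (i,j)"
        using i j z bulD(2)[OF A] by (simp add: cong_mat_index[OF Pc bulD(5)[OF A]] sp)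
      also have "\<dots> = 0" using bulD(2)[OF B i j] .
      finally show "(\<Sum>k<r. ?X $$ (i,k) * w k) = 0" .
    qed
    then have "P $$ (j, r + s + (l - (r + s))) = 0"
      by (intro GL_kernel[OF M, where v = "\<lambda>l. P $$ (j, r + s + l)"]) (use l in \<open>auto simp: w_def\<close>)
    then show ?thesis using l by simp
  qed
  let ?Z = "blk P (r + s) r (r + s) r" and ?Y = "blk P r s r s"
  have t: "blk (cong_mat P A) 0 r (r + s) r = ?X * blk A 0 r (r + s) r * transpose_mat ?Z"
    "blk (cong_mat P A) r s r s = cong_mat ?Y (blk A r s r s)" if A: "A \<in> bul r s W CC" for A
    using cong_mat_block_triangular(2,3)[OF Pc bulD(1)[OF A] z z2 bulD(2)[OF A]] by auto
  have W'eq: "W' = (\<lambda>M. ?X * M * transpose_mat ?Z) ` W"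
  proof -
    have "W' = (\<lambda>A. blk A 0 r (r + s) r) ` cong_mat P ` bul r s W CC"
      using bul_blk_images(1)[OF Wc' CD'(1,3)] S by simp
    also have "\<dots> = (\<lambda>M. ?X * M * transpose_mat ?Z) ` (\<lambda>A. blk A 0 r (r + s) r) ` bul r s W CC"
      unfolding image_image by (rule image_cong[OF refl]) (rule t(1))
    finally show ?thesis using bul_blk_images(1)[OF Wc CD(1,3)] by simp
  qed
  have C'eq: "CC' = cong_mat ?Y ` CC"
  proof -
    have "CC' = (\<lambda>A. blk A r s r s) ` cong_mat P ` bul r s W CC"
      using bul_blk_images(2)[OF Wc' CD'(1,3)] S by simp
    also have "\<dots> = cong_mat ?Y ` (\<lambda>A. blk A r s r s) ` bul r s W CC"
      unfolding image_image by (rule image_cong[OF refl]) (rule t(2))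
    finally show ?thesis using bul_blk_images(2)[OF Wc CD(1,3)] by simp
  qed
  \<comment> \<open>The blocks of one element of the target set are invertible products with factor
    Z^T or Y; determinants transfer invertibility to these factors.\<close>
  have Zg: "transpose_mat ?Z \<in> GL r"
  proof -
    have "?X * blk A 0 r (r + s) r * transpose_mat ?Z \<in> GL r" using Wg'[OF bulD(3)[OF B]] t(1)[OF A] by simp
    then have "det (?X * blk A 0 r (r + s) r * transpose_mat ?Z) \<noteq> 0" by (simp add: GL_iff_det)
    moreover have "det (?X * blk A 0 r (r + s) r * transpose_mat ?Z) = det (?X * blk A 0 r (r + s) r) * det (transpose_mat ?Z)"
      by (rule det_mult[of _ r]) auto
    ultimately show ?thesis by (auto simp: GL_iff_det)
  qed
  have Yg: "?Y \<in> GL s"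
  proof -
    have "cong_mat ?Y (blk A r s r s) \<in> GL s" using CD'(2) bulD(4)[OF B] t(2)[OF A] by auto
    then have "det (?Y * blk A r s r s * transpose_mat ?Y) \<noteq> 0" by (simp add: GL_iff_det cong_mat_def)
    moreover have "det (?Y * blk A r s r s * transpose_mat ?Y) = det ?Y * det (blk A r s r s) * det (transpose_mat ?Y)"
      using det_mult[of "?Y * blk A r s r s" s "transpose_mat ?Y"] det_mult[of ?Y s "blk A r s r s"]
        mult_carrier_mat[of ?Y s s "blk A r s r s" s] by simp
    ultimately show ?thesis by (auto simp: GL_iff_det)
  qed
  show ?thesis using X Zg Yg W'eq C'eq by (auto simp: equivalent_mats_def congruent_mats_iff)
qed
text \<open>Changing row \<open>q\<close> outside column \<open>q\<close> preserves invertibility here, so optimality gives the closure.\<close>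

lemma optimal_row_closed:
  fixes W :: "'a::field mat set"
  assumes W: "optimal_invertible_affine n W" and q: "q < n"
    and z: "\<And>M j. M \<in> W \<Longrightarrow> j < n \<Longrightarrow> j \<noteq> q \<Longrightarrow> M $$ (j,q) = 0"
    and M: "M \<in> W" and X: "X \<in> carrier_mat n n"
    and XM: "\<And>i j. i < n \<Longrightarrow> j < n \<Longrightarrow> i \<noteq> q \<or> j = q \<Longrightarrow> X $$ (i,j) = M $$ (i,j)"
  shows "X \<in> W"
proof -
  have Wa: "affine_subspace_mat n W" and Wi: "invertible_affine n W"
    using W by (auto simp: optimal_invertible_affine_def invertible_affine_def)
  note Wc = affine_subspace_matD(2)[OF Wa]
  define T where "T = {X \<in> carrier_mat n n. \<exists>M\<in>W. \<forall>i<n. \<forall>j<n. i \<noteq> q \<or> j = q \<longrightarrow> X $$ (i,j) = M $$ (i,j)}"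
  have WT: "W \<subseteq> T" using Wc by (auto simp: T_def)
  have "invertible_affine n T" unfolding invertible_affine_def
  proof (intro conjI ballI)
    show "affine_subspace_mat n T" unfolding affine_subspace_mat_iff
    proof (intro conjI ballI allI)
      show "T \<noteq> {}" using WT M by auto
      show "T \<subseteq> carrier_mat n n" by (auto simp: T_def)
      fix A Y Z c assume "A \<in> T" "Y \<in> T" "Z \<in> T"
      then obtain A' Y' Z' where h: "A \<in> carrier_mat n n" "Y \<in> carrier_mat n n" "Z \<in> carrier_mat n n" "A' \<in> W" "Y' \<in> W" "Z' \<in> W"
        "\<forall>i<n. \<forall>j<n. i \<noteq> q \<or> j = q \<longrightarrow> A $$ (i,j) = A' $$ (i,j)"
        "\<forall>i<n. \<forall>j<n. i \<noteq> q \<or> j = q \<longrightarrow> Y $$ (i,j) = Y' $$ (i,j)"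
        "\<forall>i<n. \<forall>j<n. i \<noteq> q \<or> j = q \<longrightarrow> Z $$ (i,j) = Z' $$ (i,j)"
        by (auto simp: T_def)
      have "A' + c \<cdot>\<^sub>m (Y' - Z') \<in> W" by (rule affine_subspace_matD(3)[OF Wa h(4-6)])
      moreover have "\<forall>i<n. \<forall>j<n. i \<noteq> q \<or> j = q \<longrightarrow> (A + c \<cdot>\<^sub>m (Y - Z)) $$ (i,j) = (A' + c \<cdot>\<^sub>m (Y' - Z')) $$ (i,j)"
        using h Wc[OF h(4)] Wc[OF h(5)] Wc[OF h(6)] by simp
      moreover have "A + c \<cdot>\<^sub>m (Y - Z) \<in> carrier_mat n n" using h(1-3) by auto
      ultimately show "A + c \<cdot>\<^sub>m (Y - Z) \<in> T" unfolding T_def by blast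
    qed
  next
    fix Y assume "Y \<in> T"
    then obtain L where L: "L \<in> W" and Y: "Y \<in> carrier_mat n n"
      and YL: "\<And>i j. i < n \<Longrightarrow> j < n \<Longrightarrow> i \<noteq> q \<or> j = q \<Longrightarrow> Y $$ (i,j) = L $$ (i,j)" by (auto simp: T_def)
    have Lg: "L \<in> GL n" using L Wi Wc[OF L] by (auto simp: invertible_affine_def GL_def)
    have lq: "L $$ (q,q) \<noteq> 0"
    proof
      assume q0: "L $$ (q,q) = 0"
      have "(\<lambda>j. if j = q then 1 else 0 :: 'a) q = 0"
      proof (rule GL_kernel[OF Lg _ q, where v = "\<lambda>j. if j = q then 1 else 0"])
        show "(\<Sum>j<n. L $$ (i,j) * (if j = q then 1 else 0)) = 0" if "i < n" for i
        proof (rule sum.neutral, rule ballI)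
          fix j assume "j \<in> {..<n}"
          show "L $$ (i,j) * (if j = q then 1 else 0) = 0" using z[OF L that] q0 by (cases "i = q") auto
        qed
      qed
      then show False by simp
    qed
    have rest: "(\<Sum>j<n. f j) = f q + (\<Sum>j\<in>{..<n} - {q}. f j)" for f :: "nat \<Rightarrow> 'a"
      using q by (simp add: sum.remove)
    have "Y \<in> GL n" unfolding GL_iff_kernel[OF Y]
    proof (intro allI impI)
      fix v :: "nat \<Rightarrow> 'a" and l assume v: "\<forall>i<n. (\<Sum>j<n. Y $$ (i,j) * v j) = 0" and l: "l < n"
      \<comment> \<open>\<open>w\<close> corrects v at position q so that row q of \<open>L\<close>
        annihilates it. The other rows do not notice the change, since column q of \<open>L\<close>
        is zero outside the diagonal.\<close>
      define w where "w j = (if j = q then - (\<Sum>j\<in>{..<n} - {q}. L $$ (q,j) * v j) / L $$ (q,q) else v j)" for j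
      have w0: "w j = 0" if "j < n" for j
      proof (rule GL_kernel[OF Lg _ that, where v = w])
        fix i assume i: "i < n"
        show "(\<Sum>j<n. L $$ (i,j) * w j) = 0"
        proof (cases "i = q")
          case True then show ?thesis unfolding rest using lq by (simp add: w_def)
        next
          case False
          have "(\<Sum>j<n. L $$ (i,j) * w j) = (\<Sum>j<n. Y $$ (i,j) * v j)"
            using z[OF L i False] YL[OF i] i False by (intro sum.cong) (auto simp: w_def)
          then show ?thesis using v i by simp
        qed
      qed
      have o: "v j = 0" if "j < n" "j \<noteq> q" for j using w0[OF that(1)] that by (simp add: w_def)
      have "(\<Sum>j<n. Y $$ (q,j) * v j) = L $$ (q,q) * v q" unfolding rest using o YL[OF q q] by simp
      then have "v q = 0" using v q lq by simp
      then show "v l = 0" using o[OF l] by (cases "l = q") auto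
    qed
    then show "invertible_mat Y" by (simp add: GL_def)
  qed
  then have "W = T" by (rule optimal_invertible_affine_eq[OF W _ WT])
  moreover have "X \<in> T" using X M XM unfolding T_def by blast
  ultimately show ?thesis by simp
qed

text \<open>\<open>P\<close> is factored as Z R. Here R maps the set onto the one built from W1 = G1
  W G2^T, and Z has zero top right block, so the triangular case applies to Z.\<close>

lemma bul_0_equivalent:
  fixes P :: "'a::field mat"
  assumes W: "optimal_invertible_affine r W" and C: "symplectic_affine 0 CC"
    and W': "invertible_affine r W'" and C': "symplectic_affine 0 CC'"
    and O: "optimal_symplectic_affine (r + 0 + r) (bul r 0 W CC)"
    and P: "P \<in> GL (r + 0 + r)" and S: "bul r 0 W' CC' = cong_mat P ` bul r 0 W CC"
    and q: "q < r" and l0: "r \<le> l0" "l0 < r + r" "P $$ (q,l0) \<noteq> 0"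
  shows "equivalent_mats r W W' \<and> congruent_mats 0 CC CC'"
proof -
  let ?N = "r + 0 + r"
  have Wi: "invertible_affine r W" using W by (simp add: optimal_invertible_affine_def)
  note Pc = GL_carrier[OF P] and CD = symplectic_affineD[OF C]
  have Wc: "W \<subseteq> carrier_mat r r" "W \<noteq> {}"
    using Wi affine_subspace_matD(1,2) by (auto simp: invertible_affine_def)
  have ne: "bul r 0 W CC \<noteq> {}" using bul_ex[OF Wc(1) CD(1)] Wc(2) CD(3) by blast
  have sp: "(\<Sum>j<r + 0 + r. f j) = (\<Sum>j<r. f j) + (\<Sum>j<r. f (r + j))" for f :: "nat \<Rightarrow> 'a"
    using sum_split_at[of f r r] by simp
  define c where "c j = P $$ (j,l0) / P $$ (q,l0)" for j
  have cq: "c q = 1" using l0 by (simp add: c_def)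
  have col: "P $$ (j,k) = c j * P $$ (q,k)" if "j < r" "r \<le> k" "k < r + r" for j k
    unfolding c_def by (rule bul_top_right_collinear[OF ne refl P S q]) (use l0 that in auto)
  define a where "a j k = P $$ (j,k) - c j * P $$ (q,k)" for j k
  have a0: "a j k = 0" if "j < r" "r \<le> k" "k < r + r" for j k using col[OF that] by (simp add: a_def)
  define b where "b l = P $$ (q, r + l)" for l

  \<comment> \<open>Entry (j,q) minus c j times entry (q,q) pairs the sheared row
    \<open>a j\<close>, which has no last part, with row q of \<open>P\<close>; only the last part b
    of the latter meets a nonzero block. Both entries vanish as j, q < r.\<close>
  have key: "(\<Sum>k<r. \<Sum>l<r. a j k * A $$ (k, r + l) * b l) = 0" if A: "A \<in> bul r 0 W CC" and j: "j < r" for A j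
  proof -
    have B: "cong_mat P A \<in> bul r 0 W' CC'" using A S by auto
    have "0 = cong_mat P A $$ (j,q) - c j * cong_mat P A $$ (q,q)" using bulD(2)[OF B] j q by simp
    also have "\<dots> = (\<Sum>k<?N. \<Sum>l<?N. a j k * A $$ (k,l) * P $$ (q,l))"
      using j q by (simp add: cong_mat_index[OF Pc bulD(5)[OF A]] a_def sum_distrib_left
          sum_subtractf[symmetric] left_diff_distrib mult.assoc)
    also have "\<dots> = (\<Sum>k<r. \<Sum>l<r. a j k * A $$ (k, r + l) * b l)"
      using a0[OF j] bulD(2)[OF A] by (simp only: sp) (simp add: b_def)
    finally show ?thesis by simp
  qed

  txt \<open>\<open>G1\<close> has the rows \<open>a j\<close> outside position \<open>q\<close>, and row \<open>q\<close> of \<open>G2\<close> is \<open>b\<close>: by \<open>key\<close>, all elements of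
    \<open>G1 W G2\<^sup>T\<close> vanish on column \<open>q\<close> outside the diagonal.\<close>
  let ?X = "mat r r (\<lambda>(j,k). a j k)"
  \<comment> \<open>Row q of \<open>?X\<close> is zero because c q = 1. A kernel vector u with u l
    \<noteq> 0 is annihilated by all rows \<open>a j\<close> but not by the l-th unit row, so the
    latter can complete them at position q.\<close>
  have "?X \<notin> GL r"
  proof
    assume g: "?X \<in> GL r"
    have "(\<lambda>i. if i = q then 1 else 0 :: 'a) q = 0"
    proof (rule GL_left_kernel[OF g _ q, where v = "\<lambda>i. if i = q then 1 else 0"])
      show "(\<Sum>i<r. (if i = q then 1 else 0) * ?X $$ (i,j)) = 0" if "j < r" for j
        using that cq by (intro sum.neutral) (auto simp: a_def)
    qed
    then show False by simp
  qed
  then obtain u l where u: "\<forall>i<r. (\<Sum>j<r. ?X $$ (i,j) * u j) = 0" and l: "l < r" "u l \<noteq> 0"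
    unfolding GL_iff_kernel[OF mat_carrier] by blast
  define G1 where "G1 = mat r r (\<lambda>(j,k). if j = q then (if k = l then 1 else 0) else a j k)"
  have G1: "G1 \<in> GL r"
  proof (subst GL_iff_left_kernel, simp add: G1_def, intro allI impI)
    fix v :: "nat \<Rightarrow> 'a" and i assume v: "\<forall>k<r. (\<Sum>i<r. v i * G1 $$ (i,k)) = 0" and i: "i < r"
    have rest: "(\<Sum>j<r. f j) = f q + (\<Sum>j\<in>{..<r} - {q}. f j)" for f :: "nat \<Rightarrow> 'a"
      using q by (simp add: sum.remove)
    have "0 = (\<Sum>k<r. (\<Sum>i<r. v i * G1 $$ (i,k)) * u k)" using v by simp
    also have "\<dots> = (\<Sum>i<r. v i * (\<Sum>k<r. G1 $$ (i,k) * u k))"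
      unfolding sum_distrib_left sum_distrib_right by (subst sum.swap) (simp add: mult.assoc)
    also have "\<dots> = v q * (\<Sum>k<r. G1 $$ (q,k) * u k) + (\<Sum>i\<in>{..<r} - {q}. v i * (\<Sum>k<r. ?X $$ (i,k) * u k))"
      unfolding rest[of "\<lambda>i. v i * (\<Sum>k<r. G1 $$ (i,k) * u k)"]
      by (intro arg_cong2[where f = plus] refl sum.cong arg_cong2[where f = times]) (auto simp: G1_def)
    also have "\<dots> = v q * (\<Sum>k<r. if k = l then u k else 0)"
    proof -
      have "(\<Sum>i\<in>{..<r} - {q}. v i * (\<Sum>k<r. ?X $$ (i,k) * u k)) = 0" using u by (intro sum.neutral) auto
      moreover have "(\<Sum>k<r. G1 $$ (q,k) * u k) = (\<Sum>k<r. if k = l then u k else 0)"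
        using q by (intro sum.cong) (auto simp: G1_def)
      ultimately show ?thesis by simp
    qed
    also have "\<dots> = v q * u l" using l by simp
    finally have vq: "v q = 0" using l by simp
    show "v i = 0"
    proof (rule sheared_rows_independent[of P ?N r q v c, OF P _ q vq _ i])
      fix k assume k: "k < ?N"
      show "(\<Sum>j<r. v j * (P $$ (j,k) - c j * P $$ (q,k))) = 0"
      proof (cases "k < r")
        case True
        have "(\<Sum>j<r. v j * (P $$ (j,k) - c j * P $$ (q,k))) = (\<Sum>i<r. v i * G1 $$ (i,k))"
          using True vq by (intro sum.cong) (auto simp: G1_def a_def)
        then show ?thesis using v True by simp
      next
        case False
        then show ?thesis using a0[of _ k] k by (intro sum.neutral) (auto simp: a_def)
      qed
    qed simp
  qed
  have G1a: "G1 $$ (j,k) = a j k" if "j < r" "k < r" "j \<noteq> q" for j k using that by (simp add: G1_def)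

  define p where "p = l0 - r"
  have pr: "p < r" and bp: "b p \<noteq> 0" using l0 by (auto simp: p_def b_def)
  \<comment> \<open>As b p \<noteq> 0, row q of the identity with rows p and q swapped can be
    exchanged for b.\<close>
  obtain G2 where G2: "G2 \<in> GL r" "\<And>k. k < r \<Longrightarrow> G2 $$ (q,k) = b k"
  proof -
    let ?s = "\<lambda>i. if i = q then p else if i = p then q else i"
    let ?R = "mat r r (\<lambda>(i,c). 1\<^sub>m r $$ (?s i,c) :: 'a)"
    have R: "?R \<in> GL r" by (rule GL_swap_rows[OF GL_one q pr])
    have b: "b k = (\<Sum>i<r. b (?s i) * ?R $$ (i,k))" if k: "k < r" for k
    proof -
      have "(\<Sum>i<r. b (?s i) * ?R $$ (i,k)) = (\<Sum>i<r. if i = ?s k then b k else 0)"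
        using k q pr by (intro sum.cong) auto
      also have "\<dots> = b k" using k q pr by simp
      finally show ?thesis by simp
    qed
    have "mat r r (\<lambda>(i,c). if i = q then b c else ?R $$ (i,c)) \<in> GL r"
      by (rule GL_replace_row[OF R q, where w = "\<lambda>i. b (?s i)"]) (use bp b in auto)
    then show thesis by (rule that) (use q in simp)
  qed

  obtain x where x: "\<And>k. k < r \<Longrightarrow> (\<Sum>i<r. x i * G1 $$ (i,k)) = P $$ (q,k)"
    using GL_left_solve[OF G1, of "\<lambda>k. P $$ (q,k)"] by blast
  txt \<open>\<open>R\<close> is \<open>diag(G1, G2)\<close> with its rows \<open>e = (G1 q, 0)\<close> and \<open>f = (0, b)\<close> replaced by \<open>x q e + f\<close>
    and \<open>-e\<close>; its top rows span the top rows of \<open>P\<close>.\<close>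
  define tt where "tt i k = (if i < r then (if i = q then x q else 1) * G1 $$ (i,k) else if i = r + q then - G1 $$ (q,k) else 0)" for i k
  define bb where "bb i k = (if i < r then (if i = q then b k else 0) else if i = r + q then 0 else G2 $$ (i - r,k))" for i k
  define R where "R = mat ?N ?N (\<lambda>(i,j). if j < r then tt i j else bb i (j - r))"
  have Rc: "R \<in> carrier_mat ?N ?N" by (simp add: R_def)
  have Rt: "R $$ (i,k) = tt i k" "R $$ (i, r + k) = bb i k" if "i < ?N" "k < r" for i k
    using that by (auto simp: R_def)
  have RG: "R \<in> GL ?N" unfolding GL_iff_left_kernel[OF Rc]
  proof (intro allI impI)
    fix v :: "nat \<Rightarrow> 'a" and i assume v: "\<forall>j<?N. (\<Sum>i<?N. v i * R $$ (i,j)) = 0" and i: "i < ?N"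
    \<comment> \<open>In the right half of \<open>R\<close> the nonzero rows are exactly those of
      \<open>G2\<close>, with b at index q supplied by the top row q; the left half is treated
      afterwards with \<open>G1\<close>.\<close>
    have y: "(if k = q then v q else v (r + k)) = 0" if "k < r" for k
    proof (rule GL_left_kernel[OF G2(1) _ that, where v = "\<lambda>k. if k = q then v q else v (r + k)"])
      fix j assume j: "j < r"
      have "(\<Sum>k<r. (if k = q then v q else v (r + k)) * G2 $$ (k,j))
          = (\<Sum>k<r. (if k = q then v q * b j else 0) + (if k = q then 0 else v (r + k) * G2 $$ (k,j)))"
        using G2(2)[OF j] by (intro sum.cong) auto
      also have "\<dots> = (\<Sum>i<?N. v i * R $$ (i, r + j))"
        unfolding sp sum.distrib using j q Rt
        by (intro arg_cong2[where f = plus] sum.cong refl) (auto simp: bb_def)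
      finally show "(\<Sum>k<r. (if k = q then v q else v (r + k)) * G2 $$ (k,j)) = 0" using v j by simp
    qed
    have vq: "v q = 0" using y[OF q] by simp
    have y2: "(if k = q then - v (r + q) else v k) = 0" if "k < r" for k
    proof (rule GL_left_kernel[OF G1 _ that, where v = "\<lambda>k. if k = q then - v (r + q) else v k"])
      fix j assume j: "j < r"
      have "(\<Sum>k<r. (if k = q then - v (r + q) else v k) * G1 $$ (k,j))
          = (\<Sum>k<r. (if k = q then 0 else v k * G1 $$ (k,j)) + (if k = q then - v (r + q) * G1 $$ (q,j) else 0))"
        by (intro sum.cong) auto
      also have "\<dots> = (\<Sum>i<?N. v i * R $$ (i, j))"
        unfolding sp sum.distrib using j q Rt vq
        by (intro arg_cong2[where f = plus] sum.cong refl) (auto simp: tt_def)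
      finally show "(\<Sum>k<r. (if k = q then - v (r + q) else v k) * G1 $$ (k,j)) = 0" using v j by simp
    qed
    have 1: "v k = 0" if "k < r" for k using y2[OF that] vq by (cases "k = q") auto
    have 2: "v (r + k) = 0" if "k < r" for k using y[OF that] y2[OF q] by (cases "k = q") auto
    show "v i = 0" using 1[of i] 2[of "i - r"] i by (cases "i < r") auto
  qed

  define W1 where "W1 = (\<lambda>M. G1 * M * transpose_mat G2) ` W"
  have W1: "optimal_invertible_affine r W1"
    unfolding W1_def by (rule optimal_invertible_affine_equiv[OF W G1 GL_transpose[OF G2(1)]])
  have W1e: "(G1 * M * transpose_mat G2) $$ (i,j) = (\<Sum>k<r. \<Sum>l<r. G1 $$ (i,k) * M $$ (k,l) * G2 $$ (j,l))"
    if M: "M \<in> carrier_mat r r" and ij: "i < r" "j < r" for M i j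
  proof -
    note g = GL_carrier[OF G1] GL_carrier[OF G2(1)]
    have "(G1 * M * transpose_mat G2) $$ (i,j) = (\<Sum>l<r. (G1 * M) $$ (i,l) * transpose_mat G2 $$ (l,j))"
      using g M ij by (intro mat_mult_index) auto
    also have "\<dots> = (\<Sum>l<r. \<Sum>k<r. G1 $$ (i,k) * M $$ (k,l) * G2 $$ (j,l))"
      using g ij by (intro sum.cong) (auto simp: mat_mult_index[OF g(1) M] sum_distrib_right simp del: index_mult_mat(1))
    finally show ?thesis by (subst sum.swap)
  qed
  have W1z: "M1 $$ (j,q) = 0" if t: "M1 \<in> W1" "j < r" "j \<noteq> q" for M1 j
  proof -
    obtain M where M: "M \<in> W" "M1 = G1 * M * transpose_mat G2" using t(1) by (auto simp: W1_def)
    obtain A where A: "A \<in> bul r 0 W CC" "blk A 0 r (r + 0) r = M"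
      using bul_ex[OF Wc(1) CD(1) M(1)] CD(3) by blast
    have Mk: "M $$ (k,l) = A $$ (k, r + l)" if "k < r" "l < r" for k l using that by (simp add: A(2)[symmetric])
    have "M1 $$ (j,q) = (\<Sum>k<r. \<Sum>l<r. a j k * A $$ (k, r + l) * b l)"
      using M Wc t q G2(2) Mk by (simp add: M(2) W1e subsetD[OF Wc(1)] G1a)
    then show ?thesis using key[OF A(1) t(2)] by simp
  qed
  \<comment> \<open>The inclusion is enough: the left side is optimal and the right side
    symplectic.\<close>
  have sub: "cong_mat R ` bul r 0 W CC \<subseteq> bul r 0 W1 CC"
  proof
    fix B assume "B \<in> cong_mat R ` bul r 0 W CC"
    then obtain A where A: "A \<in> bul r 0 W CC" and B: "B = cong_mat R A" by auto
    let ?M = "blk A 0 r (r + 0) r"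
    have Bal: "B \<in> alternating_mats ?N" unfolding B by (rule cong_mat_alternating[OF Rc bulD(1)[OF A]])
    have Alow: "A $$ (r + k, l) = - A $$ (l, r + k)" if "k < r" "l < r" for k l
      by (rule alternating_matsD(2)[OF bulD(1)[OF A]]) (use that in auto)
    have Be: "B $$ (i,j) = (\<Sum>k<r. (\<Sum>l<r. tt i k * A $$ (k,r + l) * bb j l))
        + (\<Sum>k<r. (\<Sum>l<r. bb i k * A $$ (r + k,l) * tt j l) + (\<Sum>l<r. bb i k * A $$ (r + k, r + l) * bb j l))"
      if ij: "i < ?N" "j < ?N" for i j
      unfolding B cong_mat_index[OF Rc bulD(5)[OF A] ij] sp
      using Rt[OF ij(1)] Rt[OF ij(2)] bulD(2)[OF A] by (simp add: sum.distrib)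
    \<comment> \<open>Row i of \<open>R\<close> is (\<open>a i\<close>, 0), which pairs to zero with
      the part x q e of row q; what remains is the expression of \<open>key\<close>.\<close>
    have B0: "B $$ (i,q) = 0" if i: "i < r" "i \<noteq> q" for i
    proof -
      have "B $$ (i,q) = (\<Sum>k<r. \<Sum>l<r. a i k * A $$ (k, r + l) * b l)"
        using i q G1a[OF i(1) _ i(2)] by (subst Be) (auto simp: tt_def bb_def)
      then show ?thesis using key[OF A i(1)] by simp
    qed
    have Bz: "B $$ (i,j) = 0" if ij: "i < r" "j < r" for i j
    proof -
      consider "i \<noteq> q" "j \<noteq> q" | "i \<noteq> q" "j = q" | "i = q" "j \<noteq> q" | "i = q" "j = q" by blast
      then show ?thesis
      proof cases
        case 1 then show ?thesis using ij by (subst Be) (auto simp: bb_def)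
      next
        case 2 then show ?thesis using B0 ij by simp
      next
        case 3
        have "B $$ (i,j) = - B $$ (j,i)" by (rule alternating_matsD(2)[OF Bal]) (use ij in auto)
        then show ?thesis using B0[of j] 3 ij by simp
      next
        case 4 then show ?thesis using alternating_matsD(3)[OF Bal, of q] q by simp
      qed
    qed
    have Mc: "?M \<in> carrier_mat r r" by simp
    \<comment> \<open>Row q of this block also involves x q and the block D of A outside the
      diagonal, so it need not agree there with G1 M G2^T. The freedom in row q of \<open>W1\<close>
      absorbs the difference.\<close>
    have "blk B 0 r (r + 0) r \<in> W1"
    proof (rule optimal_row_closed[OF W1 q W1z])
      show "G1 * ?M * transpose_mat G2 \<in> W1" using bulD(3)[OF A] by (auto simp: W1_def)
      fix i j assume ij: "i < r" "j < r" "i \<noteq> q \<or> j = q"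
      have e: "(G1 * ?M * transpose_mat G2) $$ (i,j) = (\<Sum>k<r. \<Sum>l<r. G1 $$ (i,k) * A $$ (k,r + l) * G2 $$ (j,l))"
        unfolding W1e[OF Mc ij(1,2)] by simp
      have bl: "blk B 0 r (r + 0) r $$ (i,j) = B $$ (i, r + j)" using ij by simp
      consider "i \<noteq> q" "j \<noteq> q" | "i \<noteq> q" "j = q" | "i = q" "j = q" using ij by blast
      then show "blk B 0 r (r + 0) r $$ (i,j) = (G1 * ?M * transpose_mat G2) $$ (i,j)"
      proof cases
        case 1 then show ?thesis unfolding bl e using ij by (subst Be) (auto simp: tt_def bb_def)
      next
        case 2
        have "(G1 * ?M * transpose_mat G2) $$ (i,j) = 0"
          using W1z[of "G1 * ?M * transpose_mat G2" i] bulD(3)[OF A] 2 ij by (auto simp: W1_def)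
        then show ?thesis unfolding bl using ij 2 by (subst Be) (auto simp: tt_def bb_def)
      next
        case 3
        \<comment> \<open>The sign in -e compensates the exchange of the arguments of the
          alternating form, so the diagonal entry keeps its value.\<close>
        have "B $$ (q, r + q) = (\<Sum>k<r. \<Sum>l<r. b k * A $$ (r + k,l) * (- G1 $$ (q,l)))"
          using q by (subst Be) (auto simp: tt_def bb_def)
        also have "\<dots> = (\<Sum>k<r. \<Sum>l<r. G1 $$ (q,l) * A $$ (l,r + k) * G2 $$ (q,k))"
          by (intro sum.cong refl) (simp add: Alow G2(2) mult.commute mult.left_commute)
        also have "\<dots> = (\<Sum>k<r. \<Sum>l<r. G1 $$ (q,k) * A $$ (k,r + l) * G2 $$ (q,l))" by (rule sum.swap)
        finally show ?thesis unfolding bl e using 3 by simp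
      qed
    qed (assumption | rule blk_carrier(1))+
    moreover have "blk B r 0 r 0 \<in> CC"
    proof -
      have "blk B r 0 r 0 = blk A r 0 r 0" by (intro eq_matI) auto
      then show ?thesis using bulD(4)[OF A] by simp
    qed
    ultimately show "B \<in> bul r 0 W1 CC" using Bal Bz by (simp add: bul_def)
  qed
  have W1i: "invertible_affine r W1" using W1 by (simp add: optimal_invertible_affine_def)
  have Seq: "cong_mat R ` bul r 0 W CC = bul r 0 W1 CC"
    by (rule optimal_symplectic_affine_eq[OF optimal_symplectic_affine_cong[OF O RG] symplectic_affine_bul[OF W1i C] sub])

  obtain Ri where Ri: "Ri \<in> GL ?N" "R * Ri = 1\<^sub>m ?N" "Ri * R = 1\<^sub>m ?N" using GL_inverse[OF RG] by blast
  note Ric = GL_carrier[OF Ri(1)]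
  let ?Z = "P * Ri"
  have Zg: "?Z \<in> GL ?N" by (rule GL_mult[OF P Ri(1)])
  have ZR: "?Z * R = P" using Pc Ric Rc Ri(3) by (simp add: assoc_mult_mat[of _ ?N ?N _ ?N _ ?N])
  have S2: "bul r 0 W' CC' = cong_mat ?Z ` bul r 0 W1 CC"
  proof -
    have "cong_mat ?Z (cong_mat R A) = cong_mat P A" if "A \<in> bul r 0 W CC" for A
      using cong_mat_mult[OF GL_carrier[OF Zg] Rc bulD(5)[OF that]] unfolding ZR .
    then show ?thesis unfolding S Seq[symmetric] image_image by (intro image_cong) auto
  qed
  \<comment> \<open>Coordinates of the top rows of \<open>P\<close> in the top rows of
    \<open>R\<close>: row q of \<open>P\<close> has coefficient 1 at q and x k elsewhere, and row j
    is c j times row q plus (\<open>a j\<close>, 0). The top rows of \<open>?Z\<close> are therefore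
    (T, 0).\<close>
  define T where "T j k = c j * (if k = q then 1 else x k) + (if k = j \<and> j \<noteq> q then 1 else 0)" for j k
  have PT: "P $$ (j,m) = (\<Sum>k<r. T j k * R $$ (k,m))" if j: "j < r" and m: "m < ?N" for j m
  proof (cases "m < r")
    case True
    have "(\<Sum>k<r. T j k * R $$ (k,m)) = (\<Sum>k<r. c j * (x k * G1 $$ (k,m)) + (if k = j then (if j \<noteq> q then G1 $$ (j,m) else 0) else 0))"
      using True Rt(1) j by (intro sum.cong) (auto simp: T_def tt_def algebra_simps)
    also have "\<dots> = c j * P $$ (q,m) + (if j \<noteq> q then G1 $$ (j,m) else 0)"
      using j x[OF True] by (simp add: sum.distrib sum_distrib_left[symmetric])
    also have "\<dots> = P $$ (j,m)" using G1a[OF j True] cq by (auto simp: a_def)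
    finally show ?thesis by simp
  next
    case False
    then obtain m' where m': "m = r + m'" "m' < r" using m by (metis add_0_right add_diff_inverse_nat add_less_cancel_left)
    have "(\<Sum>k<r. T j k * R $$ (k,m)) = (\<Sum>k<r. if k = q then c j * b m' else 0)"
      using m' Rt(2) j by (intro sum.cong) (auto simp: T_def bb_def)
    also have "\<dots> = P $$ (j,m)" using q col[OF j, of m] m' by (simp add: b_def)
    finally show ?thesis by simp
  qed
  have Zz: "?Z $$ (j,l) = 0" if j: "j < r" and l: "r \<le> l" "l < r + 0 + r" for j l
  proof -
    have "?Z $$ (j,l) = (\<Sum>m<?N. \<Sum>k<r. T j k * R $$ (k,m) * Ri $$ (m,l))"
      using j l by (subst mat_mult_index[OF Pc Ric]) (auto simp: PT sum_distrib_right intro!: sum.cong)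
    also have "\<dots> = (\<Sum>k<r. \<Sum>m<?N. T j k * R $$ (k,m) * Ri $$ (m,l))" by (rule sum.swap)
    also have "\<dots> = (\<Sum>k<r. T j k * (R * Ri) $$ (k,l))"
      using l by (intro sum.cong refl, subst mat_mult_index[OF Rc Ric]) (auto simp: sum_distrib_left mult.assoc)
    also have "\<dots> = 0" unfolding Ri(2) using l by (intro sum.neutral) auto
    finally show ?thesis .
  qed
  have "equivalent_mats r W1 W' \<and> congruent_mats 0 CC CC'"
    by (rule bul_lower_triangular_unique[OF W1i C W' C' Zg S2 Zz])
  moreover from this obtain X Y where XY: "X \<in> GL r" "Y \<in> GL r" "W' = (\<lambda>M. X * M * Y) ` W1" by (auto simp: equivalent_mats_def)
  have "W' = (\<lambda>M. (X * G1) * M * (transpose_mat G2 * Y)) ` W"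
    unfolding XY(3) W1_def image_image
  proof (rule image_cong[OF refl])
    fix M assume "M \<in> W"
    then have M: "M \<in> carrier_mat r r" using Wc by auto
    note c = GL_carrier[OF XY(1)] GL_carrier[OF XY(2)] GL_carrier[OF G1] GL_carrier[OF GL_transpose[OF G2(1)]]
    have "M * transpose_mat G2 \<in> carrier_mat r r" using M c by auto
    moreover from this have "G1 * (M * transpose_mat G2) \<in> carrier_mat r r" using c by auto
    ultimately show "X * (G1 * M * transpose_mat G2) * Y = (X * G1) * M * (transpose_mat G2 * Y)"
      using c M by (simp add: assoc_mult_mat[of _ r r _ r _ r])
  qed
  then have "equivalent_mats r W W'"
    using GL_mult[OF XY(1) G1] GL_mult[OF GL_transpose[OF G2(1)] XY(2)] by (auto simp: equivalent_mats_def)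
  ultimately show ?thesis by simp
qed

section \<open>Comparison of two decompositions\<close>

lemma cong_mat_image_inverse:
  assumes P: "P \<in> GL k" and S: "S \<subseteq> carrier_mat k k" and T: "T = cong_mat P ` S"
  obtains Q where "Q \<in> GL k" "S = cong_mat Q ` T"
proof -
  obtain Q where Q: "Q \<in> GL k" "Q * P = 1\<^sub>m k" using GL_inverse[OF P] by blast
  have "cong_mat Q (cong_mat P A) = A" if "A \<in> S" for A
    using cong_mat_mult[OF GL_carrier[OF Q(1)] GL_carrier[OF P], of A] cong_mat_one[of A k] Q(2) S that by auto
  then have "S = cong_mat Q ` T" unfolding T image_image by simp
  then show thesis using that Q(1) by blast
qed

text \<open>With a zero top right block, the first r' rows of \<open>P\<close> are independent and
  carried by the first r columns. The inequality is meant to be used for a congruence and its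
  inverse.\<close>

lemma bul_congruent_corank_le:
  fixes P :: "'a::field mat"
  assumes W: "invertible_affine r W" and C: "symplectic_affine s CC" "irreducible_mats s CC" "even s"
    and W': "invertible_affine r' W'" and C': "symplectic_affine s' CC'" "irreducible_mats s' CC'" "even s'"
    and N: "r' + s' + r' = r + s + r" and P: "P \<in> GL (r + s + r)"
    and S: "bul r' s' W' CC' = cong_mat P ` bul r s W CC"
  shows "r' \<le> r"
proof (cases "\<exists>q l0. q < r' \<and> r + s \<le> l0 \<and> l0 < r + s + r \<and> P $$ (q,l0) \<noteq> 0")
  case True
  have "bul r s W CC \<noteq> {}"
    using symplectic_affineD(3)[OF symplectic_affine_bul[OF W C(1)]] .
  then show ?thesis using bul_top_right_nonzero[OF _ N P S C C'] True by auto
next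
  case False
  have z: "P $$ (i,k) = 0" if "i < r'" "r \<le> k" "k < r + s + r" for i k
    by (rule irreducible_rows_eq_0[OF W C(1,2) C'(1) N P S _ W' that]) (use False in blast)
  show ?thesis
  proof (rule GL_rows_support[OF P, where f = "\<lambda>i. i" and g = "\<lambda>i. i"])
    show "P $$ (i,j) = 0" if "i < r'" "j < r + s + r" "j \<notin> (\<lambda>i. i) ` {..<r}" for i j
      using z that by simp
  qed (use N in auto)
qed

lemma bul_congruent_unique:
  fixes P :: "'a::field mat"
  assumes W: "optimal_invertible_affine r W" and C: "symplectic_affine s CC" "irreducible_mats s CC" "even s"
    and W': "invertible_affine r' W'" and C': "symplectic_affine s' CC'" "irreducible_mats s' CC'" "even s'"
    and O: "optimal_symplectic_affine (r + s + r) (bul r s W CC)"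
    and N: "r' + s' + r' = r + s + r" and P: "P \<in> GL (r + s + r)"
    and S: "bul r' s' W' CC' = cong_mat P ` bul r s W CC"
  shows "r = r' \<and> equivalent_mats r W W' \<and> congruent_mats s CC CC'"
proof -
  have Wi: "invertible_affine r W" using W by (simp add: optimal_invertible_affine_def)
  have "bul r s W CC \<subseteq> carrier_mat (r + s + r) (r + s + r)" using bulD(5) by blast
  then obtain Q where Q: "Q \<in> GL (r + s + r)" "bul r s W CC = cong_mat Q ` bul r' s' W' CC'"
    using cong_mat_image_inverse[OF P _ S] by blast
  have "r' \<le> r" by (rule bul_congruent_corank_le[OF Wi C W' C' N P S])
  moreover have "r \<le> r'"
    by (rule bul_congruent_corank_le[OF W' C' Wi C N[symmetric] _ Q(2)]) (use Q(1) N in simp)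
  ultimately have r: "r' = r" by simp
  then have s: "s' = s" using N by simp
  note S' = S[unfolded r s] and W2 = W'[unfolded r] and C2 = C'[unfolded s]
  show ?thesis
  proof (cases "\<exists>q l0. q < r \<and> r + s \<le> l0 \<and> l0 < r + s + r \<and> P $$ (q,l0) \<noteq> 0")
    case True
    then obtain q l0 where q: "q < r" "r + s \<le> l0" "l0 < r + s + r" "P $$ (q,l0) \<noteq> 0" by blast
    have "bul r s W CC \<noteq> {}"
      using symplectic_affineD(3)[OF symplectic_affine_bul[OF Wi C(1)]] .
    then have s0: "s = 0" using bul_top_right_nonzero[OF _ refl P S' C C2 q] by simp
    have "equivalent_mats r W W' \<and> congruent_mats 0 CC CC'"
      by (rule bul_0_equivalent[OF W C(1)[unfolded s0] W2 C2(1)[unfolded s0] O[unfolded s0] P[unfolded s0] S'[unfolded s0] q(1) _ _ q(4)])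
        (use q s0 in auto)
    then show ?thesis using r s0 by simp
  next
    case False
    have z: "P $$ (i,k) = 0" if "i < r" "r \<le> k" "k < r + s + r" for i k
      by (rule irreducible_rows_eq_0[OF Wi C(1,2) C2(1) refl P S' _ W2 that]) (use False in blast)
    show ?thesis using bul_lower_triangular_unique[OF Wi C(1) W2 C2(1) P S' z] r by blast
  qed
qed

lemma bullet_decompositionD:
  fixes S :: "'a::field mat set"
  assumes D: "bullet_decomposition n S r W CC"
  defines "s \<equiv> 2 * (n - r)"
  obtains P where "P \<in> GL (2 * n)" "bul r s W CC = cong_mat P ` S" "r + s + r = 2 * n"
    "optimal_invertible_affine r W" "symplectic_affine s CC" "irreducible_mats s CC" "even s"
proof -
  have d: "r \<le> n" "optimal_invertible_affine r W" "optimal_symplectic_affine s CC" "irreducible_mats s CC"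
    "congruent_mats (2 * n) S (bullet r (n - r) W CC)"
    using D by (auto simp: bullet_decomposition_def s_def)
  have C: "symplectic_affine s CC" using d(3) by (simp add: optimal_symplectic_affine_def)
  have "W \<subseteq> carrier_mat r r" using d(2) affine_subspace_matD(2)
    by (auto simp: optimal_invertible_affine_def invertible_affine_def)
  then have "bullet r (n - r) W CC = bul r s W CC"
    using symplectic_affineD(1)[OF C] unfolding s_def by (rule bullet_eq_bul)
  then obtain P where "P \<in> GL (2 * n)" "bul r s W CC = cong_mat P ` S"
    using d(5) by (auto simp: congruent_mats_iff)
  then show thesis by (rule that) (use d C in \<open>auto simp: s_def\<close>)
qed

lemma bullet_decomposition_unique:
  fixes S :: "'a::field mat set"
  assumes O: "optimal_symplectic_affine (2 * n) S"
    and D: "bullet_decomposition n S r W CC" and D': "bullet_decomposition n S r' W' CC'"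
  shows "r = r' \<and> equivalent_mats r W W' \<and> congruent_mats (2 * (n - r)) CC CC'"
proof -
  let ?s = "2 * (n - r)" and ?s' = "2 * (n - r')"
  obtain P where P: "P \<in> GL (2 * n)" "bul r ?s W CC = cong_mat P ` S" "r + ?s + r = 2 * n"
    "optimal_invertible_affine r W" "symplectic_affine ?s CC" "irreducible_mats ?s CC" "even ?s"
    using bullet_decompositionD[OF D] by blast
  obtain P' where P': "P' \<in> GL (2 * n)" "bul r' ?s' W' CC' = cong_mat P' ` S" "r' + ?s' + r' = 2 * n"
    "optimal_invertible_affine r' W'" "symplectic_affine ?s' CC'" "irreducible_mats ?s' CC'" "even ?s'"
    using bullet_decompositionD[OF D'] by blast
  have Sc: "S \<subseteq> carrier_mat (2 * n) (2 * n)"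
    using O affine_subspace_matD(2) by (auto simp: optimal_symplectic_affine_def symplectic_affine_def)
  obtain Q where Q: "Q \<in> GL (2 * n)" "S = cong_mat Q ` bul r ?s W CC"
    using cong_mat_image_inverse[OF P(1) Sc P(2)] by blast
  have N: "r' + ?s' + r' = r + ?s + r" using P(3) P'(3) by simp
  have O': "optimal_symplectic_affine (r + ?s + r) (bul r ?s W CC)"
    unfolding P(2,3) by (rule optimal_symplectic_affine_cong[OF O P(1)])
  \<comment> \<open>The congruence between the two sets passes through \<open>S\<close>:
    \<open>Q\<close> leads from the first set back to \<open>S\<close> and \<open>P'\<close> from
    \<open>S\<close> to the second.\<close>
  have g: "P' * Q \<in> GL (r + ?s + r)" unfolding P(3) by (rule GL_mult[OF P'(1) Q(1)])
  have "cong_mat P' (cong_mat Q A) = cong_mat (P' * Q) A" if "A \<in> bul r ?s W CC" for A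
    using bulD(5)[OF that] unfolding P(3) by (rule cong_mat_mult[OF GL_carrier[OF P'(1)] GL_carrier[OF Q(1)]])
  then have S2: "bul r' ?s' W' CC' = cong_mat (P' * Q) ` bul r ?s W CC"
    unfolding P'(2) Q(2) image_image by (intro image_cong refl)
  have W': "invertible_affine r' W'" using P'(4) by (simp add: optimal_invertible_affine_def)
  show ?thesis by (rule bul_congruent_unique[OF P(4-7) W' P'(5-7) O' N g S2])
qed
theorem theorem1p6:
  fixes n :: nat and \<S> :: "'a::field mat set"
  assumes "infinite (UNIV :: 'a set) \<or> int (card (UNIV :: 'a set)) > 2 * int n - 2"
    and "optimal_symplectic_affine (2 * n) \<S>"
  shows "(\<exists>r \<W> \<C>. bullet_decomposition n \<S> r \<W> \<C>)
    \<and> (\<forall>r \<W> \<C> r' \<W>' \<C>'.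
         bullet_decomposition n \<S> r \<W> \<C> \<and> bullet_decomposition n \<S> r' \<W>' \<C>' \<longrightarrow>
           r = r' \<and> equivalent_mats r \<W> \<W>' \<and> congruent_mats (2 * (n - r)) \<C> \<C>')"
  using bullet_decomposition_exists[OF assms(2)] bullet_decomposition_unique[OF assms(2)] by blast

end
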